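(* Let $\Gamma_\alpha$ be a compact (not necessarily connected) quantum graph with a distinguished vertex $v$, with arbitrary self-adjoint conditions fixed at all vertices other than $v$ and the $\delta$-type condition with coefficient $\alpha$ at $v$. Let $\Gamma_{\alpha'}$ be the graph obtained from $\Gamma_\alpha$ by changing the coefficient of the condition at $v$ from $\alpha$ to $\alpha'$. If $-\infty<\alpha<\alpha'\le\infty$ (where $\alpha'=\infty$ corresponds to the Dirichlet condition at $v$), then for every $n\geq 1$ $$\lambda_n(\Gamma_\alpha)\le\lambda_n(\Gamma_{\alpha'})\le\lambda_{n+1}(\Gamma_\alpha).$$ If the eigenvalue $\lambda_n(\Gamma_{\alpha'})$ is simple and its eigenfunction $f$ is such that either $f(v)$ or $\sum_{e\in\mathcal{E}_v}\frac{df}{dx_e}(v)$ is non-zero, then the inequalities can be made strict: $$\lambda_n(\Gamma_\alpha)<\lambda_n(\Gamma_{\alpha'})<\lambda_{n+1}(\Gamma_\alpha).$$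
   Context: A compact quantum graph is a metric graph with finitely many vertices and edges, each edge $e$ being a segment of finite positive length, equipped with the operator $\mathcal{H}$ acting as $-d^2/dx^2+V(x)$ on each edge, where $V\in L_2(\Gamma)$ is real-valued, on functions that belong to $H^2(e)$ on each edge $e$ and satisfy local self-adjoint vertex conditions. Self-adjoint conditions at a vertex $w$ of degree $d_w$ are conditions $A_wF(w)+B_wF'(w)=0$, where $F(w)$ and $F'(w)$ are the column vectors of values and of derivatives of $f$ at $w$ along the incident edges, $A_w,B_w$ are $d_w\times d_w$ complex matrices, $(A_w\ B_w)$ has rank $d_w$ and $A_wB_w^*$ is self-adjoint. The eigenvalues $\lambda_n(\Gamma)$, $n\ge1$, of $\mathcal{H}$ are labeled in non-decreasing order, counting multiplicity. $\mathcal{E}_v$ is the set of edges incident to $v$; derivatives $\frac{df}{dx_e}(v)$ are taken away from the vertex and into the edge. The $\delta$-type condition at $v$ with coefficient $\alpha\in\mathbb{R}$ is: $f$ is continuous at $v$ and $\sum_{e\in\mathcal{E}_v}\frac{df}{dx_e}(v)=\alpha f(v)$. The Dirichlet condition at $v$ ($\alpha=\infty$) is $f(v)=0$ along all incident edges. *)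

theory Defs
  imports
    "HOL-Analysis.Analysis"
    "HOL-Library.Function_Algebras"
    "Graph_Theory.Digraph"
    "Jordan_Normal_Form.Schur_Decomposition"
    "Jordan_Normal_Form.DL_Rank"
begin

section \<open>Compact quantum graphs\<close>

text \<open>
  Loops and parallel edges are allowed; the direction of an arc \<open>e\<close> only serves to identify
  the edge with \<open>{0..len e}\<close> (\<open>0\<close> at the tail, \<open>len e\<close> at the head).
  Edges meet vertices in \<^emph>\<open>edge ends\<close>: a loop has two ends at its vertex and contributes
  2 to the degree.
\<close>

datatype side = Init | Term

text \<open>
  The list \<open>ends w\<close> fixes the order in which the edge ends at \<open>w\<close> index the vectors
  \<open>F(w)\<close> and \<open>F'(w)\<close>.  The vertex condition \<open>vcond w\<close> is a relation between these two vectors.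
\<close>

record ('v, 'e) quantum_graph =
  skeleton :: "('v, 'e) pre_digraph"
  len :: "'e \<Rightarrow> real"
  potential :: "'e \<Rightarrow> real \<Rightarrow> real"
  ends :: "'v \<Rightarrow> ('e \<times> side) list"
  vcond :: "'v \<Rightarrow> complex Matrix.vec \<Rightarrow> complex Matrix.vec \<Rightarrow> bool"

definition edge_ends_at :: "('v, 'e) pre_digraph \<Rightarrow> 'v \<Rightarrow> ('e \<times> side) set" where
  "edge_ends_at G w =
     {(e, Init) | e. e \<in> arcs G \<and> tail G e = w} \<union> {(e, Term) | e. e \<in> arcs G \<and> head G e = w}"

abbreviation deg :: "('v, 'e) quantum_graph \<Rightarrow> 'v \<Rightarrow> nat" where
  "deg \<Gamma> w \<equiv> length (ends \<Gamma> w)"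

definition square_integrable_on ::
    "(real \<Rightarrow> 'b :: {banach, second_countable_topology}) \<Rightarrow> real set \<Rightarrow> bool" where
  "square_integrable_on g S \<longleftrightarrow>
     g \<in> borel_measurable (lebesgue_on S) \<and> integrable (lebesgue_on S) (\<lambda>x. (norm (g x))\<^sup>2)"


subsection \<open>Vertex conditions\<close>

text \<open>The \<open>d \<times> 2d\<close> matrix \<open>(A B)\<close>.\<close>

definition juxtapose :: "nat \<Rightarrow> complex mat \<Rightarrow> complex mat \<Rightarrow> complex mat" where
  "juxtapose d A B = four_block_mat A B (0\<^sub>m 0 d) (0\<^sub>m 0 d)"

definition self_adjoint_cond ::
    "nat \<Rightarrow> (complex Matrix.vec \<Rightarrow> complex Matrix.vec \<Rightarrow> bool) \<Rightarrow> bool" where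
  "self_adjoint_cond d C \<longleftrightarrow>
     (\<exists>A \<in> carrier_mat d d. \<exists>B \<in> carrier_mat d d.
        vec_space.rank d (juxtapose d A B) = d \<and>
        mat_adjoint (A * mat_adjoint B) = A * mat_adjoint B \<and>
        (\<forall>F \<in> carrier_vec d. \<forall>F' \<in> carrier_vec d.
           C F F' \<longleftrightarrow> A *\<^sub>v F + B *\<^sub>v F' = 0\<^sub>v d))"

text \<open>
  The \<open>\<delta>\<close>-type condition with coefficient \<open>a \<noteq> -\<infinity>\<close>; the value \<open>a = \<infinity>\<close> is the Dirichlet
  condition.  Continuity at the vertex says that all entries of \<open>F\<close> equal one number \<open>c\<close>.
\<close>

definition delta_cond :: "ereal \<Rightarrow> complex Matrix.vec \<Rightarrow> complex Matrix.vec \<Rightarrow> bool" where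
  "delta_cond a F F' \<longleftrightarrow>
     (if a = \<infinity> then (\<forall>i < dim_vec F. vec_index F i = 0)
      else (\<exists>c. (\<forall>i < dim_vec F. vec_index F i = c) \<and>
                (\<Sum>i < dim_vec F'. vec_index F' i) = complex_of_real (real_of_ereal a) * c))"

definition with_delta :: "('v, 'e) quantum_graph \<Rightarrow> 'v \<Rightarrow> ereal \<Rightarrow> ('v, 'e) quantum_graph" where
  "with_delta \<Gamma> v a = \<Gamma>\<lparr>vcond := (vcond \<Gamma>)(v := delta_cond a)\<rparr>"

text \<open>Connectedness is not required.  A graph without edges has no eigenvalues and is excluded.\<close>

definition compact_quantum_graph :: "('v, 'e) quantum_graph \<Rightarrow> bool" where
  "compact_quantum_graph \<Gamma> \<longleftrightarrow>
     fin_digraph (skeleton \<Gamma>) \<and> arcs (skeleton \<Gamma>) \<noteq> {} \<and>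
     (\<forall>e \<in> arcs (skeleton \<Gamma>).
        0 < len \<Gamma> e \<and> square_integrable_on (potential \<Gamma> e) {0..len \<Gamma> e}) \<and>
     (\<forall>w \<in> verts (skeleton \<Gamma>).
        distinct (ends \<Gamma> w) \<and> set (ends \<Gamma> w) = edge_ends_at (skeleton \<Gamma>) w \<and>
        self_adjoint_cond (deg \<Gamma> w) (vcond \<Gamma> w))"


subsection \<open>The operator\<close>

text \<open>
  \<open>u \<in> H\<^sup>2(0,l)\<close> with second derivative \<open>h \<in> L\<^sub>2(0,l)\<close>: the representative \<open>u\<close> is continuously
  differentiable up to the end points and \<open>u'\<close> is the indefinite integral of \<open>h\<close>.
\<close>

definition H2_with_second_deriv ::
    "real \<Rightarrow> (real \<Rightarrow> complex) \<Rightarrow> (real \<Rightarrow> complex) \<Rightarrow> bool" where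
  "H2_with_second_deriv l u h \<longleftrightarrow>
     square_integrable_on h {0..l} \<and>
     (\<exists>u'. \<forall>x \<in> {0..l}.
        (u has_vector_derivative u' x) (at x within {0..l}) \<and>
        u' x = u' 0 + integral\<^sup>L (lebesgue_on {0..x}) h)"

fun end_value :: "('v, 'e) quantum_graph \<Rightarrow> ('e \<Rightarrow> real \<Rightarrow> complex) \<Rightarrow> 'e \<times> side \<Rightarrow> complex" where
  "end_value \<Gamma> f (e, Init) = f e 0"
| "end_value \<Gamma> f (e, Term) = f e (len \<Gamma> e)"

text \<open>Derivatives are taken away from the vertex, into the edge.\<close>

fun end_deriv :: "('v, 'e) quantum_graph \<Rightarrow> ('e \<Rightarrow> real \<Rightarrow> complex) \<Rightarrow> 'e \<times> side \<Rightarrow> complex" where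
  "end_deriv \<Gamma> f (e, Init) = vector_derivative (f e) (at 0 within {0..len \<Gamma> e})"
| "end_deriv \<Gamma> f (e, Term) = - vector_derivative (f e) (at (len \<Gamma> e) within {0..len \<Gamma> e})"

definition vertex_values ::
    "('v, 'e) quantum_graph \<Rightarrow> ('e \<Rightarrow> real \<Rightarrow> complex) \<Rightarrow> 'v \<Rightarrow> complex Matrix.vec" where
  "vertex_values \<Gamma> f w = vec_of_list (map (end_value \<Gamma> f) (ends \<Gamma> w))"

definition vertex_derivs ::
    "('v, 'e) quantum_graph \<Rightarrow> ('e \<Rightarrow> real \<Rightarrow> complex) \<Rightarrow> 'v \<Rightarrow> complex Matrix.vec" where
  "vertex_derivs \<Gamma> f w = vec_of_list (map (end_deriv \<Gamma> f) (ends \<Gamma> w))"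

text \<open>
  Functions on the graph are total functions that vanish off the graph, so that equality of
  functions (and hence the dimension of a space of functions) is the intended one.
\<close>

definition operator_domain :: "('v, 'e) quantum_graph \<Rightarrow> ('e \<Rightarrow> real \<Rightarrow> complex) set" where
  "operator_domain \<Gamma> =
     {f. (\<forall>e x. e \<notin> arcs (skeleton \<Gamma>) \<or> x \<notin> {0..len \<Gamma> e} \<longrightarrow> f e x = 0) \<and>
         (\<forall>e \<in> arcs (skeleton \<Gamma>). \<exists>h. H2_with_second_deriv (len \<Gamma> e) (f e) h) \<and>
         (\<forall>w \<in> verts (skeleton \<Gamma>). vcond \<Gamma> w (vertex_values \<Gamma> f w) (vertex_derivs \<Gamma> f w))}"

text \<open>\<open>f\<close> lies in the domain and \<open>- f'' + V f = g\<close> in \<open>L\<^sub>2\<close> of the graph.\<close>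

definition maps_to ::
    "('v, 'e) quantum_graph \<Rightarrow> ('e \<Rightarrow> real \<Rightarrow> complex) \<Rightarrow> ('e \<Rightarrow> real \<Rightarrow> complex) \<Rightarrow> bool" where
  "maps_to \<Gamma> f g \<longleftrightarrow>
     f \<in> operator_domain \<Gamma> \<and>
     (\<forall>e \<in> arcs (skeleton \<Gamma>). \<exists>h. H2_with_second_deriv (len \<Gamma> e) (f e) h \<and>
        (AE x in lebesgue_on {0..len \<Gamma> e}.
           - h x + complex_of_real (potential \<Gamma> e x) * f e x = g e x))"


subsection \<open>Eigenvalues\<close>

definition scale_fun :: "complex \<Rightarrow> ('e \<Rightarrow> real \<Rightarrow> complex) \<Rightarrow> 'e \<Rightarrow> real \<Rightarrow> complex" where
  "scale_fun c f = (\<lambda>e x. c * f e x)"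

interpretation graph_fun: vector_space scale_fun
  by unfold_locales (auto simp: scale_fun_def fun_eq_iff algebra_simps)

definition eigenspace :: "('v, 'e) quantum_graph \<Rightarrow> real \<Rightarrow> ('e \<Rightarrow> real \<Rightarrow> complex) set" where
  "eigenspace \<Gamma> \<mu> = {f. maps_to \<Gamma> f (scale_fun (complex_of_real \<mu>) f)}"

definition multiplicity_of :: "('v, 'e) quantum_graph \<Rightarrow> real \<Rightarrow> nat" where
  "multiplicity_of \<Gamma> \<mu> = graph_fun.dim (eigenspace \<Gamma> \<mu>)"

text \<open>
  \<open>s\<close> lists the eigenvalues in non-decreasing order, each as often as its multiplicity.
\<close>

definition lists_eigenvalues :: "('v, 'e) quantum_graph \<Rightarrow> (nat \<Rightarrow> real) \<Rightarrow> bool" where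
  "lists_eigenvalues \<Gamma> s \<longleftrightarrow>
     mono s \<and> (\<forall>\<mu>. finite {k. s k = \<mu>} \<and> card {k. s k = \<mu>} = multiplicity_of \<Gamma> \<mu>)"

text \<open>The labels of the eigenvalues start at \<open>n = 1\<close>.\<close>

definition eigenval :: "('v, 'e) quantum_graph \<Rightarrow> nat \<Rightarrow> real" where
  "eigenval \<Gamma> n = (THE s. lists_eigenvalues \<Gamma> s) (n - 1)"

end

theory Submission
  imports Defs "HOL-Complex_Analysis.Great_Picard"
begin

text \<open>
  Fix \<open>m\<close> far below zero and compare the resolvents \<open>T\<^sub>\<alpha> = (H\<^sub>\<alpha> - m)\<^sup>-\<^sup>1\<close> instead of the operators, all
  acting on the inner product space of functions that are continuous on each edge; completeness of this
  space is never needed.  The vertex conditions make the Schroedinger equation a square linear system for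
  the initial data on the edges, so coercivity of the quadratic form gives both existence and uniqueness
  of \<open>T\<^sub>\<alpha> g\<close>, and the \<open>H\<^sup>1\<close> bound that comes with it makes \<open>T\<^sub>\<alpha>\<close> compact by Arzela and Ascoli.

  For \<open>\<alpha> < \<alpha>'\<close> Green's formula yields \<open>\<langle>T\<^sub>\<alpha> g, g\<rangle> \<ge> \<langle>T\<^sub>\<alpha>' g, g\<rangle>\<close>, while \<open>T\<^sub>\<alpha> g = T\<^sub>\<alpha>' g\<close> on the kernel of a
  single linear functional.  By the variational principle the number of eigenvalues of \<open>T\<^sub>\<alpha>\<close> above any
  \<open>t > 0\<close> is at least that of \<open>T\<^sub>\<alpha>'\<close> and at most one more, which is the interlacing.  If the two
  operators shared the simple eigenvalue of \<open>f\<close>, Green's formula would provide an eigenfunction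
  proportional to \<open>f\<close> whose value and flux at \<open>v\<close> vanish.
\<close>

subsection \<open>Linear systems\<close>

text \<open>The quadratic forms of the two operators may have different domains, since a Dirichlet
  condition shrinks the form domain; their resolvents act on one common space. The single shift
  \<open>m\<close> comes from the form bound at the smaller coefficient, to which a larger
  coefficient only adds a nonnegative term at \<open>v\<close>. Functions continuous on the edges
  form a large enough space because H^1-bounded sequences have uniformly convergent subsequences,
  whose limits are again continuous. The correspondence \<mu> = m + 1 / \<tau> reverses the order:
  eigenvalues up to \<open>z\<close> become eigenvalues of the resolvent from
  \<open>1 / (z - m)\<close> on. As \<open>eigenval\<close> is a definite description, the
  eigenvalues must also be shown to be infinitely many and finitely many below each bound; the
  former rests on positivity of the resolvent and on polynomials on one edge. General self-adjoint
  conditions enter through linearity, which lets equations be counted, through symmetry, which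
  removes the other vertices from Green's formula, and through a bound of the boundary term by
  boundary values, which makes the form semibounded.\<close>

lemma homogeneous_system_nontrivial:
  fixes a :: "'i \<Rightarrow> 'j \<Rightarrow> 'k::field"
  assumes "finite I" "finite J" "card I < card J"
  shows "\<exists>c. (\<exists>j\<in>J. c j \<noteq> 0) \<and> (\<forall>i\<in>I. (\<Sum>j\<in>J. a i j * c j) = 0)"
  using assms
proof (induction I arbitrary: J a rule: finite_induct)
  case empty
  then have "J \<noteq> {}" by auto
  then show ?case by (intro exI[of _ "\<lambda>_. 1"]) auto
next
  case (insert i I)
  show ?case
  proof (cases "\<forall>j\<in>J. a i j = 0")
    case True
    have "card I < card J" using insert by simp
    from insert.IH[OF insert.prems(1) this, of a] True show ?thesis by auto
  next
    case False
    \<comment> \<open>Equation \<open>i\<close> is solved for the unknown \<open>j0\<close> and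
      substituted into the others; one equation and one unknown disappear together.\<close>
    then obtain j0 where j0: "j0 \<in> J" "a i j0 \<noteq> 0" by auto
    define J' where "J' = J - {j0}"
    have J': "finite J'" "card I < card J'" "J = insert j0 J'" "j0 \<notin> J'"
      using insert j0 by (auto simp: J'_def card_Diff_singleton)
    obtain c where c: "\<exists>j\<in>J'. c j \<noteq> 0"
      "\<And>k. k \<in> I \<Longrightarrow> (\<Sum>j\<in>J'. (a k j - a k j0 * a i j / a i j0) * c j) = 0"
      using insert.IH[OF J'(1,2), of "\<lambda>k j. a k j - a k j0 * a i j / a i j0"] by auto
    define d where "d = c(j0 := - (\<Sum>j\<in>J'. a i j * c j) / a i j0)"
    have d: "(\<Sum>j\<in>J. a k j * d j) = (\<Sum>j\<in>J'. a k j * c j) + a k j0 * d j0" for k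
    proof -
      have "(\<Sum>j\<in>J'. a k j * d j) = (\<Sum>j\<in>J'. a k j * c j)"
        using J'(4) by (intro sum.cong) (auto simp: d_def)
      then show ?thesis using J' by simp
    qed
    have "(\<Sum>j\<in>J. a k j * d j) = 0" if "k \<in> insert i I" for k
    proof (cases "k = i")
      case True
      then show ?thesis unfolding d using j0 by (simp add: d_def)
    next
      case False
      then have "k \<in> I" using that by simp
      from c(2)[OF this] have "(\<Sum>j\<in>J'. a k j * c j) = a k j0 / a i j0 * (\<Sum>j\<in>J'. a i j * c j)"
        by (simp add: algebra_simps sum_subtractf sum_distrib_left)
      then show ?thesis unfolding d by (simp add: d_def)
    qed
    moreover have "\<exists>j\<in>J. d j \<noteq> 0" using c(1) J' by (auto simp: d_def)
    ultimately show ?thesis by blast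
  qed
qed

text \<open>The right-hand side is treated as the column of one more unknown, \<open>None\<close>. A
  nontrivial solution of the enlarged homogeneous system has \<open>c None \<noteq> 0\<close> by
  injectivity, and dividing by \<open>- c None\<close> solves the original system.\<close>

lemma square_system_solvable:
  fixes a :: "'i \<Rightarrow> 'j \<Rightarrow> 'k::field"
  assumes fin: "finite I" "finite J" "card I = card J"
    and inj: "\<And>c. (\<forall>i\<in>I. (\<Sum>j\<in>J. a i j * c j) = 0) \<Longrightarrow> (\<forall>j\<in>J. c j = 0)"
  shows "\<exists>c. \<forall>i\<in>I. (\<Sum>j\<in>J. a i j * c j) = b i"
proof -
  let ?J = "insert None (Some ` J)"
  have "card ?J = Suc (card J)" using fin by (simp add: card_image)
  then obtain c where c: "\<exists>j\<in>?J. c j \<noteq> 0"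
      "\<forall>i\<in>I. (\<Sum>j\<in>?J. (case j of None \<Rightarrow> b i | Some j \<Rightarrow> a i j) * c j) = 0"
    using homogeneous_system_nontrivial[of I ?J "\<lambda>i j. case j of None \<Rightarrow> b i | Some j \<Rightarrow> a i j"] fin
    by auto
  have eq: "b i * c None + (\<Sum>j\<in>J. a i j * c (Some j)) = 0" if "i \<in> I" for i
    using c(2) that fin by (simp add: sum.reindex)
  have "c None \<noteq> 0"
  proof
    assume 0: "c None = 0"
    then have "\<forall>j\<in>J. c (Some j) = 0" using inj[of "\<lambda>j. c (Some j)"] eq by auto
    then show False using c(1) 0 by auto
  qed
  then have "(\<Sum>j\<in>J. a i j * (- c (Some j) / c None)) = b i" if "i \<in> I" for i
  proof -
    have "(\<Sum>j\<in>J. a i j * (- c (Some j) / c None)) = - (\<Sum>j\<in>J. a i j * c (Some j)) / c None"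
      by (simp add: sum_negf sum_divide_distrib)
    also have "\<dots> = b i" using eq[OF that] \<open>c None \<noteq> 0\<close>
      by (simp add: field_simps) (metis add_eq_0_iff mult.commute add.commute)
    finally show ?thesis .
  qed
  then show ?thesis by (intro exI[of _ "\<lambda>j. - c (Some j) / c None"]) auto
qed

subsection \<open>Self-adjoint relations\<close>

text \<open>The orthogonal complement of the kernel of \<open>(A B)\<close> is spanned by the conjugated rows, and
  \<open>A B\<^sup>* = B A\<^sup>*\<close> puts all vectors \<open>(B\<^sup>* z, - A\<^sup>* z)\<close> into the kernel; counting dimensions, they
  fill it.\<close>

lemma kernel_parametrization:
  fixes A B :: "nat \<Rightarrow> nat \<Rightarrow> complex"
  assumes rows: "\<And>z. \<forall>j<d. (\<Sum>i<d. cnj (A i j) * z i) = 0 \<Longrightarrow>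
                      \<forall>j<d. (\<Sum>i<d. cnj (B i j) * z i) = 0 \<Longrightarrow> \<forall>i<d. z i = 0"
    and sa: "\<And>i k. i < d \<Longrightarrow> k < d \<Longrightarrow> (\<Sum>j<d. A i j * cnj (B k j)) = (\<Sum>j<d. B i j * cnj (A k j))"
    and ker: "\<forall>i<d. (\<Sum>j<d. A i j * F j + B i j * F' j) = 0"
  shows "\<exists>z. \<forall>j<d. F j = (\<Sum>i<d. cnj (B i j) * z i) \<and> F' j = - (\<Sum>i<d. cnj (A i j) * z i)"
proof -
  \<comment> \<open>\<open>p\<close> and \<open>q\<close> are the actions of the adjoints of
    \<open>B\<close> and of \<open>A\<close>.\<close>
  define p where "p = (\<lambda>z j. (\<Sum>i<d. cnj (B i j) * z i))"
  define q where "q = (\<lambda>z j. (\<Sum>i<d. cnj (A i j) * z i))"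
  have V: "(\<Sum>j<d. A i j * p z j) = (\<Sum>j<d. B i j * q z j)" if "i < d" for z i
  proof -
    have "(\<Sum>j<d. A i j * p z j) = (\<Sum>k<d. (\<Sum>j<d. A i j * cnj (B k j)) * z k)"
      unfolding p_def sum_distrib_left sum_distrib_right by (subst sum.swap) (simp add: mult_ac)
    also have "\<dots> = (\<Sum>k<d. (\<Sum>j<d. B i j * cnj (A k j)) * z k)"
      using sa that by (intro sum.cong) auto
    also have "\<dots> = (\<Sum>j<d. B i j * q z j)"
      unfolding q_def sum_distrib_left sum_distrib_right by (subst sum.swap) (simp add: mult_ac)
    finally show ?thesis .
  qed
  \<comment> \<open>A vector \<open>(q e, p e)\<close> of the span of the conjugated rows that lies
    in the kernel is orthogonal to itself: pairing the equations with \<open>cnj (e i)\<close>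
    produces its squared norm.\<close>
  have R: "(\<forall>j<d. q e j = 0) \<and> (\<forall>j<d. p e j = 0)"
    if "\<forall>i<d. (\<Sum>j<d. A i j * q e j + B i j * p e j) = 0" for e
  proof -
    have "0 = (\<Sum>i<d. cnj (e i) * (\<Sum>j<d. A i j * q e j + B i j * p e j))"
      using that by simp
    also have "\<dots> = (\<Sum>i<d. \<Sum>j<d. cnj (e i) * A i j * q e j) + (\<Sum>i<d. \<Sum>j<d. cnj (e i) * B i j * p e j)"
      by (simp add: sum_distrib_left algebra_simps sum.distrib)
    also have "\<dots> = (\<Sum>j<d. q e j * cnj (q e j)) + (\<Sum>j<d. p e j * cnj (p e j))"
      unfolding p_def q_def cnj_sum sum_distrib_left[of _ _ "{..<d}"]
      by (intro arg_cong2[where f = "(+)"]; subst sum.swap;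
          simp add: sum_distrib_left sum_distrib_right mult_ac)
    finally have "complex_of_real ((\<Sum>j<d. (cmod (q e j))\<^sup>2) + (\<Sum>j<d. (cmod (p e j))\<^sup>2)) = 0"
      by (simp add: complex_norm_square del: of_real_power)
    then have *: "(\<Sum>j<d. (cmod (q e j))\<^sup>2) + (\<Sum>j<d. (cmod (p e j))\<^sup>2) = 0"
      unfolding of_real_eq_0_iff .
    have "(\<Sum>j<d. (cmod (q e j))\<^sup>2) = 0" "(\<Sum>j<d. (cmod (p e j))\<^sup>2) = 0"
      using * sum_nonneg[of "{..<d}" "\<lambda>j. (cmod (q e j))\<^sup>2"] sum_nonneg[of "{..<d}" "\<lambda>j. (cmod (p e j))\<^sup>2"]
      by auto
    then show ?thesis by (subst (asm) (1 2) sum_nonneg_eq_0_iff) auto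
  qed
  let ?I = "({True} \<times> {..<d}) \<union> ({False} \<times> {..<d})"
  \<comment> \<open>\<open>M\<close> is the matrix of
    \<open>(z, e) \<mapsto> (p z + q e, - q z + p e)\<close>, where \<open>True\<close> labels
    \<open>z\<close> and \<open>F\<close>, and \<open>False\<close> labels \<open>e\<close> and
    \<open>F'\<close>. Its invertibility splits the space into the kernel vectors
    \<open>(p z, - q z)\<close> and the span of the conjugated rows.\<close>
  define M where "M = (\<lambda>r c. case (r, c) of
      ((True, j), (True, i)) \<Rightarrow> cnj (B i j) | ((True, j), (False, i)) \<Rightarrow> cnj (A i j)
    | ((False, j), (True, i)) \<Rightarrow> - cnj (A i j) | ((False, j), (False, i)) \<Rightarrow> cnj (B i j))"
  have split: "(\<Sum>c\<in>?I. g c) = (\<Sum>i<d. g (True, i)) + (\<Sum>i<d. g (False, i))" for g :: "bool \<times> nat \<Rightarrow> complex"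
  proof -
    have "(\<Sum>c\<in>{b} \<times> {..<d}. g c) = (\<Sum>i<d. g (b, i))" for b
    proof -
      have "{b} \<times> {..<d} = Pair b ` {..<d}" by auto
      then show ?thesis by (simp add: sum.reindex inj_on_def)
    qed
    then show ?thesis by (subst sum.union_disjoint) auto
  qed
  have MT: "(\<Sum>c\<in>?I. M (True, j) c * x c) = p (\<lambda>i. x (True, i)) j + q (\<lambda>i. x (False, i)) j"
    and MF: "(\<Sum>c\<in>?I. M (False, j) c * x c) = - q (\<lambda>i. x (True, i)) j + p (\<lambda>i. x (False, i)) j" for x j
    unfolding split by (simp_all add: M_def p_def q_def sum_negf)
  \<comment> \<open>Applying \<open>(A B)\<close> to a decomposed vector removes the
    \<open>z\<close> part by \<open>V\<close>, so that \<open>R\<close> decides about the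
    \<open>e\<close> part. This serves the injectivity of \<open>M\<close> and then the given kernel
    vector.\<close>
  have comb: "(\<Sum>j<d. A i j * q e j + B i j * p e j) =
      (\<Sum>j<d. A i j * (p z j + q e j) + B i j * (- q z j + p e j))" if "i < d" for i e z
  proof -
    have "(\<Sum>j<d. A i j * (p z j + q e j) + B i j * (- q z j + p e j)) =
        (\<Sum>j<d. A i j * q e j + B i j * p e j) + ((\<Sum>j<d. A i j * p z j) - (\<Sum>j<d. B i j * q z j))"
      unfolding sum.distrib[symmetric] sum_subtractf[symmetric]
      by (intro sum.cong refl) (simp add: ring_distribs)
    then show ?thesis using V[OF that, of z] by simp
  qed
  have "\<exists>x. \<forall>r\<in>?I. (\<Sum>c\<in>?I. M r c * x c) = (if fst r then F (snd r) else F' (snd r))"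
  proof (rule square_system_solvable)
    fix x assume "\<forall>r\<in>?I. (\<Sum>c\<in>?I. M r c * x c) = 0"
    then have *: "p (\<lambda>i. x (True, i)) j + q (\<lambda>i. x (False, i)) j = 0"
        "- q (\<lambda>i. x (True, i)) j + p (\<lambda>i. x (False, i)) j = 0" if "j < d" for j
    proof -
      have "(True, j) \<in> ?I" "(False, j) \<in> ?I" using that by auto
      then have "(\<Sum>c\<in>?I. M (True, j) c * x c) = 0" "(\<Sum>c\<in>?I. M (False, j) c * x c) = 0"
        using \<open>\<forall>r\<in>?I. (\<Sum>c\<in>?I. M r c * x c) = 0\<close> by blast+
      then show "p (\<lambda>i. x (True, i)) j + q (\<lambda>i. x (False, i)) j = 0"
        "- q (\<lambda>i. x (True, i)) j + p (\<lambda>i. x (False, i)) j = 0"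
        unfolding MT MF .
    qed
    have "(\<Sum>j<d. A i j * q (\<lambda>i. x (False, i)) j + B i j * p (\<lambda>i. x (False, i)) j) = 0" if "i < d" for i
      unfolding comb[OF that, of "\<lambda>i. x (False, i)" "\<lambda>i. x (True, i)"]
      by (rule sum.neutral) (metis * lessThan_iff mult_zero_right add_0)
    then have "\<forall>i<d. (\<Sum>j<d. A i j * q (\<lambda>i. x (False, i)) j + B i j * p (\<lambda>i. x (False, i)) j) = 0"
      by blast
    from R[OF this] have 0: "\<forall>j<d. q (\<lambda>i. x (False, i)) j = 0" "\<forall>j<d. p (\<lambda>i. x (False, i)) j = 0"
      by auto
    have "\<forall>i<d. x (False, i) = 0" by (rule rows) (use 0 in \<open>unfold p_def q_def\<close>)
    moreover have 1: "\<forall>j<d. q (\<lambda>i. x (True, i)) j = 0" "\<forall>j<d. p (\<lambda>i. x (True, i)) j = 0"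
      using * 0 by (metis add.right_neutral neg_equal_0_iff_equal)+
    have "\<forall>i<d. x (True, i) = 0" by (rule rows) (use 1 in \<open>unfold p_def q_def\<close>)
    ultimately show "\<forall>r\<in>?I. x r = 0" by auto
  qed auto
  then obtain x where x: "\<And>r. r \<in> ?I \<Longrightarrow> (\<Sum>c\<in>?I. M r c * x c) = (if fst r then F (snd r) else F' (snd r))"
    by blast
  have *: "F j = p (\<lambda>i. x (True, i)) j + q (\<lambda>i. x (False, i)) j"
        "F' j = - q (\<lambda>i. x (True, i)) j + p (\<lambda>i. x (False, i)) j" if "j < d" for j
  proof -
    have "(True, j) \<in> ?I" "(False, j) \<in> ?I" using that by auto
    from this[THEN x] show "F j = p (\<lambda>i. x (True, i)) j + q (\<lambda>i. x (False, i)) j"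
        "F' j = - q (\<lambda>i. x (True, i)) j + p (\<lambda>i. x (False, i)) j"
      unfolding MT MF by simp_all
  qed
  have "(\<Sum>j<d. A i j * q (\<lambda>i. x (False, i)) j + B i j * p (\<lambda>i. x (False, i)) j) = 0" if "i < d" for i
  proof -
    have "(\<Sum>j<d. A i j * q (\<lambda>i. x (False, i)) j + B i j * p (\<lambda>i. x (False, i)) j) =
        (\<Sum>j<d. A i j * F j + B i j * F' j)"
      unfolding comb[OF that, of "\<lambda>i. x (False, i)" "\<lambda>i. x (True, i)"]
      by (intro sum.cong refl) (metis * lessThan_iff)
    then show ?thesis using ker that by simp
  qed
  then have "\<forall>i<d. (\<Sum>j<d. A i j * q (\<lambda>i. x (False, i)) j + B i j * p (\<lambda>i. x (False, i)) j) = 0"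
    by blast
  from R[OF this] * have "\<forall>j<d. F j = p (\<lambda>i. x (True, i)) j \<and> F' j = - q (\<lambda>i. x (True, i)) j"
    by simp
  then show ?thesis unfolding p_def q_def by (rule exI[of _ "\<lambda>i. x (True, i)"])
qed

text \<open>The common form of the given conditions and of all \<open>\<delta>\<close>-type
  conditions: as many equations as edge ends. Summed over the vertices this yields the square system
  behind the resolvent, whose injectivity will come from coercivity.\<close>

definition linear_cond :: "nat \<Rightarrow> (complex Matrix.vec \<Rightarrow> complex Matrix.vec \<Rightarrow> bool) \<Rightarrow> bool" where
  "linear_cond d C \<longleftrightarrow> (\<exists>a b. \<forall>F\<in>carrier_vec d. \<forall>F'\<in>carrier_vec d.
     C F F' \<longleftrightarrow> (\<forall>i<d. (\<Sum>j<d. a i j * vec_index F j + b i j * vec_index F' j) = 0))"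

text \<open>The rank hypothesis speaks of columns, the kernel argument of rows. A maximal
  independent set of columns has \<open>d\<close> elements and hence spans the whole space; a vector
  \<open>y\<close> annihilating all columns then annihilates the unit vectors too.\<close>

lemma rank_juxtapose_rows:
  assumes A: "A \<in> carrier_mat d d" and B: "B \<in> carrier_mat d d"
    and rank: "vec_space.rank d (juxtapose d A B) = d"
    and yA: "\<forall>j<d. (\<Sum>i<d. y i * A $$ (i, j)) = 0" and yB: "\<forall>j<d. (\<Sum>i<d. y i * B $$ (i, j)) = 0"
  shows "\<forall>i<d. y i = (0::complex)"
proof -
  interpret vec_space "TYPE(complex)" d .
  let ?M = "juxtapose d A B"
  have M: "?M \<in> carrier_mat d (d + d)"
    using A B by (auto simp: juxtapose_def)
  have cols: "set (cols ?M) \<subseteq> carrier_vec d" using cols_dim[of ?M] M by simp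
  obtain S where S: "maximal S (\<lambda>T. T \<subseteq> set (cols ?M) \<and> lin_indpt T)" "finite S"
  proof -
    have "lin_indpt {}" by (rule finite_lin_indpt2) auto
    then show ?thesis
      using maximal_exists_superset[of "set (cols ?M)" "(\<lambda>T. T \<subseteq> set (cols ?M) \<and> lin_indpt T)" "{}"] that
      by auto
  qed
  have card: "card S = d" using rank_card_indpt[OF M S(1)] rank by simp
  have li: "lin_indpt S" and sub: "S \<subseteq> set (cols ?M)" using S(1) by (auto simp: maximal_def)
  have "basis S"
    using dim_li_is_basis[OF fin_dim S(2) _ li] cols sub card dim_is_n by auto
  then have span: "span S = carrier_vec d" by (simp add: basis_def)
  define z where "z = Matrix.vec d y"
  have orth: "z \<bullet> c = 0" if "c \<in> set (cols ?M)" for c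
  proof -
    from that obtain j where j: "j < d + d" "c = col ?M j"
      using M by (auto simp: cols_def)
    have c: "vec_index c i = (if j < d then A $$ (i, j) else B $$ (i, j - d))" if "i < d" for i
      using j that A B M unfolding j(2) by (auto simp: juxtapose_def)
    have "dim_vec c = d" using j M by simp
    then have "z \<bullet> c = (\<Sum>i<d. y i * vec_index c i)"
      unfolding scalar_prod_def by (simp add: z_def atLeast0LessThan)
    also have "\<dots> = (\<Sum>i<d. y i * (if j < d then A $$ (i, j) else B $$ (i, j - d)))"
      by (intro sum.cong refl) (simp add: c)
    also have "\<dots> = 0"
      using yA yB j by (cases "j < d") simp_all
    finally show ?thesis .
  qed
  have "z \<bullet> x = 0" if "x \<in> span S" for x
  proof -
    from that S(2) obtain a where x: "x = lincomb a S"
      using finite_span sub cols by auto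
    have "z \<bullet> x = (\<Sum>s\<in>S. a s * (z \<bullet> s))"
    proof -
      have "z \<bullet> x = (\<Sum>i<d. y i * (\<Sum>s\<in>S. a s * vec_index s i))"
        unfolding x scalar_prod_def using lincomb_index[of _ S a] lincomb_dim[OF S(2), of a] sub cols
        by (auto simp: z_def atLeast0LessThan intro!: sum.cong)
      also have "\<dots> = (\<Sum>s\<in>S. \<Sum>i<d. a s * (y i * vec_index s i))"
        unfolding sum_distrib_left by (subst sum.swap) (simp add: mult_ac)
      also have "\<dots> = (\<Sum>s\<in>S. a s * (z \<bullet> s))"
      proof (intro sum.cong refl)
        fix s assume "s \<in> S"
        then have "dim_vec s = d" using sub cols by auto
        then show "(\<Sum>i<d. a s * (y i * vec_index s i)) = a s * (z \<bullet> s)"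
          by (simp add: scalar_prod_def z_def atLeast0LessThan sum_distrib_left)
      qed
      finally show ?thesis .
    qed
    then show ?thesis using orth sub by (simp add: subset_iff)
  qed
  then have "z \<bullet> unit_vec d i = 0" for i using span by simp
  then have "vec_index z i = 0" if "i < d" for i using that scalar_prod_right_unit[of i d z] by (simp add: z_def)
  then show ?thesis by (simp add: z_def)
qed

lemma self_adjoint_cond_linear: "self_adjoint_cond d C \<Longrightarrow> linear_cond d C"
proof -
  assume "self_adjoint_cond d C"
  then obtain A B where AB: "A \<in> carrier_mat d d" "B \<in> carrier_mat d d"
    "\<And>F F'. F \<in> carrier_vec d \<Longrightarrow> F' \<in> carrier_vec d \<Longrightarrow> C F F' \<longleftrightarrow> A *\<^sub>v F + B *\<^sub>v F' = 0\<^sub>v d"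
    unfolding self_adjoint_cond_def by metis
  have "C F F' \<longleftrightarrow> (\<forall>i<d. (\<Sum>j<d. A $$ (i, j) * vec_index F j + B $$ (i, j) * vec_index F' j) = 0)"
    if "F \<in> carrier_vec d" "F' \<in> carrier_vec d" for F F'
    using AB that unfolding AB(3)[OF that]
    by (auto simp: vec_eq_iff scalar_prod_def atLeast0LessThan sum.distrib)
  then show ?thesis unfolding linear_cond_def
    by (intro exI[of _ "\<lambda>i j. A $$ (i, j)"] exI[of _ "\<lambda>i j. B $$ (i, j)"]) auto
qed

lemma mat_adjoint_carrier:
  "(M :: complex mat) \<in> carrier_mat m n \<Longrightarrow> mat_adjoint M \<in> carrier_mat n m"
  by (auto simp: mat_adjoint_def)

lemma mat_adjoint_index:
  fixes M :: "complex mat"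
  assumes "i < dim_col M" "k < dim_row M"
  shows "mat_adjoint M $$ (i, k) = cnj (M $$ (k, i))"
  using assms by (simp add: mat_adjoint_def mat_of_rows_def conjugate_vec_def)

text \<open>Why such a vertex contributes nothing to Green's formula: once the first pair is written
  as B^* z and - A^* z, the difference of the two sides is a pairing of \<open>z\<close> with A G +
  B G', which vanishes.\<close>

lemma self_adjoint_cond_symmetric:
  assumes sa: "self_adjoint_cond d C"
    and F: "F \<in> carrier_vec d" "F' \<in> carrier_vec d" "C F F'"
    and G: "G \<in> carrier_vec d" "G' \<in> carrier_vec d" "C G G'"
  shows "(\<Sum>i<d. vec_index F' i * cnj (vec_index G i)) = (\<Sum>i<d. vec_index F i * cnj (vec_index G' i))"
proof -
  from sa obtain A B where AB: "A \<in> carrier_mat d d" "B \<in> carrier_mat d d"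
    "vec_space.rank d (juxtapose d A B) = d"
    "mat_adjoint (A * mat_adjoint B) = A * mat_adjoint B"
    "\<And>F F'. F \<in> carrier_vec d \<Longrightarrow> F' \<in> carrier_vec d \<Longrightarrow> C F F' \<longleftrightarrow> A *\<^sub>v F + B *\<^sub>v F' = 0\<^sub>v d"
    unfolding self_adjoint_cond_def by metis
  define a b where "a = (\<lambda>i j. A $$ (i, j))" and "b = (\<lambda>i j. B $$ (i, j))"
  have C: "C F F' \<longleftrightarrow> (\<forall>i<d. (\<Sum>j<d. a i j * vec_index F j + b i j * vec_index F' j) = 0)"
    if "F \<in> carrier_vec d" "F' \<in> carrier_vec d" for F F'
    using AB(1,2) that unfolding AB(5)[OF that] a_def b_def
    by (auto simp: vec_eq_iff scalar_prod_def atLeast0LessThan sum.distrib)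
  have adj: "(A * mat_adjoint B) $$ (i, k) = (\<Sum>j<d. a i j * cnj (b k j))" if "i < d" "k < d" for i k
  proof -
    have "mat_adjoint B \<in> carrier_mat d d" using AB(2) by (rule mat_adjoint_carrier)
    then have "(A * mat_adjoint B) $$ (i, k) = (\<Sum>j<d. A $$ (i, j) * mat_adjoint B $$ (j, k))"
      using AB(1,2) that by (simp add: scalar_prod_def atLeast0LessThan)
    also have "\<dots> = (\<Sum>j<d. a i j * cnj (b k j))"
      using AB(1,2) that by (intro sum.cong refl) (simp add: mat_adjoint_index a_def b_def)
    finally show ?thesis .
  qed
  have "\<exists>z. \<forall>j<d. vec_index F j = (\<Sum>i<d. cnj (b i j) * z i) \<and> vec_index F' j = - (\<Sum>i<d. cnj (a i j) * z i)"
  proof (rule kernel_parametrization)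
    fix z assume z: "\<forall>j<d. (\<Sum>i<d. cnj (a i j) * z i) = 0" "\<forall>j<d. (\<Sum>i<d. cnj (b i j) * z i) = 0"
    have "cnj (\<Sum>i<d. cnj (a i j) * z i) = 0" "cnj (\<Sum>i<d. cnj (b i j) * z i) = 0" if "j < d" for j
      using z that by simp_all
    then have Z: "(\<Sum>i<d. cnj (z i) * A $$ (i, j)) = 0" "(\<Sum>i<d. cnj (z i) * B $$ (i, j)) = 0" if "j < d" for j
      using that by (simp_all add: a_def b_def mult.commute)
    have "\<forall>i<d. cnj (z i) = 0"
      by (rule rank_juxtapose_rows[OF AB(1-3), of "\<lambda>i. cnj (z i)"]; intro allI impI; erule Z)
    then show "\<forall>i<d. z i = 0" by simp
  next
    fix i k assume ik: "i < d" "k < d"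
    have "(A * mat_adjoint B) $$ (i, k) = cnj ((A * mat_adjoint B) $$ (k, i))"
    proof -
      have "A * mat_adjoint B \<in> carrier_mat d d" using AB(1,2) by (simp add: mat_adjoint_carrier mult_carrier_mat)
      then have "i < dim_col (A * mat_adjoint B)" "k < dim_row (A * mat_adjoint B)"
        using ik by (simp_all only: carrier_matD)
      from mat_adjoint_index[OF this] show ?thesis unfolding AB(4) .
    qed
    then show "(\<Sum>j<d. a i j * cnj (b k j)) = (\<Sum>j<d. b i j * cnj (a k j))"
      unfolding adj[OF ik] adj[OF ik(2,1)] by (simp add: mult.commute)
  qed (rule C[THEN iffD1, OF F])
  then obtain z where z: "\<And>j. j < d \<Longrightarrow> vec_index F j = (\<Sum>i<d. cnj (b i j) * z i)"
      "\<And>j. j < d \<Longrightarrow> vec_index F' j = - (\<Sum>i<d. cnj (a i j) * z i)" by auto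
  have "(\<Sum>j<d. vec_index F j * cnj (vec_index G' j)) - (\<Sum>j<d. vec_index F' j * cnj (vec_index G j))
      = (\<Sum>j<d. \<Sum>i<d. z i * cnj (a i j * vec_index G j + b i j * vec_index G' j))"
    unfolding sum_subtractf[symmetric]
  proof (intro sum.cong refl)
    fix j assume "j \<in> {..<d}"
    then have "vec_index F j * cnj (vec_index G' j) - vec_index F' j * cnj (vec_index G j)
      = (\<Sum>i<d. cnj (b i j) * z i) * cnj (vec_index G' j) + (\<Sum>i<d. cnj (a i j) * z i) * cnj (vec_index G j)"
      by (simp add: z)
    also have "\<dots> = (\<Sum>i<d. z i * cnj (a i j * vec_index G j + b i j * vec_index G' j))"
      unfolding sum_distrib_right sum.distrib[symmetric]
      by (intro sum.cong refl) (simp add: algebra_simps)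
    finally show "vec_index F j * cnj (vec_index G' j) - vec_index F' j * cnj (vec_index G j)
      = (\<Sum>i<d. z i * cnj (a i j * vec_index G j + b i j * vec_index G' j))" .
  qed
  also have "\<dots> = (\<Sum>i<d. z i * cnj (\<Sum>j<d. a i j * vec_index G j + b i j * vec_index G' j))"
    by (subst sum.swap) (simp only: sum_distrib_left cnj_sum)
  also have "\<dots> = 0" using C[THEN iffD1, OF G] by simp
  finally show ?thesis by simp
qed

lemma delta_cond_linear:
  assumes a: "a \<noteq> -\<infinity>"
  shows "linear_cond d (delta_cond a)"
proof (cases "a = \<infinity>")
  case True
  show ?thesis unfolding linear_cond_def
  proof (intro exI ballI)
    fix F F' :: "complex Matrix.vec" assume "F \<in> carrier_vec d" "F' \<in> carrier_vec d"
    then show "delta_cond a F F' \<longleftrightarrow> (\<forall>i<d. (\<Sum>j<d. (if i = j then 1 else 0) * vec_index F j + 0 * vec_index F' j) = 0)"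
      using True by (auto simp: delta_cond_def if_distrib[of "\<lambda>x. x * _"] sum.delta cong: if_cong)
  qed
next
  case False
  let ?a = "complex_of_real (real_of_ereal a)"
  \<comment> \<open>Row 0 carries the flux equation with the common value read off at index 0; row
    \<open>i > 0\<close> says that the entries \<open>i\<close> and 0 agree. This gives exactly
    \<open>d\<close> equations.\<close>
  let ?p = "\<lambda>i j. if i = 0 then (if j = 0 then - ?a else 0) else (if j = i then 1 else 0) - (if j = 0 then 1 else 0)"
  let ?q = "\<lambda>i (j::nat). if i = 0 then 1 else (0::complex)"
  show ?thesis unfolding linear_cond_def
  proof (intro exI ballI)
    fix F F' :: "complex Matrix.vec" assume FF: "F \<in> carrier_vec d" "F' \<in> carrier_vec d"
    have "(\<Sum>j<d. ?p i j * vec_index F j + ?q i j * vec_index F' j) =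
       (if i = 0 then (\<Sum>j<d. vec_index F' j) - ?a * vec_index F 0 else vec_index F i - vec_index F 0)" if "i < d" for i
    proof -
      have "0 < d" using that by simp
      then show ?thesis using that
        by (auto simp: sum.distrib left_diff_distrib sum_subtractf if_distrib[of "\<lambda>x. x * _"] sum.delta cong: if_cong)
    qed
    note eq = this
    show "delta_cond a F F' \<longleftrightarrow> (\<forall>i<d. (\<Sum>j<d. ?p i j * vec_index F j + ?q i j * vec_index F' j) = 0)" (is "_ = ?R")
    proof
      assume "delta_cond a F F'"
      then obtain c where c: "\<And>i. i < d \<Longrightarrow> vec_index F i = c" "(\<Sum>i<d. vec_index F' i) = ?a * c"
        using False FF by (auto simp: delta_cond_def)
      show ?R
      proof (intro allI impI)
        fix i assume "i < d"
        show "(\<Sum>j<d. ?p i j * vec_index F j + ?q i j * vec_index F' j) = 0"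
          unfolding eq[OF \<open>i < d\<close>]
          using \<open>i < d\<close> c by simp
      qed
    next
      assume R: ?R
      show "delta_cond a F F'"
      \<comment> \<open>Without edge ends there is no entry at index 0 to serve as the common value;
        the sums are empty and the value 0 is a witness.\<close>
      proof (cases "d = 0")
        case True
        then show ?thesis using False FF by (auto simp: delta_cond_def intro!: exI[of _ 0])
      next
        case d: False
        have "(\<Sum>i<d. vec_index F' i) = ?a * vec_index F 0" using R[rule_format, of 0] eq[of 0] d by simp
        moreover have "vec_index F i = vec_index F 0" if "i < d" for i
          using R[rule_format, OF that] eq[OF that] that by (cases "i = 0") auto
        ultimately have "\<exists>c. (\<forall>i<d. vec_index F i = c) \<and> (\<Sum>i<d. vec_index F' i) = ?a * c" by blast
        then show ?thesis using False FF unfolding delta_cond_def by (simp add: carrier_vecD)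
      qed
    qed
  qed
qed

text \<open>A linear section of \<open>(F, F') \<mapsto> F\<close> shows that \<open>\<langle>F', F\<rangle>\<close> depends on \<open>F\<close> only: the difference of
  two admissible \<open>F'\<close> is paired with \<open>F\<close> to zero by symmetry.\<close>

lemma symmetric_relation_bound:
  fixes L :: "((nat \<Rightarrow> complex) \<times> (nat \<Rightarrow> complex)) set"
  assumes zero: "(0, 0) \<in> L"
    and add: "\<And>F F' G G'. (F, F') \<in> L \<Longrightarrow> (G, G') \<in> L \<Longrightarrow> (F + G, F' + G') \<in> L"
    and scale: "\<And>c F F'. (F, F') \<in> L \<Longrightarrow> ((\<lambda>i. c * F i), (\<lambda>i. c * F' i)) \<in> L"
    and supp: "\<And>F F' i. (F, F') \<in> L \<Longrightarrow> i \<ge> d \<Longrightarrow> F i = 0"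
    and sym: "\<And>F F' G G'. (F, F') \<in> L \<Longrightarrow> (G, G') \<in> L \<Longrightarrow>
      (\<Sum>i<d. F' i * cnj (G i)) = (\<Sum>i<d. F i * cnj (G' i))"
  shows "\<exists>K\<ge>0. \<forall>(F, F')\<in>L. cmod (\<Sum>i<d. F' i * cnj (F i)) \<le> K * (\<Sum>i<d. (cmod (F i))\<^sup>2)"
proof -
  define s2 where "s2 = (\<lambda>(c::complex) (F::nat \<Rightarrow> complex). (\<lambda>i. c * F i))"
  define s1 where "s1 = (\<lambda>c (p::(nat \<Rightarrow> complex) \<times> (nat \<Rightarrow> complex)). (s2 c (fst p), s2 c (snd p)))"
  interpret vs1: vector_space s1
    by unfold_locales (auto simp: s1_def s2_def fun_eq_iff algebra_simps plus_prod_def)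
  interpret vs2: vector_space s2
    by unfold_locales (auto simp: s2_def fun_eq_iff algebra_simps)
  interpret vector_space_pair s1 s2 ..
  have lin: "Vector_Spaces.linear s1 s2 fst"
    by unfold_locales (auto simp: s1_def)
  have sub: "vs1.subspace L"
  proof (rule vs1.subspaceI)
    show "0 \<in> L" using zero by (simp add: zero_prod_def)
    show "x + y \<in> L" if "x \<in> L" "y \<in> L" for x y
      using add[of "fst x" "snd x" "fst y" "snd y"] that by (simp add: plus_prod_def)
    show "s1 c x \<in> L" if "x \<in> L" for c x
      using scale[of "fst x" "snd x" c] that by (simp add: s1_def s2_def)
  qed
  \<comment> \<open>\<open>g\<close> is the linear section: it assigns to each admissible first
    component a pair of \<open>L\<close> above it.\<close>
  obtain g where g: "g ` UNIV \<subseteq> L" "Vector_Spaces.linear s2 s1 g" "\<And>F. F \<in> fst ` L \<Longrightarrow> fst (g F) = F"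
    using linear_exists_right_inverse_on[OF lin sub] by auto
  interpret g: Vector_Spaces.linear s2 s1 g by (rule g(2))
  define \<delta> where "\<delta> = (\<lambda>j i. if i = (j::nat) then 1 else (0::complex))"
  define M where "M = (\<lambda>j i. snd (g (\<delta> j)) i)"
  \<comment> \<open>A crude bound for the sesquilinear form given by the matrix \<open>M\<close> of
    the section: each product of two entries of \<open>F\<close> is at most the squared
    norm.\<close>
  define K where "K = (\<Sum>i<d. \<Sum>j<d. cmod (M j i))"
  have "cmod (\<Sum>i<d. F' i * cnj (F i)) \<le> K * (\<Sum>i<d. (cmod (F i))\<^sup>2)" if FL: "(F, F') \<in> L" for F F'
  proof -
    let ?S = "\<Sum>i<d. (cmod (F i))\<^sup>2"
    have "fst (g F) = F" by (rule g(3)) (use FL in force)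
    moreover have "g F \<in> L" using g(1) by auto
    ultimately have gF: "(F, snd (g F)) \<in> L" by (metis prod.collapse)
    have F: "F = (\<Sum>j<d. s2 (F j) (\<delta> j))"
    proof
      fix i
      have "(\<Sum>j<d. s2 (F j) (\<delta> j)) i = (\<Sum>j<d. if j = i then F j else 0)"
        by (induction d) (auto simp: s2_def \<delta>_def)
      also have "\<dots> = F i" using supp[OF FL, of i] by (cases "i < d") auto
      finally show "F i = (\<Sum>j<d. s2 (F j) (\<delta> j)) i" by simp
    qed
    have snd_sum: "snd (\<Sum>j\<in>J. s1 (F j) (g (\<delta> j))) i = (\<Sum>j\<in>J. F j * M j i)" for J i
      by (induction J rule: infinite_finite_induct) (auto simp: s1_def s2_def M_def)
    have "g F = (\<Sum>j<d. s1 (F j) (g (\<delta> j)))"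
      by (subst F) (simp add: g.sum g.scale)
    then have gFi: "snd (g F) i = (\<Sum>j<d. F j * M j i)" for i by (simp add: snd_sum)
    have "(\<Sum>i<d. F' i * cnj (F i)) = (\<Sum>i<d. snd (g F) i * cnj (F i))"
      using sym[OF FL FL] sym[OF FL gF] sym[OF gF FL] sym[OF gF gF] by metis
    also have "cmod \<dots> \<le> (\<Sum>i<d. \<Sum>j<d. cmod (M j i) * ?S)"
    proof (intro order.trans[OF norm_sum] sum_mono)
      fix i assume i: "i \<in> {..<d}"
      have le: "(cmod (F k))\<^sup>2 \<le> ?S" if "k < d" for k
        using that by (intro member_le_sum) auto
      have "cmod (snd (g F) i * cnj (F i)) \<le> (\<Sum>j<d. cmod (F j * M j i)) * cmod (F i)"
      proof -
        have "cmod (snd (g F) i * cnj (F i)) = cmod (\<Sum>j<d. F j * M j i) * cmod (F i)"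
          unfolding gFi by (simp add: norm_mult)
        then show ?thesis by (simp only:) (intro mult_right_mono norm_sum norm_ge_zero)
      qed
      also have "\<dots> = (\<Sum>j<d. cmod (M j i) * (cmod (F j) * cmod (F i)))"
        by (simp add: sum_distrib_left sum_distrib_right norm_mult mult_ac)
      also have "\<dots> \<le> (\<Sum>j<d. cmod (M j i) * ?S)"
      proof (intro sum_mono mult_left_mono)
        fix j assume "j \<in> {..<d}"
        then have "2 * (cmod (F j) * cmod (F i)) \<le> ?S + ?S"
          using sum_squares_bound[of "cmod (F j)" "cmod (F i)"] le[of j] le[of i] i by simp
        then show "cmod (F j) * cmod (F i) \<le> ?S" by simp
      qed auto
      finally show "cmod (snd (g F) i * cnj (F i)) \<le> (\<Sum>j<d. cmod (M j i) * ?S)" .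
    qed
    also have "\<dots> = K * ?S" by (simp add: K_def sum_distrib_right)
    finally show ?thesis .
  qed
  moreover have "K \<ge> 0" unfolding K_def by (intro sum_nonneg) auto
  ultimately show ?thesis by blast
qed

text \<open>Removes the derivatives from the boundary term of the quadratic form. What remains are
  squared boundary values, which the H^1 part of the form can absorb.\<close>

lemma self_adjoint_cond_bound:
  assumes sa: "self_adjoint_cond d C"
  shows "\<exists>K\<ge>0. \<forall>F\<in>carrier_vec d. \<forall>F'\<in>carrier_vec d. C F F' \<longrightarrow>
    cmod (\<Sum>i<d. vec_index F' i * cnj (vec_index F i)) \<le> K * (\<Sum>i<d. (cmod (vec_index F i))\<^sup>2)"
proof -
  obtain a b where ab: "\<And>F F'. F \<in> carrier_vec d \<Longrightarrow> F' \<in> carrier_vec d \<Longrightarrow>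
      C F F' \<longleftrightarrow> (\<forall>i<d. (\<Sum>j<d. a i j * vec_index F j + b i j * vec_index F' j) = 0)"
    using self_adjoint_cond_linear[OF sa] unfolding linear_cond_def by metis
  define L where "L = {(F, F'). (\<forall>i\<ge>d. F i = 0) \<and> C (Matrix.vec d F) (Matrix.vec d F')}"
  have C: "C (Matrix.vec d F) (Matrix.vec d F') \<longleftrightarrow> (\<forall>i<d. (\<Sum>j<d. a i j * F j + b i j * F' j) = 0)" for F F'
    by (subst ab) auto
  have "\<exists>K\<ge>0. \<forall>(F, F')\<in>L. cmod (\<Sum>i<d. F' i * cnj (F i)) \<le> K * (\<Sum>i<d. (cmod (F i))\<^sup>2)"
  proof (rule symmetric_relation_bound)
    show "(0, 0) \<in> L" by (simp add: L_def C)
    show "(F + G, F' + G') \<in> L" if "(F, F') \<in> L" "(G, G') \<in> L" for F F' G G'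
    proof -
      have "(\<Sum>j<d. a i j * (F j + G j) + b i j * (F' j + G' j)) =
        (\<Sum>j<d. a i j * F j + b i j * F' j) + (\<Sum>j<d. a i j * G j + b i j * G' j)" for i
        unfolding sum.distrib[symmetric] by (intro sum.cong refl) (simp add: ring_distribs)
      then show ?thesis using that by (simp add: L_def C)
    qed
    show "((\<lambda>i. c * F i), (\<lambda>i. c * F' i)) \<in> L" if "(F, F') \<in> L" for c F F'
    proof -
      have "(\<Sum>j<d. a i j * (c * F j) + b i j * (c * F' j)) = c * (\<Sum>j<d. a i j * F j + b i j * F' j)" for i
        unfolding sum_distrib_left by (intro sum.cong refl) (simp add: algebra_simps)
      then show ?thesis using that by (simp add: L_def C)
    qed
    show "F i = 0" if "(F, F') \<in> L" "i \<ge> d" for F F' i using that by (simp add: L_def)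
    show "(\<Sum>i<d. F' i * cnj (G i)) = (\<Sum>i<d. F i * cnj (G' i))" if "(F, F') \<in> L" "(G, G') \<in> L" for F F' G G'
      using self_adjoint_cond_symmetric[OF sa, of "Matrix.vec d F" "Matrix.vec d F'" "Matrix.vec d G" "Matrix.vec d G'"] that
      by (simp add: L_def)
  qed
  then obtain K where K: "K \<ge> 0" "\<And>F F'. (F, F') \<in> L \<Longrightarrow> cmod (\<Sum>i<d. F' i * cnj (F i)) \<le> K * (\<Sum>i<d. (cmod (F i))\<^sup>2)"
    by blast
  show ?thesis
  proof (intro exI conjI ballI impI)
    fix F F' assume FF: "F \<in> carrier_vec d" "F' \<in> carrier_vec d" "C F F'"
    \<comment> \<open>The relation \<open>L\<close> consists of functions on all of nat, so the
      vector is continued by 0 in order to be a combination of the first \<open>d\<close> unit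
      functions.\<close>
    define F0 where "F0 = (\<lambda>i. if i < d then vec_index F i else 0)"
    have "Matrix.vec d F0 = F" "Matrix.vec d (\<lambda>i. vec_index F' i) = F'"
      using FF by (auto simp: F0_def vec_eq_iff)
    then have "(F0, \<lambda>i. vec_index F' i) \<in> L" using FF(3) by (simp add: L_def F0_def)
    from K(2)[OF this] show "cmod (\<Sum>i<d. vec_index F' i * cnj (vec_index F i)) \<le> K * (\<Sum>i<d. (cmod (vec_index F i))\<^sup>2)"
      by (simp add: F0_def)
  qed (rule K(1))
qed

subsection \<open>Compact positive operators on an inner product space\<close>

text \<open>The ambient type carries the vector space structure of all functions, but the integrals
  that define the inner product behave well only on the carrier \<open>X\<close>; hence all laws are
  relative to it.\<close>

locale inner_space = vector_space scale
  for scale :: "complex \<Rightarrow> 'a::ab_group_add \<Rightarrow> 'a" (infixr "\<star>" 75) +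
  fixes X :: "'a set" and ip :: "'a \<Rightarrow> 'a \<Rightarrow> complex"
  assumes subspace_X: "subspace X"
    and ip_add: "\<lbrakk>x \<in> X; y \<in> X; z \<in> X\<rbrakk> \<Longrightarrow> ip (x + y) z = ip x z + ip y z"
    and ip_scale: "\<lbrakk>x \<in> X; z \<in> X\<rbrakk> \<Longrightarrow> ip (c \<star> x) z = c * ip x z"
    and ip_cnj: "\<lbrakk>x \<in> X; y \<in> X\<rbrakk> \<Longrightarrow> ip y x = cnj (ip x y)"
    and ip_nonneg: "x \<in> X \<Longrightarrow> 0 \<le> Re (ip x x)"
    and ip_definite: "\<lbrakk>x \<in> X; Re (ip x x) = 0\<rbrakk> \<Longrightarrow> x = 0"
begin

abbreviation nrm2 :: "'a \<Rightarrow> real" where "nrm2 x \<equiv> Re (ip x x)"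

lemma X_simps [simp, intro]:
  "0 \<in> X" "\<lbrakk>x \<in> X; y \<in> X\<rbrakk> \<Longrightarrow> x + y \<in> X" "\<lbrakk>x \<in> X; y \<in> X\<rbrakk> \<Longrightarrow> x - y \<in> X"
  "x \<in> X \<Longrightarrow> c \<star> x \<in> X" "(\<And>i. i \<in> I \<Longrightarrow> f i \<in> X) \<Longrightarrow> sum f I \<in> X"
  using subspace_X by (auto intro: subspace_0 subspace_add subspace_diff subspace_scale subspace_sum)

lemma ip_add_right: "\<lbrakk>x \<in> X; y \<in> X; z \<in> X\<rbrakk> \<Longrightarrow> ip z (x + y) = ip z x + ip z y"
  by (metis ip_add ip_cnj X_simps(2) complex_cnj_add)

lemma ip_scale_right: "\<lbrakk>x \<in> X; z \<in> X\<rbrakk> \<Longrightarrow> ip z (c \<star> x) = cnj c * ip z x"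
  by (metis ip_scale ip_cnj X_simps(4) complex_cnj_mult)

lemma ip_zero [simp]: "x \<in> X \<Longrightarrow> ip 0 x = 0" "x \<in> X \<Longrightarrow> ip x 0 = 0"
  using ip_scale[of 0 x 0] ip_scale_right[of 0 x 0] by auto

lemma ip_minus: "\<lbrakk>x \<in> X; z \<in> X\<rbrakk> \<Longrightarrow> ip (- x) z = - ip x z"
    "\<lbrakk>x \<in> X; z \<in> X\<rbrakk> \<Longrightarrow> ip z (- x) = - ip z x"
  using ip_scale[of x z "-1"] ip_scale_right[of x z "-1"] by (auto simp: scale_minus_left)

lemma ip_diff: "\<lbrakk>x \<in> X; y \<in> X; z \<in> X\<rbrakk> \<Longrightarrow> ip (x - y) z = ip x z - ip y z"
  using ip_add[of x "-y" z] ip_minus(1)[of y z] subspace_neg[OF subspace_X] by simp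

lemma ip_diff_right: "\<lbrakk>x \<in> X; y \<in> X; z \<in> X\<rbrakk> \<Longrightarrow> ip z (x - y) = ip z x - ip z y"
  using ip_add_right[of x "-y" z] ip_minus(2)[of y z] subspace_neg[OF subspace_X] by simp

lemma ip_sum: "\<lbrakk>\<And>i. i \<in> I \<Longrightarrow> f i \<in> X; z \<in> X\<rbrakk> \<Longrightarrow> ip (sum f I) z = (\<Sum>i\<in>I. ip (f i) z)"
  by (induction I rule: infinite_finite_induct) (auto simp: ip_add)

lemma ip_self: "x \<in> X \<Longrightarrow> ip x x = complex_of_real (nrm2 x)"
  using ip_cnj[of x x] by (auto simp: complex_eq_iff)

lemma nrm2_pos: "x \<in> X \<Longrightarrow> x \<noteq> 0 \<Longrightarrow> 0 < nrm2 x"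
  using ip_nonneg[of x] ip_definite[of x] by fastforce

lemma nrm2_scale:
  assumes x: "x \<in> X"
  shows "nrm2 (c \<star> x) = (cmod c)\<^sup>2 * nrm2 x"
proof -
  have "ip (c \<star> x) (c \<star> x) = (c * cnj c) * ip x x"
    using x by (simp add: ip_scale ip_scale_right)
  also have "c * cnj c = complex_of_real ((cmod c)\<^sup>2)" by (rule complex_norm_square[symmetric])
  finally show ?thesis by simp
qed

lemma nrm2_add: "\<lbrakk>x \<in> X; y \<in> X\<rbrakk> \<Longrightarrow> nrm2 (x + y) = nrm2 x + nrm2 y + 2 * Re (ip x y)"
  using ip_cnj[of x y] by (simp add: ip_add ip_add_right)

lemma nrm2_diff: "\<lbrakk>x \<in> X; y \<in> X\<rbrakk> \<Longrightarrow> nrm2 (x - y) = nrm2 x + nrm2 y - 2 * Re (ip x y)"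
  using ip_cnj[of x y] by (simp add: ip_diff ip_diff_right)

lemma ip_le: "\<lbrakk>x \<in> X; y \<in> X\<rbrakk> \<Longrightarrow> 2 * Re (ip x y) \<le> nrm2 x + nrm2 y"
  using nrm2_diff[of x y] ip_nonneg[of "x - y"] by simp

lemma nrm2_diff_triangle:
  assumes "x \<in> X" "y \<in> X" "z \<in> X"
  shows "nrm2 (x - y) \<le> 2 * nrm2 (x - z) + 2 * nrm2 (y - z)"
proof -
  have "nrm2 (x - y) = nrm2 ((x - z) - (y - z))" by simp
  also have "\<dots> = nrm2 (x - z) + nrm2 (y - z) - 2 * Re (ip (x - z) (y - z))"
    using assms by (intro nrm2_diff) auto
  also have "\<dots> \<le> 2 * nrm2 (x - z) + 2 * nrm2 (y - z)"
  proof -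
    have "0 \<le> nrm2 ((x - z) + (y - z))" using assms by (intro ip_nonneg) auto
    then show ?thesis using nrm2_add[of "x - z" "y - z"] assms by simp
  qed
  finally show ?thesis .
qed

lemma nrm2_minus_commute: "\<lbrakk>x \<in> X; y \<in> X\<rbrakk> \<Longrightarrow> nrm2 (x - y) = nrm2 (y - x)"
  using ip_cnj[of x y] by (simp add: nrm2_diff)

lemma limit_unique:
  assumes "\<And>n. f n \<in> X" "x \<in> X" "y \<in> X"
    and "(\<lambda>n. nrm2 (f n - x)) \<longlonglongrightarrow> 0" "(\<lambda>n. nrm2 (f n - y)) \<longlonglongrightarrow> 0"
  shows "x = y"
proof -
  have "(\<lambda>n. 2 * nrm2 (f n - x) + 2 * nrm2 (f n - y)) \<longlonglongrightarrow> 2 * 0 + 2 * 0"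
    by (intro tendsto_intros assms)
  moreover have "nrm2 (x - y) \<le> 2 * nrm2 (f n - x) + 2 * nrm2 (f n - y)" for n
    using nrm2_diff_triangle[of x y "f n"] assms by (simp add: nrm2_minus_commute)
  ultimately have "nrm2 (x - y) \<le> 0" by (intro LIMSEQ_le_const) auto
  then show ?thesis using ip_definite[of "x - y"] ip_nonneg[of "x - y"] assms by auto
qed

text \<open>Bessel's inequality for one vector, from the squared distance of \<open>x\<close> to its
  projection. It supplies the continuity of \<open>ip\<close> in its first argument.\<close>

lemma cmod_ip_unit_le:
  assumes "x \<in> X" "e \<in> X" "nrm2 e = 1"
  shows "(cmod (ip x e))\<^sup>2 \<le> nrm2 x"
proof -
  define c where "c = ip x e"
  have "0 \<le> nrm2 (x - c \<star> e)" using assms by (intro ip_nonneg) auto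
  also have "\<dots> = nrm2 x + nrm2 (c \<star> e) - 2 * Re (ip x (c \<star> e))"
    using assms by (intro nrm2_diff) auto
  also have "nrm2 (c \<star> e) = (cmod c)\<^sup>2" using nrm2_scale[of e c] assms by simp
  also have "ip x (c \<star> e) = cnj c * c" using ip_scale_right[of e x c] assms by (simp add: c_def)
  also have "Re (cnj c * c) = (cmod c)\<^sup>2"
    unfolding cmod_power2 by (simp add: power2_eq_square)
  finally show ?thesis by (simp add: c_def)
qed

definition orthonormal :: "'a set \<Rightarrow> bool" where
  "orthonormal B \<longleftrightarrow> B \<subseteq> X \<and> (\<forall>e\<in>B. \<forall>e'\<in>B. ip e e' = (if e = e' then 1 else 0))"

lemma ip_orthonormal_combination:
  assumes "orthonormal B" "finite B" "e' \<in> B"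
  shows "ip (\<Sum>e\<in>B. c e \<star> e) e' = c e'"
proof -
  have "ip (\<Sum>e\<in>B. c e \<star> e) e' = (\<Sum>e\<in>B. c e * ip e e')"
    using assms by (subst ip_sum) (auto simp: orthonormal_def ip_scale subset_iff)
  also have "\<dots> = (\<Sum>e\<in>B. if e = e' then c e else 0)"
    using assms by (intro sum.cong) (auto simp: orthonormal_def)
  finally show ?thesis using assms by (simp add: sum.delta')
qed

lemma ip_orthonormal_combinations:
  assumes "orthonormal B" "finite B"
  shows "ip (\<Sum>e\<in>B. c e \<star> e) (\<Sum>e\<in>B. d e \<star> e) = (\<Sum>e\<in>B. c e * cnj (d e))"
proof -
  have X: "(\<Sum>e\<in>B. d e \<star> e) \<in> X" using assms by (auto simp: orthonormal_def)
  have "ip (\<Sum>e\<in>B. c e \<star> e) (\<Sum>e\<in>B. d e \<star> e) = (\<Sum>e\<in>B. c e * ip e (\<Sum>e\<in>B. d e \<star> e))"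
    using assms X by (subst ip_sum) (auto simp: orthonormal_def ip_scale subset_iff)
  also have "\<dots> = (\<Sum>e\<in>B. c e * cnj (d e))"
  proof (intro sum.cong refl)
    fix e assume e: "e \<in> B"
    then have "e \<in> X" using assms by (auto simp: orthonormal_def)
    then show "c e * ip e (\<Sum>e\<in>B. d e \<star> e) = c e * cnj (d e)"
      using ip_cnj[OF X, of e] ip_orthonormal_combination[OF assms e, of d] by simp
  qed
  finally show ?thesis .
qed

lemma orthonormal_independent:
  assumes "orthonormal B" "finite B"
  shows "independent B"
unfolding independent_explicit_module
proof (intro allI impI)
  fix t u v assume *: "finite t" "t \<subseteq> B" "(\<Sum>v\<in>t. u v \<star> v) = 0" "v \<in> t"
  have "orthonormal t" using assms(1) *(2) by (auto simp: orthonormal_def subset_iff)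
  from ip_orthonormal_combination[OF this *(1,4), of u] *
  show "u v = 0" using assms by (auto simp: orthonormal_def)
qed

end

text \<open>Compactness asks for a limit inside \<open>X\<close>, which takes the place of
  completeness. Strict positivity makes \<open>T\<close> injective and, on an infinite-dimensional
  \<open>X\<close>, yields infinitely many eigenvalues.\<close>

locale compact_positive_operator = inner_space scale X ip
  for scale :: "complex \<Rightarrow> 'a::ab_group_add \<Rightarrow> 'a" (infixr "\<star>" 75) and X ip +
  fixes T :: "'a \<Rightarrow> 'a"
  assumes T_closed [simp, intro]: "x \<in> X \<Longrightarrow> T x \<in> X"
    and T_add: "\<lbrakk>x \<in> X; y \<in> X\<rbrakk> \<Longrightarrow> T (x + y) = T x + T y"
    and T_scale: "x \<in> X \<Longrightarrow> T (c \<star> x) = c \<star> T x"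
    and T_symmetric: "\<lbrakk>x \<in> X; y \<in> X\<rbrakk> \<Longrightarrow> ip (T x) y = ip x (T y)"
    and T_positive: "\<lbrakk>x \<in> X; x \<noteq> 0\<rbrakk> \<Longrightarrow> 0 < Re (ip (T x) x)"
    and T_bounded: "\<exists>C. \<forall>x\<in>X. nrm2 (T x) \<le> C * nrm2 x"
    and T_compact: "\<lbrakk>\<And>n::nat. f n \<in> X; \<And>n. nrm2 (f n) \<le> 1\<rbrakk> \<Longrightarrow>
      \<exists>y k. y \<in> X \<and> strict_mono k \<and> (\<lambda>n. nrm2 (T (f (k n)) - y)) \<longlonglongrightarrow> 0"
begin

lemma T_zero [simp]: "T 0 = 0"
  using T_scale[of 0 0] by simp

lemma T_diff: "\<lbrakk>x \<in> X; y \<in> X\<rbrakk> \<Longrightarrow> T (x - y) = T x - T y"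
  using T_add[of x "(-1) \<star> y"] T_scale[of y "-1"] X_simps(4)[of y "-1"] by (simp add: scale_minus_left)

lemma T_sum: "(\<And>i. i \<in> I \<Longrightarrow> f i \<in> X) \<Longrightarrow> T (sum f I) = (\<Sum>i\<in>I. T (f i))"
  by (induction I rule: infinite_finite_induct) (auto simp: T_add)

lemma T_nonneg: "x \<in> X \<Longrightarrow> 0 \<le> Re (ip (T x) x)"
  using T_positive[of x] by (cases "x = 0") auto

definition eigensystem :: "real \<Rightarrow> 'a set \<Rightarrow> bool" where
  "eigensystem t B \<longleftrightarrow> finite B \<and> orthonormal B \<and> (\<forall>e\<in>B. \<exists>\<tau>\<ge>t. T e = complex_of_real \<tau> \<star> e)"

text \<open>The supremum \<open>m\<close> of the Rayleigh quotient is attained: for the positive form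
  \<open>Q f = m \<parallel>f\<parallel>\<^sup>2 - \<langle>T f, f\<rangle>\<close>, the inequality \<open>Q (f - s (m f - T f)) \<ge> 0\<close> with \<open>s = 1 / m\<close> gives
  \<open>\<parallel>m f - T f\<parallel>\<^sup>2 \<le> m Q f\<close>.\<close>

lemma rayleigh_attained:
  assumes S: "S \<subseteq> X" "\<And>x y. x \<in> S \<Longrightarrow> y \<in> S \<Longrightarrow> x - y \<in> S" "\<And>c x. x \<in> S \<Longrightarrow> c \<star> x \<in> S"
      "\<And>x. x \<in> S \<Longrightarrow> T x \<in> S"
    and closed: "\<And>f y. \<lbrakk>\<And>n. f n \<in> S; y \<in> X; (\<lambda>n. nrm2 (f n - y)) \<longlonglongrightarrow> 0\<rbrakk> \<Longrightarrow> y \<in> S"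
    and g: "g \<in> S" "g \<noteq> 0" "t * nrm2 g \<le> Re (ip (T g) g)" and t: "t > 0"
  shows "\<exists>m e. m \<ge> t \<and> e \<in> S \<and> e \<noteq> 0 \<and> T e = complex_of_real m \<star> e"
proof -
  define U where "U = {Re (ip (T f) f) | f. f \<in> S \<and> nrm2 f = 1}"
  obtain C where C: "\<And>x. x \<in> X \<Longrightarrow> nrm2 (T x) \<le> C * nrm2 x" using T_bounded by blast
  define m where "m = Sup U"
  \<comment> \<open>The bound is \<open>ip_le\<close> for \<open>T f\<close> and \<open>f\<close>,
    with \<open>nrm2 f = 1\<close>.\<close>
  have bdd: "bdd_above U"
  proof (rule bdd_aboveI[of _ "(C + 1) / 2"])
    fix u assume "u \<in> U"
    then obtain f where f: "f \<in> S" "nrm2 f = 1" "u = Re (ip (T f) f)" by (auto simp: U_def)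
    then have "f \<in> X" using S by auto
    then show "u \<le> (C + 1) / 2" using ip_le[of "T f" f] C[of f] f by auto
  qed
  have normalize: "\<exists>h. h \<in> S \<and> nrm2 h = 1 \<and> Re (ip (T f) f) = nrm2 f * Re (ip (T h) h)"
    if f: "f \<in> S" "f \<noteq> 0" for f
  proof -
    have fX: "f \<in> X" using f S by auto
    define a where "a = complex_of_real (1 / sqrt (nrm2 f))"
    have n: "nrm2 f > 0" using nrm2_pos fX f by auto
    then have a: "(cmod a)\<^sup>2 = 1 / nrm2 f" by (simp add: a_def norm_divide power_divide)
    have ca: "cnj a = a" by (simp add: a_def)
    have "a * cnj a = complex_of_real (1 / nrm2 f)" unfolding complex_norm_square[symmetric] a ..
    then have aa: "a * a = complex_of_real (1 / nrm2 f)" by (simp add: ca)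
    have "ip (T (a \<star> f)) (a \<star> f) = (a * a) * ip (T f) f"
      using fX by (simp add: T_scale ip_scale ip_scale_right ca)
    then have "Re (ip (T (a \<star> f)) (a \<star> f)) = Re (ip (T f) f) / nrm2 f"
      unfolding aa by simp
    then show ?thesis using n a fX f S(3)
      by (intro exI[of _ "a \<star> f"]) (auto simp: nrm2_scale)
  qed
  have le_m: "Re (ip (T f) f) \<le> m * nrm2 f" if f: "f \<in> S" for f
  proof (cases "f = 0")
    case False
    from normalize[OF f False] obtain h where h: "h \<in> S" "nrm2 h = 1"
        "Re (ip (T f) f) = nrm2 f * Re (ip (T h) h)" by blast
    have "Re (ip (T h) h) \<le> m" unfolding m_def using h bdd by (intro cSup_upper) (auto simp: U_def)
    moreover have "f \<in> X" using f S by auto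
    ultimately show ?thesis using h(3) ip_nonneg[of f] by (simp add: mult.commute[of m] mult_left_mono)
  qed auto
  have gX: "g \<in> X" using g S by auto
  have "t * nrm2 g \<le> m * nrm2 g" using le_m[OF g(1)] g(3) by simp
  then have mt: "m \<ge> t" using nrm2_pos[OF gX g(2)] by simp
  then have m0: "m > 0" using t by simp
  obtain h where h: "h \<in> S" "nrm2 h = 1" using normalize[OF g(1,2)] by blast
  then have U_ne: "U \<noteq> {}" by (auto simp: U_def)
  have "\<exists>f. f \<in> S \<and> nrm2 f = 1 \<and> m - 1 / real (Suc n) < Re (ip (T f) f)" for n
  proof -
    have "m - 1 / real (Suc n) < Sup U" unfolding m_def by simp
    then obtain u where "u \<in> U" "m - 1 / real (Suc n) < u" using less_cSupD[OF U_ne] by blast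
    then show ?thesis by (auto simp: U_def)
  qed
  then obtain f where f: "\<And>n. f n \<in> S" "\<And>n. nrm2 (f n) = 1"
      "\<And>n. m - 1 / real (Suc n) < Re (ip (T (f n)) (f n))" by metis
  have fX: "f n \<in> X" for n using f(1) S by auto
  define R where "R = (\<lambda>x. complex_of_real m \<star> x - T x)"
  have RS: "R x \<in> S" if "x \<in> S" for x using that S by (auto simp: R_def)
  have R_bound: "nrm2 (R x) \<le> m * (m * nrm2 x - Re (ip (T x) x))" if x: "x \<in> S" for x
  proof -
    define r where "r = R x"
    define s where "s = 1 / m"
    have rS: "r \<in> S" using RS x by (simp add: r_def)
    have xX: "x \<in> X" and rX: "r \<in> X" using x rS S by auto
    let ?y = "x - complex_of_real s \<star> r"
    have "?y \<in> S" using x rS S by blast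
    from le_m[OF this] have "0 \<le> m * nrm2 ?y - Re (ip (T ?y) ?y)" by linarith
    also have "nrm2 ?y = nrm2 x + s\<^sup>2 * nrm2 r - 2 * (s * Re (ip x r))"
    proof -
      have "nrm2 ?y = nrm2 x + nrm2 (complex_of_real s \<star> r) - 2 * Re (ip x (complex_of_real s \<star> r))"
        using xX rX by (intro nrm2_diff X_simps)
      also have "nrm2 (complex_of_real s \<star> r) = s\<^sup>2 * nrm2 r"
        unfolding nrm2_scale[OF rX] by simp
      also have "ip x (complex_of_real s \<star> r) = complex_of_real s * ip x r"
        unfolding ip_scale_right[OF rX xX] by simp
      finally show ?thesis by simp
    qed
    also have "Re (ip (T ?y) ?y) = Re (ip (T x) x) - 2 * (s * Re (ip (T x) r)) + s\<^sup>2 * Re (ip (T r) r)"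
    proof -
      have sym: "ip (T r) x = cnj (ip (T x) r)"
        unfolding T_symmetric[OF rX xX] by (rule ip_cnj) (use xX rX in auto)
      have E: "ip (T x - complex_of_real s \<star> T r) z = ip (T x) z - complex_of_real s * ip (T r) z"
        if "z \<in> X" for z
        using ip_diff[of "T x" "complex_of_real s \<star> T r" z] ip_scale[of "T r" z] xX rX that by auto
      have "T ?y = T x - complex_of_real s \<star> T r"
        unfolding T_diff[OF xX X_simps(4)[OF rX]] T_scale[OF rX] ..
      then have *: "ip (T ?y) ?y = ip (T x - complex_of_real s \<star> T r) x
          - cnj (complex_of_real s) * ip (T x - complex_of_real s \<star> T r) r"
        using xX rX ip_diff_right[of x "complex_of_real s \<star> r" "T ?y"]
          ip_scale_right[of r "T ?y" "complex_of_real s"] by auto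
      show ?thesis unfolding * E[OF xX] E[OF rX] sym by (simp add: power2_eq_square algebra_simps)
    qed
    finally have *: "0 \<le> m * nrm2 x - Re (ip (T x) x) + m * s\<^sup>2 * nrm2 r
        - 2 * (s * (m * Re (ip x r) - Re (ip (T x) r))) - s\<^sup>2 * Re (ip (T r) r)"
      by (simp add: algebra_simps)
    have "ip r r = complex_of_real m * ip x r - ip (T x) r"
    proof -
      have "ip r r = ip (complex_of_real m \<star> x - T x) r" unfolding r_def R_def ..
      also have "\<dots> = ip (complex_of_real m \<star> x) r - ip (T x) r" using xX rX by (intro ip_diff) auto
      finally show ?thesis unfolding ip_scale[OF xX rX] .
    qed
    then have rr: "nrm2 r = m * Re (ip x r) - Re (ip (T x) r)" by simp
    \<comment> \<open>The quadratic term in \<open>T r\<close> is dropped because \<open>T\<close>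
      is nonnegative. With \<open>s = 1 / m\<close> the two terms in \<open>nrm2 r\<close> then
      combine to \<open>- nrm2 r / m\<close>.\<close>
    have "0 \<le> m * nrm2 x - Re (ip (T x) x) + m * s\<^sup>2 * nrm2 r - 2 * (s * nrm2 r)"
      using *[folded rr] mult_nonneg_nonneg[OF zero_le_power2[of s] T_nonneg[OF rX]] by linarith
    also have "m * s\<^sup>2 * nrm2 r = nrm2 r / m"
      using m0 by (simp add: s_def power2_eq_square)
    also have "s * nrm2 r = nrm2 r / m"
      by (simp add: s_def)
    finally have "nrm2 r / m \<le> m * nrm2 x - Re (ip (T x) x)" by simp
    then show ?thesis using m0 by (simp add: r_def field_simps)
  qed
  have R_lim: "(\<lambda>n. nrm2 (R (f n))) \<longlonglongrightarrow> 0"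
  proof (rule tendsto_sandwich[OF _ _ tendsto_const])
    show "\<forall>\<^sub>F n in sequentially. 0 \<le> nrm2 (R (f n))"
      using RS f(1) S(1) by (intro always_eventually allI ip_nonneg) auto
    have "nrm2 (R (f n)) \<le> m * (1 / real (Suc n))" for n
    proof -
      have "nrm2 (R (f n)) \<le> m * (m - Re (ip (T (f n)) (f n)))"
        using R_bound[OF f(1)[of n]] f(2) by simp
      also have "\<dots> \<le> m * (1 / real (Suc n))"
        using f(3)[of n] m0 by (intro mult_left_mono) auto
      finally show ?thesis .
    qed
    then show "\<forall>\<^sub>F n in sequentially. nrm2 (R (f n)) \<le> m * (1 / real (Suc n))" by simp
    show "(\<lambda>n. m * (1 / real (Suc n))) \<longlonglongrightarrow> 0"
      using tendsto_mult[OF tendsto_const[of m] LIMSEQ_Suc[OF lim_1_over_n]] by simp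
  qed
  obtain y k where y: "y \<in> X" "strict_mono k" "(\<lambda>n. nrm2 (T (f (k n)) - y)) \<longlonglongrightarrow> 0"
    using T_compact[of f] fX f(2) by auto
  \<comment> \<open>Along the subsequence \<open>T f\<close> tends to \<open>y\<close> and
    \<open>m f - T f\<close> tends to 0, so \<open>m f\<close> tends to \<open>y\<close>. Thus
    \<open>y\<close>, known only as a limit of images, is also a limit of elements of
    \<open>S\<close>; it is nonzero because \<open>nrm2 (h n) = m^2\<close>.\<close>
  define h where "h = (\<lambda>n. complex_of_real m \<star> f (k n))"
  have hS: "h n \<in> S" and hX: "h n \<in> X" for n using f S(3) fX by (auto simp: h_def)
  have h_lim: "(\<lambda>n. nrm2 (h n - y)) \<longlonglongrightarrow> 0"
  proof (rule tendsto_sandwich[OF _ _ tendsto_const])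
    show "\<forall>\<^sub>F n in sequentially. 0 \<le> nrm2 (h n - y)"
      using hX y by (intro always_eventually allI ip_nonneg) auto
    have "nrm2 (h n - y) \<le> 2 * nrm2 (R (f (k n))) + 2 * nrm2 (T (f (k n)) - y)" for n
    proof -
      have "R (f (k n)) = h n - T (f (k n))" by (simp add: R_def h_def)
      then show ?thesis
        using nrm2_diff_triangle[of "h n" y "T (f (k n))"] nrm2_minus_commute[of y "T (f (k n))"] hX y fX
        by auto
    qed
    then show "\<forall>\<^sub>F n in sequentially. nrm2 (h n - y) \<le> 2 * nrm2 (R (f (k n))) + 2 * nrm2 (T (f (k n)) - y)"
      by simp
    have "(\<lambda>n. 2 * nrm2 (R (f (k n))) + 2 * nrm2 (T (f (k n)) - y)) \<longlonglongrightarrow> 2 * 0 + 2 * 0"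
      using LIMSEQ_subseq_LIMSEQ[OF R_lim y(2)] y(3) by (intro tendsto_intros) (simp_all add: o_def)
    then show "(\<lambda>n. 2 * nrm2 (R (f (k n))) + 2 * nrm2 (T (f (k n)) - y)) \<longlonglongrightarrow> 0" by simp
  qed
  have yS: "y \<in> S" by (rule closed[OF hS y(1) h_lim])
  have "y \<noteq> 0"
  proof
    assume "y = 0"
    then have "(\<lambda>n. m\<^sup>2) \<longlonglongrightarrow> 0" using h_lim fX f(2) by (simp add: h_def nrm2_scale)
    then show False using m0 by (simp add: LIMSEQ_const_iff)
  qed
  \<comment> \<open>Both sides are limits of \<open>T (h n)\<close>: one by boundedness of
    \<open>T\<close>, the other because \<open>T (h n)\<close> is \<open>m\<close> times
    \<open>T (f (k n))\<close>.\<close>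
  moreover have "T y = complex_of_real m \<star> y"
  proof (rule limit_unique)
    show "T (h n) \<in> X" "T y \<in> X" "complex_of_real m \<star> y \<in> X" for n using hX y by auto
    show "(\<lambda>n. nrm2 (T (h n) - T y)) \<longlonglongrightarrow> 0"
    proof (rule tendsto_sandwich[OF _ _ tendsto_const])
      show "\<forall>\<^sub>F n in sequentially. 0 \<le> nrm2 (T (h n) - T y)"
        using hX y by (intro always_eventually allI ip_nonneg) auto
      show "\<forall>\<^sub>F n in sequentially. nrm2 (T (h n) - T y) \<le> C * nrm2 (h n - y)"
        using C[of "h _ - y"] hX y by (intro always_eventually allI) (auto simp: T_diff)
      show "(\<lambda>n. C * nrm2 (h n - y)) \<longlonglongrightarrow> 0" using tendsto_mult[OF tendsto_const h_lim, of C] by simp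
    qed
    have "T (h n) - complex_of_real m \<star> y = complex_of_real m \<star> (T (f (k n)) - y)" for n
      using fX by (simp add: h_def T_scale scale_right_diff_distrib)
    then have "nrm2 (T (h n) - complex_of_real m \<star> y) = m\<^sup>2 * nrm2 (T (f (k n)) - y)" for n
      using fX y by (simp add: nrm2_scale)
    then show "(\<lambda>n. nrm2 (T (h n) - complex_of_real m \<star> y)) \<longlonglongrightarrow> 0"
      using tendsto_mult[OF tendsto_const y(3), of "m\<^sup>2"] by simp
  qed
  ultimately show ?thesis using mt yS by blast
qed

definition geom_mult :: "real \<Rightarrow> nat" where
  "geom_mult \<tau> = dim {x \<in> X. T x = complex_of_real \<tau> \<star> x}"

definition eigenvalue_count :: "real \<Rightarrow> nat" where
  "eigenvalue_count t = (\<Sum>\<tau> | t \<le> \<tau> \<and> geom_mult \<tau> \<noteq> 0. geom_mult \<tau>)"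

text \<open>Maximality is expressed by the variational bound on the orthogonal complement rather
  than by inclusion, since this bound is what the comparison of two operators and the spanning of
  eigenspaces use.\<close>

definition maximal_eigensystem :: "real \<Rightarrow> 'a set \<Rightarrow> bool" where
  "maximal_eigensystem t B \<longleftrightarrow> eigensystem t B \<and>
     (\<forall>f\<in>X. f \<noteq> 0 \<longrightarrow> (\<forall>e\<in>B. ip f e = 0) \<longrightarrow> Re (ip (T f) f) < t * nrm2 f)"

text \<open>Otherwise repeated extension produces an infinite orthonormal sequence of eigenvectors
  with eigenvalues at least \<open>t\<close>. Their images have pairwise squared distance at least
  \<open>2 t^2\<close>, so no subsequence of them converges, against compactness.\<close>

lemma eigensystem_unextendable:
  assumes t: "t > 0"
  shows "\<exists>B. eigensystem t B \<and> (\<forall>e. e \<notin> B \<longrightarrow> \<not> eigensystem t (insert e B))"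
proof (rule ccontr)
  assume "\<not> ?thesis"
  then have "\<forall>B. \<exists>e. eigensystem t B \<longrightarrow> e \<notin> B \<and> eigensystem t (insert e B)" by blast
  then obtain ext where ext: "\<And>B. eigensystem t B \<Longrightarrow> ext B \<notin> B"
      "\<And>B. eigensystem t B \<Longrightarrow> eigensystem t (insert (ext B) B)" by metis
  define Bs where "Bs = rec_nat {} (\<lambda>_ B. insert (ext B) B)"
  have Bs: "Bs 0 = {}" "\<And>n. Bs (Suc n) = insert (ext (Bs n)) (Bs n)" by (simp_all add: Bs_def)
  have sys: "eigensystem t (Bs n)" for n
    by (induction n) (auto simp: Bs ext(2), auto simp: eigensystem_def orthonormal_def)
  define e where "e = (\<lambda>n. ext (Bs n))"
  have mono: "Bs a \<subseteq> Bs b" if "a \<le> b" for a b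
    using that by (induction b rule: dec_induct) (auto simp: Bs)
  have e_in: "e a \<in> Bs b" if "a < b" for a b
    using mono[of "Suc a" b] that by (auto simp: Bs e_def)
  have e_neq: "e a \<noteq> e b" if "a < b" for a b
    using e_in[OF that] ext(1)[OF sys[of b]] by (auto simp: e_def)
  have e_ip: "ip (e a) (e b) = (if a = b then 1 else 0)" for a b
  proof -
    let ?n = "Suc (max a b)"
    have "orthonormal (Bs ?n)" using sys by (auto simp: eigensystem_def)
    moreover have "e a \<in> Bs ?n" "e b \<in> Bs ?n" by (intro e_in; simp)+
    moreover have "e a = e b \<longleftrightarrow> a = b" using e_neq[of a b] e_neq[of b a] by (metis linorder_neqE_nat)
    ultimately show ?thesis by (auto simp: orthonormal_def)
  qed
  have eX: "e n \<in> X" for n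
    using sys[of "Suc n"] e_in[of n "Suc n"] by (auto simp: eigensystem_def orthonormal_def)
  have "\<exists>\<tau>. \<tau> \<ge> t \<and> T (e n) = complex_of_real \<tau> \<star> e n" for n
    using sys[of "Suc n"] e_in[of n "Suc n"] unfolding eigensystem_def by blast
  then obtain \<tau> where \<tau>: "\<And>n. \<tau> n \<ge> t" "\<And>n. T (e n) = complex_of_real (\<tau> n) \<star> e n" by metis
  have sep: "nrm2 (T (e a) - T (e b)) \<ge> 2 * t\<^sup>2" if "a \<noteq> b" for a b
  proof -
    have "nrm2 (T (e a) - T (e b)) = (\<tau> a)\<^sup>2 + (\<tau> b)\<^sup>2"
      unfolding \<tau>(2) nrm2_diff[OF X_simps(4)[OF eX] X_simps(4)[OF eX]] nrm2_scale[OF eX]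
      using that eX by (simp add: ip_scale ip_scale_right e_ip)
    moreover have "t\<^sup>2 \<le> (\<tau> a)\<^sup>2" "t\<^sup>2 \<le> (\<tau> b)\<^sup>2" using t \<tau>(1)[of a] \<tau>(1)[of b] by (auto intro: power_mono)
    ultimately show ?thesis by simp
  qed
  obtain y k where y: "y \<in> X" "strict_mono k" "(\<lambda>n. nrm2 (T (e (k n)) - y)) \<longlonglongrightarrow> 0"
    using T_compact[of e] eX e_ip by auto
  have "\<forall>\<^sub>F n in sequentially. nrm2 (T (e (k n)) - y) < t\<^sup>2 / 2"
    using t by (intro order_tendstoD(2)[OF y(3)]) simp
  then obtain N where N: "\<And>n. n \<ge> N \<Longrightarrow> nrm2 (T (e (k n)) - y) < t\<^sup>2 / 2"
    by (auto simp: eventually_sequentially)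
  \<comment> \<open>Two images within squared distance \<open>t^2 / 2\<close> of \<open>y\<close>
    are less than \<open>2 t^2\<close> apart, by the factors 2 in
    \<open>nrm2_diff_triangle\<close>.\<close>
  have "k N \<noteq> k (Suc N)" using strict_monoD[OF y(2), of N "Suc N"] by simp
  from sep[OF this] have "2 * t\<^sup>2 \<le> 2 * nrm2 (T (e (k N)) - y) + 2 * nrm2 (T (e (k (Suc N))) - y)"
    using nrm2_diff_triangle[of "T (e (k N))" "T (e (k (Suc N)))" y] eX y(1) by auto
  then show False using N[of N] N[of "Suc N"] t by simp
qed

text \<open>The orthogonal complement of an eigensystem is closed and invariant under
  \<open>T\<close>. If the Rayleigh quotient reached \<open>t\<close> there, the complement would
  contain an eigenvector which, once normalized, extends the unextendable system.\<close>

lemma maximal_eigensystem_exists: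
  assumes t: "t > 0"
  shows "\<exists>B. maximal_eigensystem t B"
proof -
  obtain B where B: "eigensystem t B" "\<And>e. e \<notin> B \<Longrightarrow> \<not> eigensystem t (insert e B)"
    using eigensystem_unextendable[OF t] by blast
  have BX: "B \<subseteq> X" using B by (auto simp: eigensystem_def orthonormal_def)
  have "Re (ip (T f) f) < t * nrm2 f" if f: "f \<in> X" "f \<noteq> 0" "\<forall>e\<in>B. ip f e = 0" for f
  proof (rule ccontr)
    assume "\<not> ?thesis"
    then have ge: "t * nrm2 f \<le> Re (ip (T f) f)" by simp
    define S where "S = {x \<in> X. \<forall>e\<in>B. ip x e = 0}"
    have TS: "T x \<in> S" if x: "x \<in> S" for x
    proof -
      have xX: "x \<in> X" using x by (simp add: S_def)
      have "ip (T x) e = 0" if e: "e \<in> B" for e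
      proof -
        obtain \<tau> where \<tau>: "T e = complex_of_real \<tau> \<star> e" using e B(1) unfolding eigensystem_def by blast
        have eX: "e \<in> X" using e BX by auto
        have "ip (T x) e = ip x (T e)" using xX eX by (rule T_symmetric)
        also have "\<dots> = cnj (complex_of_real \<tau>) * ip x e" unfolding \<tau> using eX xX by (rule ip_scale_right)
        also have "\<dots> = 0" using x e by (simp add: S_def)
        finally show ?thesis .
      qed
      then show ?thesis using xX by (simp add: S_def)
    qed
    have "\<exists>m e. m \<ge> t \<and> e \<in> S \<and> e \<noteq> 0 \<and> T e = complex_of_real m \<star> e"
    proof (rule rayleigh_attained)
      show "S \<subseteq> X" by (auto simp: S_def)
      show "x - y \<in> S" if "x \<in> S" "y \<in> S" for x y
        using that BX by (auto simp: S_def ip_diff subset_iff)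
      show "c \<star> x \<in> S" if "x \<in> S" for c x
        using that BX by (auto simp: S_def ip_scale subset_iff)
      show "T x \<in> S" if "x \<in> S" for x by (rule TS[OF that])
      show "f \<in> S" "f \<noteq> 0" "t * nrm2 f \<le> Re (ip (T f) f)" "t > 0" using f ge t by (auto simp: S_def)
    next
      fix h y assume h: "\<And>n. h n \<in> S" "y \<in> X" "(\<lambda>n. nrm2 (h n - y)) \<longlonglongrightarrow> 0"
      \<comment> \<open>Closedness of the complement: \<open>ip y e\<close> differs from 0 only by
        the sign and the size of \<open>ip (h n - y) e\<close>, which Bessel's inequality makes
        small.\<close>
      have "ip y e = 0" if e: "e \<in> B" for e
      proof -
        have e1: "e \<in> X" "nrm2 e = 1" using e B by (auto simp: eigensystem_def orthonormal_def)
        have hX: "h n \<in> X" for n using h(1)[of n] by (simp add: S_def)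
        have "(cmod (ip y e))\<^sup>2 \<le> nrm2 (h n - y)" for n
        proof -
          have "ip (h n) e = 0" using h(1)[of n] e by (simp add: S_def)
          then have "ip (h n - y) e = - ip y e" using ip_diff[OF hX h(2) e1(1), of n] by simp
          then show ?thesis using cmod_ip_unit_le[of "h n - y" e] hX h(2) e1 by simp
        qed
        then have "(cmod (ip y e))\<^sup>2 \<le> 0" by (intro LIMSEQ_le_const[OF h(3)]) auto
        then show ?thesis by simp
      qed
      then show "y \<in> S" using h(2) by (simp add: S_def)
    qed
    then obtain m e where m: "m \<ge> t" "e \<in> S" "e \<noteq> 0" "T e = complex_of_real m \<star> e" by blast
    have eX: "e \<in> X" using m(2) by (simp add: S_def)
    define a where "a = complex_of_real (1 / sqrt (nrm2 e))"
    define h where "h = a \<star> e"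
    have hX: "h \<in> X" using eX by (auto simp: h_def)
    have "nrm2 h = 1"
      using nrm2_pos[OF eX m(3)] unfolding h_def nrm2_scale[OF eX] by (simp add: a_def norm_divide power_divide)
    then have h1: "ip h h = 1" using ip_self[OF hX] by simp
    have h0: "ip h b = 0" "ip b h = 0" if "b \<in> B" for b
    proof -
      have bX: "b \<in> X" using that BX by auto
      show "ip h b = 0" unfolding h_def ip_scale[OF eX bX] using m(2) that by (simp add: S_def)
      then show "ip b h = 0" using ip_cnj[OF hX bX] by simp
    qed
    have "h \<notin> B" using h0(1)[of h] h1 by auto
    moreover have "eigensystem t (insert h B)"
    proof -
      have "T h = complex_of_real m \<star> h"
        using eX m(4) by (simp add: h_def T_scale mult.commute)
      then show ?thesis using B(1) m(1) hX h1 h0 by (auto simp: eigensystem_def orthonormal_def)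
    qed
    ultimately show False using B(2) by blast
  qed
  then show ?thesis using B(1) by (auto simp: maximal_eigensystem_def)
qed

context
  fixes t B
  assumes t: "t > 0" and B: "maximal_eigensystem t B"
begin

text \<open>Symmetry makes \<open>x\<close> orthogonal to the eigenvectors in \<open>B\<close> with
  other eigenvalues, so its projection \<open>p\<close> is again an eigenvector for
  \<open>\<tau>\<close>. Then \<open>x - p\<close> is orthogonal to \<open>B\<close> with Rayleigh
  quotient \<open>\<tau> \<ge> t\<close>, which maximality allows only for 0.\<close>

lemma eigenvectors_in_span:
  assumes \<tau>: "\<tau> \<ge> t" and x: "x \<in> X" "T x = complex_of_real \<tau> \<star> x"
  shows "x \<in> span {e \<in> B. T e = complex_of_real \<tau> \<star> e}"
proof -
  have on: "orthonormal B" and fin: "finite B" and BX: "B \<subseteq> X"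
    using B by (auto simp: maximal_eigensystem_def eigensystem_def orthonormal_def)
  define p where "p = (\<Sum>e\<in>B. ip x e \<star> e)"
  have pX: "p \<in> X" using BX by (auto simp: p_def)
  have zero: "ip x e = 0 \<or> T e = complex_of_real \<tau> \<star> e" if e: "e \<in> B" for e
  proof -
    have eX: "e \<in> X" using e BX by auto
    obtain \<sigma> where \<sigma>: "T e = complex_of_real \<sigma> \<star> e"
      using e B unfolding maximal_eigensystem_def eigensystem_def by blast
    have "complex_of_real \<tau> * ip x e = ip (T x) e" unfolding x(2) by (rule ip_scale[OF x(1) eX, symmetric])
    also have "\<dots> = ip x (T e)" by (rule T_symmetric[OF x(1) eX])
    also have "\<dots> = complex_of_real \<sigma> * ip x e" unfolding \<sigma> ip_scale_right[OF eX x(1)] by simp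
    finally show ?thesis using \<sigma> by auto
  qed
  have Tp: "T p = complex_of_real \<tau> \<star> p"
  proof -
    have "T p = (\<Sum>e\<in>B. ip x e \<star> T e)"
      unfolding p_def using BX by (subst T_sum) (auto intro!: sum.cong simp: T_scale)
    also have "\<dots> = (\<Sum>e\<in>B. complex_of_real \<tau> \<star> (ip x e \<star> e))"
    proof (intro sum.cong refl)
      fix e assume "e \<in> B"
      from zero[OF this] show "ip x e \<star> T e = complex_of_real \<tau> \<star> (ip x e \<star> e)"
        by (elim disjE) (simp_all add: mult.commute)
    qed
    finally show ?thesis by (simp add: p_def scale_sum_right)
  qed
  have "ip (x - p) e = 0" if "e \<in> B" for e
  proof -
    have "ip (x - p) e = ip x e - ip p e" using x(1) pX that BX by (intro ip_diff) auto
    then show ?thesis unfolding p_def ip_orthonormal_combination[OF on fin that] by simp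
  qed
  moreover have "t * nrm2 (x - p) \<le> Re (ip (T (x - p)) (x - p))"
  proof -
    have "T (x - p) = complex_of_real \<tau> \<star> (x - p)"
      unfolding T_diff[OF x(1) pX] Tp x(2) by (simp add: scale_right_diff_distrib)
    then have "Re (ip (T (x - p)) (x - p)) = \<tau> * nrm2 (x - p)"
      using ip_scale[of "x - p" "x - p" "complex_of_real \<tau>"] x(1) pX by simp
    then show ?thesis using \<tau> ip_nonneg[of "x - p"] x(1) pX by (simp add: mult_right_mono)
  qed
  ultimately have "x - p = 0"
    using B x(1) pX X_simps(3)[OF x(1) pX] unfolding maximal_eigensystem_def by (meson not_less)
  then have "x = (\<Sum>e\<in>B. ip x e \<star> e)" by (simp add: p_def)
  also have "\<dots> = (\<Sum>e\<in>{e \<in> B. T e = complex_of_real \<tau> \<star> e}. ip x e \<star> e)"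
    using zero fin by (intro sum.mono_neutral_right) auto
  also have "\<dots> \<in> span {e \<in> B. T e = complex_of_real \<tau> \<star> e}"
    by (intro span_sum span_scale span_base)
  finally show ?thesis .
qed

lemma geom_mult_eq_card:
  assumes \<tau>: "\<tau> \<ge> t"
  shows "geom_mult \<tau> = card {e \<in> B. T e = complex_of_real \<tau> \<star> e}"
  unfolding geom_mult_def
proof (rule basis_card_eq_dim[symmetric])
  have "orthonormal {e \<in> B. T e = complex_of_real \<tau> \<star> e}" "finite {e \<in> B. T e = complex_of_real \<tau> \<star> e}"
    using B by (auto simp: maximal_eigensystem_def eigensystem_def orthonormal_def)
  then show "independent {e \<in> B. T e = complex_of_real \<tau> \<star> e}" by (rule orthonormal_independent)
  show "{e \<in> B. T e = complex_of_real \<tau> \<star> e} \<subseteq> {x \<in> X. T x = complex_of_real \<tau> \<star> x}"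
    using B by (auto simp: maximal_eigensystem_def eigensystem_def orthonormal_def)
  show "{x \<in> X. T x = complex_of_real \<tau> \<star> x} \<subseteq> span {e \<in> B. T e = complex_of_real \<tau> \<star> e}"
    using eigenvectors_in_span[OF \<tau>] by auto
qed

text \<open>\<open>B\<close> is partitioned by the eigenvalues of its elements, and each class is a
  basis of its eigenspace. So the sum of multiplicities becomes a number of orthonormal vectors, to
  which dimension counting applies.\<close>

lemma eigenvalue_count_eq_card:
  shows "finite {\<tau>. t \<le> \<tau> \<and> geom_mult \<tau> \<noteq> 0}" "eigenvalue_count t = card B"
proof -
  let ?M = "{\<tau>. t \<le> \<tau> \<and> geom_mult \<tau> \<noteq> 0}"
  have fin: "finite B" and sys: "eigensystem t B"
    using B by (auto simp: maximal_eigensystem_def eigensystem_def)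
  obtain ev where ev: "\<And>e. e \<in> B \<Longrightarrow> ev e \<ge> t \<and> T e = complex_of_real (ev e) \<star> e"
    using sys unfolding eigensystem_def by metis
  have ne: "e \<noteq> 0" if "e \<in> B" for e
    using sys that by (fastforce simp: eigensystem_def orthonormal_def)
  have unique: "\<sigma> = ev e" if "e \<in> B" "T e = complex_of_real \<sigma> \<star> e" for e \<sigma>
    using ev[OF that(1)] ne[OF that(1)] that(2) by (simp add: scale_right_imp_eq)
  have M: "?M \<subseteq> ev ` B"
  proof
    fix \<tau> assume "\<tau> \<in> ?M"
    then have "card {e \<in> B. T e = complex_of_real \<tau> \<star> e} \<noteq> 0" using geom_mult_eq_card by auto
    then obtain e where "e \<in> B" "T e = complex_of_real \<tau> \<star> e" by (auto simp: card_eq_0_iff)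
    then show "\<tau> \<in> ev ` B" using unique by auto
  qed
  then show finM: "finite ?M" using fin by (rule finite_subset[OF _ finite_imageI])
  have "B = (\<Union>\<tau>\<in>?M. {e \<in> B. T e = complex_of_real \<tau> \<star> e})"
  proof
    show "B \<subseteq> (\<Union>\<tau>\<in>?M. {e \<in> B. T e = complex_of_real \<tau> \<star> e})"
    proof
      fix e assume e: "e \<in> B"
      then have "geom_mult (ev e) \<noteq> 0" using ev[OF e] fin by (auto simp: geom_mult_eq_card card_eq_0_iff)
      then show "e \<in> (\<Union>\<tau>\<in>?M. {e \<in> B. T e = complex_of_real \<tau> \<star> e})" using e ev[OF e] by auto
    qed
  qed auto
  then have "card B = card (\<Union>\<tau>\<in>?M. {e \<in> B. T e = complex_of_real \<tau> \<star> e})" by simp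
  also have "\<dots> = (\<Sum>\<tau>\<in>?M. card {e \<in> B. T e = complex_of_real \<tau> \<star> e})"
  proof (rule card_UN_disjoint[OF finM]; intro ballI impI)
    fix i j :: real assume "i \<noteq> j"
    have "False" if "e \<in> B" "T e = complex_of_real i \<star> e" "T e = complex_of_real j \<star> e" for e
      using unique[OF that(1,2)] unique[OF that(1,3)] \<open>i \<noteq> j\<close> by simp
    then show "{e \<in> B. T e = complex_of_real i \<star> e} \<inter> {e \<in> B. T e = complex_of_real j \<star> e} = {}"
      by blast
  qed (use fin in auto)
  also have "\<dots> = eigenvalue_count t"
    unfolding eigenvalue_count_def by (intro sum.cong) (auto simp: geom_mult_eq_card)
  finally show "eigenvalue_count t = card B" by simp
qed

end

lemma finite_eigenvalues_above: "t > 0 \<Longrightarrow> finite {\<tau>. t \<le> \<tau> \<and> geom_mult \<tau> \<noteq> 0}"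
  using maximal_eigensystem_exists[of t] eigenvalue_count_eq_card(1) by blast

text \<open>With finitely many positive eigenvalues some \<open>t > 0\<close> lies below all of
  them, and a maximal system for \<open>t\<close> spans all eigenvectors with positive eigenvalue. A
  vector \<open>f\<close> orthogonal to it stays orthogonal to the systems of every smaller
  threshold, yet its Rayleigh quotient is positive.\<close>

lemma infinitely_many_eigenvalues:
  assumes inf: "\<And>B. finite B \<Longrightarrow> B \<subseteq> X \<Longrightarrow> \<exists>f\<in>X. f \<noteq> 0 \<and> (\<forall>e\<in>B. ip f e = 0)"
  shows "infinite {\<tau>. 0 < \<tau> \<and> geom_mult \<tau> \<noteq> 0}"
proof
  let ?M = "{\<tau>. 0 < \<tau> \<and> geom_mult \<tau> \<noteq> 0}"
  assume fin: "finite ?M"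
  \<comment> \<open>The element 1 keeps the minimum meaningful when \<open>?M\<close> is
    empty.\<close>
  define t where "t = Min (insert 1 ?M)"
  have t: "t > 0" using fin by (simp add: t_def)
  have t_le: "t \<le> \<tau>" if "\<tau> \<in> ?M" for \<tau> unfolding t_def using fin that by (intro Min_le) auto
  obtain B where B: "maximal_eigensystem t B" using maximal_eigensystem_exists[OF t] by blast
  then have BX: "B \<subseteq> X" "finite B" by (auto simp: maximal_eigensystem_def eigensystem_def orthonormal_def)
  obtain f where f: "f \<in> X" "f \<noteq> 0" "\<forall>e\<in>B. ip f e = 0" using inf[OF BX(2,1)] by blast
  have nf: "nrm2 f > 0" using nrm2_pos f by auto
  define \<epsilon> where "\<epsilon> = Re (ip (T f) f) / nrm2 f"
  have \<epsilon>: "\<epsilon> > 0" using T_positive f nf by (simp add: \<epsilon>_def)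
  \<comment> \<open>A threshold that the Rayleigh quotient \<open>\<epsilon>\<close> of
    \<open>f\<close> reaches, so that orthogonality to \<open>B'\<close> becomes
    contradictory.\<close>
  define t' where "t' = min t \<epsilon>"
  have t': "t' > 0" using t \<epsilon> by (simp add: t'_def)
  obtain B' where B': "maximal_eigensystem t' B'" using maximal_eigensystem_exists[OF t'] by blast
  have "ip f e = 0" if e: "e \<in> B'" for e
  proof -
    have sys: "eigensystem t' B'" using B' by (simp add: maximal_eigensystem_def)
    then obtain \<tau> where \<tau>: "\<tau> \<ge> t'" "T e = complex_of_real \<tau> \<star> e"
      using e by (auto simp: eigensystem_def)
    have eX: "e \<in> X" using sys e by (auto simp: eigensystem_def orthonormal_def)
    have "geom_mult \<tau> \<noteq> 0"
      using geom_mult_eq_card[OF t' B' \<tau>(1)] e \<tau>(2) sys by (auto simp: eigensystem_def card_eq_0_iff)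
    then have "\<tau> \<ge> t" using t_le \<tau>(1) t' by auto
    from eigenvectors_in_span[OF t B this eX \<tau>(2)] have "e \<in> span B"
      by (rule subsetD[OF span_mono, rotated]) auto
    moreover have "subspace {x \<in> X. ip x f = 0}"
      by (rule subspaceI) (use f(1) in \<open>auto simp: ip_add ip_scale\<close>)
    moreover have "B \<subseteq> {x \<in> X. ip x f = 0}"
    proof
      fix b assume "b \<in> B"
      then have "b \<in> X" "ip f b = 0" using BX f(3) by auto
      then show "b \<in> {x \<in> X. ip x f = 0}" using ip_cnj[OF f(1), of b] by auto
    qed
    ultimately have "ip e f = 0" using span_minimal by blast
    then show ?thesis using ip_cnj[OF eX f(1)] by simp
  qed
  then have "Re (ip (T f) f) < t' * nrm2 f" using B' f by (auto simp: maximal_eigensystem_def)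
  also have "\<dots> \<le> \<epsilon> * nrm2 f" using nf by (intro mult_right_mono) (auto simp: t'_def)
  finally show False using nf by (simp add: \<epsilon>_def)
qed

end

text \<open>A combination of eigenvectors of \<open>T\<^sub>2\<close> that is orthogonal to those of \<open>T\<^sub>1\<close> and annihilated by the
  functionals would violate the variational bound for \<open>T\<^sub>1\<close>.\<close>

lemma (in inner_space) eigenvalue_count_le:
  assumes 1: "compact_positive_operator scale X ip T1" and 2: "compact_positive_operator scale X ip T2"
    and L: "finite L" "\<And>l x y. l \<in> L \<Longrightarrow> x \<in> X \<Longrightarrow> y \<in> X \<Longrightarrow> l (x + y) = l x + l y"
      "\<And>l c x. l \<in> L \<Longrightarrow> x \<in> X \<Longrightarrow> l (c \<star> x) = c * (l x :: complex)"
    and dom: "\<And>f. f \<in> X \<Longrightarrow> \<forall>l\<in>L. l f = 0 \<Longrightarrow> Re (ip (T2 f) f) \<le> Re (ip (T1 f) f)"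
    and t: "t > 0"
  shows "compact_positive_operator.eigenvalue_count scale X T2 t
    \<le> compact_positive_operator.eigenvalue_count scale X T1 t + card L"
proof -
  interpret T1: compact_positive_operator scale X ip T1 by (rule 1)
  interpret T2: compact_positive_operator scale X ip T2 by (rule 2)
  obtain B1 where B1: "T1.maximal_eigensystem t B1" using T1.maximal_eigensystem_exists[OF t] by blast
  obtain B2 where B2: "T2.maximal_eigensystem t B2" using T2.maximal_eigensystem_exists[OF t] by blast
  have fin: "finite B1" "B1 \<subseteq> X" "finite B2" "B2 \<subseteq> X" "orthonormal B2"
    using B1 B2 by (auto simp: T1.maximal_eigensystem_def T1.eigensystem_def T2.maximal_eigensystem_def
        T2.eigensystem_def orthonormal_def)
  have l_sum: "l (sum h J) = (\<Sum>j\<in>J. l (h j))" if l: "l \<in> L" "\<And>j. j \<in> J \<Longrightarrow> h j \<in> X" for l h J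
  proof -
    have "l 0 = 0" using L(3)[OF l(1), of 0 0] by simp
    then show ?thesis using l(2)
      by (induction J rule: infinite_finite_induct) (auto simp: L(2)[OF l(1)])
  qed
  have "card B2 \<le> card B1 + card L"
  proof (rule ccontr)
    assume "\<not> ?thesis"
    moreover have "card (Inl ` B1 \<union> Inr ` L) = card B1 + card L"
      using fin L(1) by (subst card_Un_disjoint) (auto simp: card_image)
    ultimately have "card (Inl ` B1 \<union> Inr ` L) < card B2" by simp
    then obtain c where c: "\<exists>e\<in>B2. c e \<noteq> 0"
      "\<forall>i\<in>Inl ` B1 \<union> Inr ` L. (\<Sum>e\<in>B2. (case i of Inl b \<Rightarrow> ip e b | Inr l \<Rightarrow> l e) * c e) = 0"
      using homogeneous_system_nontrivial[of "Inl ` B1 \<union> Inr ` L" B2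
          "\<lambda>i e. case i of Inl b \<Rightarrow> ip e b | Inr l \<Rightarrow> l e"] fin L(1) by auto
    define f where "f = (\<Sum>e\<in>B2. c e \<star> e)"
    have ceX: "c e \<star> e \<in> X" if "e \<in> B2" for e using that fin by auto
    then have fX: "f \<in> X" by (auto simp: f_def)
    have "f \<noteq> 0"
    proof
      assume "f = 0"
      then have "c e = 0" if "e \<in> B2" for e
        using ip_orthonormal_combination[OF fin(5,3) that, of c] that fin(4) by (auto simp: f_def)
      then show False using c(1) by auto
    qed
    moreover have "ip f b = 0" if b: "b \<in> B1" for b
    proof -
      have "ip f b = (\<Sum>e\<in>B2. ip (c e \<star> e) b)"
        unfolding f_def by (rule ip_sum) (use fin b in auto)
      also have "\<dots> = (\<Sum>e\<in>B2. ip e b * c e)" using fin b by (intro sum.cong) (auto simp: ip_scale subset_iff)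
      also have "\<dots> = 0" using c(2)[rule_format, of "Inl b"] b by simp
      finally show ?thesis .
    qed
    ultimately have "Re (ip (T1 f) f) < t * nrm2 f"
      using B1 fX by (auto simp: T1.maximal_eigensystem_def)
    moreover have "Re (ip (T2 f) f) \<le> Re (ip (T1 f) f)"
    proof (rule dom[OF fX], rule ballI)
      fix l assume l: "l \<in> L"
      have "l f = (\<Sum>e\<in>B2. l (c e \<star> e))" unfolding f_def by (rule l_sum[OF l ceX])
      also have "\<dots> = (\<Sum>e\<in>B2. l e * c e)" using fin l by (intro sum.cong) (auto simp: L(3) subset_iff)
      also have "\<dots> = 0" using c(2)[rule_format, of "Inr l"] l by simp
      finally show "l f = 0" .
    qed
    \<comment> \<open>On a combination of orthonormal eigenvectors the form of \<open>T2\<close> is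
      diagonal, with diagonal entries at least \<open>t\<close>.\<close>
    moreover have "t * nrm2 f \<le> Re (ip (T2 f) f)"
    proof -
      obtain ev where ev: "\<And>e. e \<in> B2 \<Longrightarrow> ev e \<ge> t \<and> T2 e = complex_of_real (ev e) \<star> e"
        using B2 unfolding T2.maximal_eigensystem_def T2.eigensystem_def by metis
      have "T2 f = (\<Sum>e\<in>B2. T2 (c e \<star> e))" unfolding f_def by (rule T2.T_sum) (rule ceX)
      also have "\<dots> = (\<Sum>e\<in>B2. (c e * complex_of_real (ev e)) \<star> e)"
        using ev fin by (intro sum.cong) (auto simp: T2.T_scale subset_iff)
      finally have "Re (ip (T2 f) f) = (\<Sum>e\<in>B2. Re (c e * complex_of_real (ev e) * cnj (c e)))"
        using ip_orthonormal_combinations[OF fin(5,3), of "\<lambda>e. c e * complex_of_real (ev e)" c]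
        by (simp add: f_def)
      also have "\<dots> = (\<Sum>e\<in>B2. ev e * (cmod (c e))\<^sup>2)"
        unfolding cmod_power2 by (intro sum.cong) (auto simp: power2_eq_square algebra_simps)
      also have "\<dots> \<ge> (\<Sum>e\<in>B2. t * (cmod (c e))\<^sup>2)"
        using ev by (intro sum_mono mult_right_mono) auto
      also have "(\<Sum>e\<in>B2. t * (cmod (c e))\<^sup>2) = t * nrm2 f"
        unfolding f_def ip_orthonormal_combinations[OF fin(5,3)] sum_distrib_left[symmetric]
        unfolding cmod_power2 by (simp add: power2_eq_square)
      finally show ?thesis .
    qed
    ultimately show False by simp
  qed
  then show ?thesis
    using T1.eigenvalue_count_eq_card(2)[OF t B1] T2.eigenvalue_count_eq_card(2)[OF t B2] by simp
qed

subsection \<open>Enumerating a multiset of reals\<close>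

lemma downward_closed_finite_nat:
  fixes A :: "nat set"
  assumes "finite A" "\<And>j k. k \<in> A \<Longrightarrow> j \<le> k \<Longrightarrow> j \<in> A"
  shows "A = {..<card A}"
proof -
  have "A \<subseteq> {..<card A}"
  proof
    fix k assume "k \<in> A"
    then have "{..k} \<subseteq> A" using assms(2) by auto
    then show "k \<in> {..<card A}" using card_mono[OF assms(1), of "{..k}"] by simp
  qed
  then show ?thesis by (intro card_subset_eq) auto
qed

text \<open>Summing only over the support of \<open>m\<close> gives a finite index set in the
  intended use; over an infinite one the sum would be 0 by convention.\<close>

definition count_le :: "(real \<Rightarrow> nat) \<Rightarrow> real \<Rightarrow> nat" where
  "count_le m z = (\<Sum>\<mu> | \<mu> \<le> z \<and> m \<mu> \<noteq> 0. m \<mu>)"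

text \<open>\<open>lists_eigenvalues\<close> for an arbitrary multiplicity function, so that
  existence, uniqueness and interlacing of lists can be treated without operators.\<close>

definition enumerates :: "(real \<Rightarrow> nat) \<Rightarrow> (nat \<Rightarrow> real) \<Rightarrow> bool" where
  "enumerates m s \<longleftrightarrow> mono s \<and> (\<forall>\<mu>. finite {k. s k = \<mu>} \<and> card {k. s k = \<mu>} = m \<mu>)"

text \<open>By monotonicity a sublevel set of \<open>s\<close> is an initial segment of nat, hence
  determined by its size. This adjunction between a list and its counting function yields both
  uniqueness and interlacing; the strict inequality reflects that indices start at 0.\<close>

lemma enumerates_le_iff:
  assumes fin: "\<And>z. finite {\<mu>. \<mu> \<le> z \<and> m \<mu> \<noteq> 0}" and s: "enumerates m s"
  shows "s k \<le> z \<longleftrightarrow> k < count_le m z"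
proof -
  let ?M = "{\<mu>. \<mu> \<le> z \<and> m \<mu> \<noteq> 0}"
  have fib: "finite {k. s k = \<mu>}" "card {k. s k = \<mu>} = m \<mu>" for \<mu>
    using s by (auto simp: enumerates_def)
  have ne: "m (s k) \<noteq> 0" for k
    using fib[of "s k"] by (metis (mono_tags) card_0_eq empty_iff mem_Collect_eq)
  have U: "{k. s k \<le> z} = (\<Union>\<mu>\<in>?M. {k. s k = \<mu>})" using ne by auto
  have "finite {k. s k \<le> z}" unfolding U using fin fib by auto
  moreover have "card {k. s k \<le> z} = count_le m z"
    unfolding U count_le_def by (subst card_UN_disjoint) (use fin fib in auto)
  moreover have "j \<in> {k. s k \<le> z}" if "k \<in> {k. s k \<le> z}" "j \<le> k" for j k
    using that s by (auto simp: enumerates_def dest!: monoD[of s j k])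
  ultimately have "{k. s k \<le> z} = {..<count_le m z}"
    using downward_closed_finite_nat[of "{k. s k \<le> z}"] by simp
  then show ?thesis by auto
qed

text \<open>The definite description in \<open>eigenval\<close> denotes because of this. Finiteness
  below each bound lets the values be listed upwards from the least, and infinitude of the support
  makes the list total on nat.\<close>

lemma enumerates_ex1:
  assumes fin: "\<And>z. finite {\<mu>. \<mu> \<le> z \<and> m \<mu> \<noteq> 0}" and inf: "infinite {\<mu>. m \<mu> \<noteq> 0}"
  shows "\<exists>!s. enumerates m s"
proof (rule ex_ex1I)
  define E where "E = {\<mu>. m \<mu> \<noteq> 0}"
  let ?N = "count_le m"
  have finE: "finite {\<mu>\<in>E. \<mu> \<le> z}" for z
    by (rule finite_subset[OF _ fin[of z]]) (auto simp: E_def)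
  have mono_N: "?N a \<le> ?N b" if "a \<le> b" for a b
    unfolding count_le_def using that fin by (intro sum_mono2) auto
  have big: "\<exists>\<mu>\<in>E. ?N \<mu> > k" for k
  proof -
    obtain F where F: "F \<subseteq> E" "finite F" "card F = Suc k"
      using infinite_arbitrarily_large[of E "Suc k"] inf by (auto simp: E_def)
    then have "F \<noteq> {}" by auto
    have "Suc k = (\<Sum>\<mu>\<in>F. 1)" using F by simp
    also have "\<dots> \<le> (\<Sum>\<mu>\<in>F. m \<mu>)" using F by (intro sum_mono) (auto simp: E_def Suc_le_eq)
    also have "\<dots> \<le> ?N (Max F)"
      unfolding count_le_def using fin F \<open>F \<noteq> {}\<close> by (intro sum_mono2) (auto simp: E_def)
    finally have "k < ?N (Max F)" by simp
    moreover have "Max F \<in> E" using F \<open>F \<noteq> {}\<close> Max_in[of F] by blast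
    ultimately show ?thesis by blast
  qed
  \<comment> \<open>\<open>s k\<close> is the least value in the support whose count exceeds
    \<open>k\<close>. The cut at some value with this property only makes the set finite, so that
    \<open>Min\<close> applies; the minimum does not depend on it.\<close>
  define s where "s = (\<lambda>k. Min {\<mu>\<in>E. \<mu> \<le> (SOME x. x \<in> E \<and> ?N x > k) \<and> ?N \<mu> > k})"
  have s: "s k \<in> E \<and> ?N (s k) > k \<and> (\<forall>\<mu>\<in>E. ?N \<mu> > k \<longrightarrow> s k \<le> \<mu>)" for k
  proof -
    define x where "x = (SOME x. x \<in> E \<and> ?N x > k)"
    have x: "x \<in> E" "?N x > k" using someI_ex[of "\<lambda>x. x \<in> E \<and> ?N x > k"] big[of k] by (auto simp: x_def)
    let ?S = "{\<mu>\<in>E. \<mu> \<le> x \<and> ?N \<mu> > k}"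
    have S: "finite ?S" "?S \<noteq> {}" using x by (auto intro: finite_subset[OF _ finE[of x]])
    have sk: "s k = Min ?S" by (simp add: s_def x_def)
    have "s k \<in> ?S" unfolding sk using S by (rule Min_in)
    moreover have "s k \<le> \<mu>" if "\<mu> \<in> E" "?N \<mu> > k" for \<mu>
    proof (cases "\<mu> \<le> x")
      case True
      then show ?thesis unfolding sk using S that by (intro Min_le) auto
    next
      case False
      then show ?thesis using \<open>s k \<in> ?S\<close> by auto
    qed
    ultimately show ?thesis by auto
  qed
  have le_iff: "s k \<le> z \<longleftrightarrow> k < ?N z" for k z
  proof
    assume "s k \<le> z"
    then show "k < ?N z" using s[of k] mono_N[of "s k" z] by auto
  next
    assume k: "k < ?N z"
    let ?F = "{\<mu>\<in>E. \<mu> \<le> z}"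
    have ne: "?F \<noteq> {}"
    proof
      assume "?F = {}"
      then have "{\<mu>. \<mu> \<le> z \<and> m \<mu> \<noteq> 0} = {}" by (auto simp: E_def)
      then show False using k unfolding count_le_def by simp
    qed
    \<comment> \<open>The counting function is constant between the largest value of the support
      below \<open>z\<close> and \<open>z\<close> itself.\<close>
    define \<mu> where "\<mu> = Max ?F"
    have \<mu>: "\<mu> \<in> ?F" unfolding \<mu>_def using finE ne by (rule Max_in)
    have "{\<nu>. \<nu> \<le> \<mu> \<and> m \<nu> \<noteq> 0} = {\<nu>. \<nu> \<le> z \<and> m \<nu> \<noteq> 0}"
    proof -
      have "x \<le> \<mu>" if "x \<in> ?F" for x unfolding \<mu>_def using that by (rule Max_ge[OF finE])
      then show ?thesis using \<mu> by (auto simp: E_def)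
    qed
    then have "?N \<mu> = ?N z" by (simp add: count_le_def)
    then show "s k \<le> z" using s[of k] k \<mu> by (metis (mono_tags, lifting) mem_Collect_eq order_trans)
  qed
  have "mono s"
  proof (rule monoI)
    fix j k :: nat assume "j \<le> k"
    then show "s j \<le> s k" using le_iff[of k "s k"] by (simp add: le_iff)
  qed
  moreover have "finite {k. s k = \<mu>} \<and> card {k. s k = \<mu>} = m \<mu>" for \<mu>
  proof -
    define F where "F = {\<nu>. \<nu> < \<mu> \<and> m \<nu> \<noteq> 0}"
    have F: "finite F" by (rule finite_subset[OF _ fin[of \<mu>]]) (auto simp: F_def)
    have N: "?N \<mu> = sum m F + m \<mu>"
    proof (cases "m \<mu> = 0")
      case True
      then have "{\<nu>. \<nu> \<le> \<mu> \<and> m \<nu> \<noteq> 0} = F" by (auto simp: F_def order_le_less)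
      then show ?thesis using True by (simp add: count_le_def)
    next
      case False
      then have "{\<nu>. \<nu> \<le> \<mu> \<and> m \<nu> \<noteq> 0} = insert \<mu> F" by (auto simp: F_def order_le_less)
      then show ?thesis using F by (simp add: count_le_def F_def)
    qed
    have less_iff: "s k < \<mu> \<longleftrightarrow> k < sum m F" for k
    proof (cases "F = {}")
      case True
      then show ?thesis using s[of k] by (auto simp: F_def E_def)
    next
      case False
      define \<nu> where "\<nu> = Max F"
      have \<nu>: "\<nu> \<in> F" unfolding \<nu>_def using F False by (rule Max_in)
      have "{\<kappa>. \<kappa> \<le> \<nu> \<and> m \<kappa> \<noteq> 0} = F"
      proof -
        have "x \<le> \<nu>" if "x \<in> F" for x unfolding \<nu>_def using that by (rule Max_ge[OF F])
        then show ?thesis using \<nu> by (auto simp: F_def)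
      qed
      then have "?N \<nu> = sum m F" by (simp add: count_le_def)
      moreover have "s k < \<mu> \<longleftrightarrow> s k \<le> \<nu>"
      proof
        assume "s k < \<mu>"
        then have "s k \<in> F" using s[of k] by (auto simp: F_def E_def)
        then show "s k \<le> \<nu>" unfolding \<nu>_def using F by (rule Max_ge[rotated])
      qed (use \<nu> in \<open>auto simp: F_def\<close>)
      ultimately show ?thesis by (simp add: le_iff)
    qed
    \<comment> \<open>The indices with value \<open>\<mu>\<close> start at the number of entries
      below \<open>\<mu>\<close> and end before the number of entries up to \<open>\<mu>\<close>;
      the difference is \<open>m \<mu>\<close>.\<close>
    have "{k. s k = \<mu>} = {sum m F..<?N \<mu>}"
    proof (rule Set.set_eqI)
      fix k
      have "s k = \<mu> \<longleftrightarrow> s k \<le> \<mu> \<and> \<not> s k < \<mu>" by auto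
      then show "k \<in> {k. s k = \<mu>} \<longleftrightarrow> k \<in> {sum m F..<?N \<mu>}"
        unfolding le_iff less_iff by auto
    qed
    then show ?thesis by (simp add: N)
  qed
  ultimately show "\<exists>s. enumerates m s" by (auto simp: enumerates_def)
next
  fix s s' assume "enumerates m s" "enumerates m s'"
  from this[THEN enumerates_le_iff[OF fin]] have "s k \<le> z \<longleftrightarrow> s' k \<le> z" for k z by auto
  then show "s = s'" by (intro ext) (metis order_antisym order_refl)
qed

text \<open>Inequalities between counting functions turn into reversed inequalities between lists,
  evaluated at \<open>s' k\<close> and at \<open>s (Suc k)\<close>; the additional 1 in the count
  becomes the shift of the index.\<close>

lemma enumerates_interlace:
  assumes fin: "\<And>z. finite {\<mu>. \<mu> \<le> z \<and> m \<mu> \<noteq> 0}" "\<And>z. finite {\<mu>. \<mu> \<le> z \<and> m' \<mu> \<noteq> 0}"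
    and s: "enumerates m s" "enumerates m' s'"
    and le: "\<And>z. count_le m' z \<le> count_le m z" "\<And>z. count_le m z \<le> count_le m' z + 1"
  shows "s k \<le> s' k" "s' k \<le> s (Suc k)"
proof -
  note iff = enumerates_le_iff[OF fin(1) s(1)] enumerates_le_iff[OF fin(2) s(2)]
  show "s k \<le> s' k" using iff(2)[of k "s' k"] le(1)[of "s' k"] by (simp add: iff(1))
  show "s' k \<le> s (Suc k)" using iff(1)[of "Suc k" "s (Suc k)"] le(2)[of "s (Suc k)"] by (simp add: iff(2))
qed

lemma enumerates_value: "enumerates m s \<Longrightarrow> m (s k) \<noteq> 0"
  by (metis (mono_tags, lifting) enumerates_def card_0_eq empty_iff mem_Collect_eq)

subsection \<open>Indefinite integrals on an interval\<close>

lemma absolutely_integrable_mult_continuous: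
  fixes f g :: "real \<Rightarrow> complex"
  assumes "f absolutely_integrable_on {a..b}" "continuous_on {a..b} g"
  shows "(\<lambda>t. f t * g t) absolutely_integrable_on {a..b}"
proof -
  have "(\<lambda>t. (\<lambda>x y. y * x) (g t) (f t)) absolutely_integrable_on {a..b}"
  proof (rule absolutely_integrable_bounded_measurable_product[where h = "\<lambda>x y :: complex. y * x" and f = g and g = f])
    show "bilinear (\<lambda>x y :: complex. y * x)"
      by (simp add: bilinear_conv_bounded_bilinear bounded_bilinear.flip[OF bounded_bilinear_mult])
    show "g \<in> borel_measurable (lebesgue_on {a..b})"
      using assms(2) by (intro continuous_imp_measurable_on_sets_lebesgue) auto
    show "bounded (g ` {a..b})"
      using assms(2) by (intro compact_imp_bounded compact_continuous_image) auto
  qed (use assms(1) in auto)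
  then show ?thesis by simp
qed

lemma indefinite_integral_diff:
  fixes f :: "real \<Rightarrow> 'a::banach"
  assumes "f integrable_on {a..b}" "a \<le> x" "x \<le> y" "y \<le> b"
  shows "integral {a..y} f - integral {a..x} f = integral {x..y} f"
proof -
  have "f integrable_on {a..y}" using assms by (intro integrable_subinterval_real[OF assms(1)]) auto
  from Henstock_Kurzweil_Integration.integral_combine[OF assms(2,3) this] show ?thesis by (simp add: algebra_simps)
qed

text \<open>The defect of the product rule over \<open>[x, y]\<close> is quadratically small with respect to the
  increment of a continuous monotone function \<open>A\<close>; halving the increment of \<open>A\<close> over and over
  shows that it vanishes.\<close>

lemma quadratically_small_increment_zero:
  fixes \<phi> :: "real \<Rightarrow> 'a::real_normed_vector" and A :: "real \<Rightarrow> real"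
  assumes A: "continuous_on {a..b} A"
    and small: "\<And>x y. \<lbrakk>a \<le> x; x \<le> y; y \<le> b\<rbrakk> \<Longrightarrow> norm (\<phi> y - \<phi> x) \<le> (A y - A x)\<^sup>2"
    and mono: "\<And>x y. \<lbrakk>a \<le> x; x \<le> y; y \<le> b\<rbrakk> \<Longrightarrow> A x \<le> A y"
    and ab: "a \<le> b"
  shows "\<phi> b = \<phi> a"
proof -
  have *: "norm (\<phi> y - \<phi> x) \<le> (A y - A x)\<^sup>2 / 2 ^ n" if "a \<le> x" "x \<le> y" "y \<le> b" for n x y
    using that
  proof (induction n arbitrary: x y)
    case 0
    then show ?case using small by simp
  next
    case (Suc n)
    have "continuous_on {x..y} A" using A Suc.prems by (auto intro: continuous_on_subset)
    \<comment> \<open>By the intermediate value theorem \<open>A\<close> splits its increment evenly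
      at \<open>c\<close>; two squares of half the increment add up to half the square.\<close>
    then obtain c where c: "x \<le> c" "c \<le> y" "A c = (A x + A y) / 2"
      using IVT'[of A x "(A x + A y) / 2" y] mono[of x y] Suc.prems by auto
    have "norm (\<phi> y - \<phi> x) \<le> norm (\<phi> y - \<phi> c) + norm (\<phi> c - \<phi> x)"
      by (metis norm_triangle_ineq diff_add_cancel add_diff_eq)
    also have "\<dots> \<le> (A y - A c)\<^sup>2 / 2 ^ n + (A c - A x)\<^sup>2 / 2 ^ n"
      using Suc.prems c by (intro add_mono Suc.IH) auto
    also have "\<dots> = (A y - A x)\<^sup>2 / 2 ^ Suc n"
      unfolding c(3) by (simp add: field_simps power2_eq_square)
    finally show ?case .
  qed
  have "(\<lambda>n. (A b - A a)\<^sup>2 * (1 / 2) ^ n) \<longlonglongrightarrow> (A b - A a)\<^sup>2 * 0"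
    by (intro tendsto_intros LIMSEQ_power_zero) auto
  moreover have "norm (\<phi> b - \<phi> a) \<le> (A b - A a)\<^sup>2 * (1 / 2) ^ n" for n
    using *[of a b n] ab by (simp add: power_divide)
  ultimately have "norm (\<phi> b - \<phi> a) \<le> 0" by (intro LIMSEQ_le_const) auto
  then show ?thesis by simp
qed

text \<open>Integration by parts for absolutely continuous functions. Derivatives exist only almost
  everywhere, so the argument compares increments with those of \<open>A\<close>, the indefinite
  integral of \<open>norm p + norm r\<close>, which dominates the variation of both \<open>P\<close>
  and \<open>Q\<close>.\<close>

lemma indefinite_integral_mult:
  fixes p r P Q :: "real \<Rightarrow> complex"
  assumes p: "p absolutely_integrable_on {a..b}" and r: "r absolutely_integrable_on {a..b}"
    and P: "\<And>x. x \<in> {a..b} \<Longrightarrow> P x = P a + integral {a..x} p"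
    and Q: "\<And>x. x \<in> {a..b} \<Longrightarrow> Q x = Q a + integral {a..x} r"
    and ab: "a \<le> b"
  shows "((\<lambda>t. p t * Q t + P t * r t) has_integral P b * Q b - P a * Q a) {a..b}"
proof -
  have pi: "p integrable_on {a..b}" and ri: "r integrable_on {a..b}"
    using p r by (auto simp: absolutely_integrable_on_def)
  have "continuous_on {a..b} (\<lambda>x. P a + integral {a..x} p)"
    by (intro continuous_intros indefinite_integral_continuous_1 pi)
  then have Pc: "continuous_on {a..b} P"
    by (rule continuous_on_eq) (use P in \<open>metis\<close>)
  have "continuous_on {a..b} (\<lambda>x. Q a + integral {a..x} r)"
    by (intro continuous_intros indefinite_integral_continuous_1 ri)
  then have Qc: "continuous_on {a..b} Q"
    by (rule continuous_on_eq) (use Q in \<open>metis\<close>)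
  define k where "k = (\<lambda>t. p t * Q t + P t * r t)"
  have ka: "k absolutely_integrable_on {a..b}"
    unfolding k_def using absolutely_integrable_mult_continuous[OF p Qc]
      absolutely_integrable_mult_continuous[OF r Pc]
    by (intro set_integral_add) (simp_all add: mult.commute)
  then have ki: "k integrable_on {a..b}" by (auto simp: absolutely_integrable_on_def)
  define n where "n = (\<lambda>t. norm (p t) + norm (r t))"
  have npi: "(\<lambda>t. norm (p t)) integrable_on {a..b}" and nri: "(\<lambda>t. norm (r t)) integrable_on {a..b}"
    using p r by (auto simp: absolutely_integrable_on_def)
  then have ni: "n integrable_on {a..b}" unfolding n_def by (rule integrable_add)
  define A where "A = (\<lambda>x. integral {a..x} n)"
  define \<phi> where "\<phi> = (\<lambda>x. P x * Q x - integral {a..x} k)"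
  have A_diff: "A y - A x = integral {x..y} n" if "a \<le> x" "x \<le> y" "y \<le> b" for x y
    unfolding A_def using that by (intro indefinite_integral_diff[OF ni]) auto
  have P_diff: "P y - P x = integral {x..y} p" and Q_diff: "Q y - Q x = integral {x..y} r"
    if "a \<le> x" "x \<le> y" "y \<le> b" for x y
    using P[of x] P[of y] Q[of x] Q[of y] indefinite_integral_diff[OF pi that]
      indefinite_integral_diff[OF ri that] that by auto
  have sub: "h integrable_on {x..y}" if "h integrable_on {a..b}" "a \<le> x" "y \<le> b" for x y and h :: "real \<Rightarrow> 'z::banach"
    using that by (intro integrable_subinterval_real[OF that(1)]) auto
  have bound: "norm (P y - P x) \<le> A y - A x" "norm (Q y - Q x) \<le> A y - A x"
    if xy: "a \<le> x" "x \<le> y" "y \<le> b" for x y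
    unfolding P_diff[OF xy] Q_diff[OF xy] A_diff[OF xy]
    by (intro integral_norm_bound_integral sub[OF pi] sub[OF ri] sub[OF ni] xy; simp add: n_def)+
  have mono: "A x \<le> A y" if "a \<le> x" "x \<le> y" "y \<le> b" for x y
    using bound(1)[OF that] norm_ge_zero[of "P y - P x"] by linarith
  have "\<phi> b = \<phi> a"
  proof (rule quadratically_small_increment_zero[OF _ _ mono ab])
    show "continuous_on {a..b} A" unfolding A_def by (rule indefinite_integral_continuous_1[OF ni])
  next
    fix x y assume xy: "a \<le> x" "x \<le> y" "y \<le> b"
    let ?M = "A y - A x"
    \<comment> \<open>The increments of \<open>P\<close> and \<open>Q\<close> are rewritten as
      integrals of \<open>p\<close> and \<open>r\<close>; the integrand left over contains
      differences \<open>Q y - Q t\<close> and \<open>P x - P t\<close>, each at most the increment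
      of \<open>A\<close>. A second such factor comes from integrating.\<close>
    have "\<phi> y - \<phi> x = (P y - P x) * Q y + P x * (Q y - Q x) - integral {x..y} k"
      using indefinite_integral_diff[OF ki xy] by (simp add: \<phi>_def algebra_simps)
    also have "\<dots> = integral {x..y} (\<lambda>t. p t * Q y) + integral {x..y} (\<lambda>t. P x * r t) - integral {x..y} k"
      unfolding P_diff[OF xy] Q_diff[OF xy] by simp
    also have "\<dots> = integral {x..y} (\<lambda>t. p t * (Q y - Q t) + (P x - P t) * r t)"
    proof -
      have "integral {x..y} (\<lambda>t. p t * (Q y - Q t) + (P x - P t) * r t) =
        integral {x..y} (\<lambda>t. (p t * Q y + P x * r t) - k t)"
        by (rule arg_cong[where f = "integral {x..y}"]) (auto simp: k_def algebra_simps)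
      also have "\<dots> = integral {x..y} (\<lambda>t. p t * Q y + P x * r t) - integral {x..y} k"
        using xy by (intro Henstock_Kurzweil_Integration.integral_diff sub[OF ki] integrable_add
            integrable_on_mult_left integrable_on_mult_right sub[OF pi] sub[OF ri])
      also have "integral {x..y} (\<lambda>t. p t * Q y + P x * r t) =
          integral {x..y} (\<lambda>t. p t * Q y) + integral {x..y} (\<lambda>t. P x * r t)"
        using xy by (intro Henstock_Kurzweil_Integration.integral_add
            integrable_on_mult_left integrable_on_mult_right sub[OF pi] sub[OF ri])
      finally show ?thesis by simp
    qed
    finally have "norm (\<phi> y - \<phi> x) = norm (integral {x..y} (\<lambda>t. p t * (Q y - Q t) + (P x - P t) * r t))"
      by simp
    also have "\<dots> \<le> integral {x..y} (\<lambda>t. n t * ?M)"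
    proof (rule integral_norm_bound_integral)
      have "(\<lambda>t. (p t * Q y + P x * r t) - k t) integrable_on {x..y}"
        using xy by (intro integrable_diff sub[OF ki] integrable_add
            integrable_on_mult_left integrable_on_mult_right sub[OF pi] sub[OF ri])
      then show "(\<lambda>t. p t * (Q y - Q t) + (P x - P t) * r t) integrable_on {x..y}"
        by (rule back_subst[where P = "\<lambda>f. f integrable_on {x..y}"]) (auto simp: k_def algebra_simps)
      show "(\<lambda>t. n t * ?M) integrable_on {x..y}"
        using xy by (intro integrable_on_mult_left sub[OF ni])
    next
      fix t assume t: "t \<in> {x..y}"
      have "norm (Q y - Q t) \<le> ?M" "norm (P x - P t) \<le> ?M"
        using bound(2)[of t y] bound(1)[of x t] mono[of x t] mono[of t y] xy t
        by (auto simp: norm_minus_commute)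
      moreover have "0 \<le> ?M" using mono[OF xy] by simp
      ultimately have "norm (p t * (Q y - Q t)) + norm ((P x - P t) * r t) \<le> norm (p t) * ?M + ?M * norm (r t)"
        unfolding norm_mult by (intro add_mono mult_mono) auto
      then show "norm (p t * (Q y - Q t) + (P x - P t) * r t) \<le> n t * ?M"
        using norm_triangle_ineq[of "p t * (Q y - Q t)" "(P x - P t) * r t"]
        by (simp add: n_def algebra_simps)
    qed
    also have "\<dots> = ?M\<^sup>2" by (simp add: A_diff[OF xy] power2_eq_square)
    finally show "norm (\<phi> y - \<phi> x) \<le> ?M\<^sup>2" .
  qed
  then have "integral {a..b} k = P b * Q b - P a * Q a" by (simp add: \<phi>_def algebra_simps)
  with ki have "(k has_integral P b * Q b - P a * Q a) {a..b}" by (simp add: has_integral_iff)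
  then show ?thesis by (simp only: k_def)
qed

subsection \<open>The Schroedinger equation on an interval\<close>

text \<open>The equation - f'' + q f = g in integrated form: with \<open>q\<close> merely
  integrable, \<open>f'\<close> is only absolutely continuous, so its increments are prescribed
  instead of a second derivative. In use \<open>q\<close> is the potential minus the shift
  \<open>m\<close>.\<close>

definition edge_solution ::
    "(real \<Rightarrow> real) \<Rightarrow> real \<Rightarrow> (real \<Rightarrow> complex) \<Rightarrow> (real \<Rightarrow> complex) \<Rightarrow> (real \<Rightarrow> complex) \<Rightarrow> bool" where
  "edge_solution q l f f' g \<longleftrightarrow> (\<forall>x\<in>{0..l}. (f has_vector_derivative f' x) (at x within {0..l}) \<and>
     f' x = f' 0 + integral {0..x} (\<lambda>t. complex_of_real (q t) * f t - g t))"

lemma edge_solutionD: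
  assumes "edge_solution q l f f' g" "x \<in> {0..l}"
  shows "(f has_vector_derivative f' x) (at x within {0..l})"
    "f' x = f' 0 + integral {0..x} (\<lambda>t. complex_of_real (q t) * f t - g t)"
  using assms unfolding edge_solution_def by blast+

lemma absolutely_integrable_complex_of_real:
  fixes q :: "real \<Rightarrow> real"
  assumes "q absolutely_integrable_on S"
  shows "(\<lambda>t. complex_of_real (q t)) absolutely_integrable_on S"
  using absolutely_integrable_linear[OF assms bounded_linear_of_real] by (simp add: o_def)

context
  fixes q :: "real \<Rightarrow> real" and l :: real
  assumes q: "q absolutely_integrable_on {0..l}" and l: "0 < l"
begin

lemma edge_integrand:
  assumes "continuous_on {0..l} f" "continuous_on {0..l} g"
  shows "(\<lambda>t. complex_of_real (q t) * f t - g t) absolutely_integrable_on {0..l}"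
  using absolutely_integrable_mult_continuous[OF absolutely_integrable_complex_of_real[OF q] assms(1)]
    absolutely_integrable_continuous_real[OF assms(2)]
  by (rule set_integral_diff)

lemma edge_solution_continuous:
  assumes "edge_solution q l f f' g" and g: "continuous_on {0..l} g"
  shows "continuous_on {0..l} f" "continuous_on {0..l} f'"
    "(\<lambda>t. complex_of_real (q t) * f t - g t) absolutely_integrable_on {0..l}"
proof -
  show f: "continuous_on {0..l} f"
    unfolding continuous_on_eq_continuous_within
    using has_vector_derivative_continuous[OF edge_solutionD(1)[OF assms(1)]] by blast
  then show i: "(\<lambda>t. complex_of_real (q t) * f t - g t) absolutely_integrable_on {0..l}"
    using g by (rule edge_integrand)
  have "continuous_on {0..l} (\<lambda>x. f' 0 + integral {0..x} (\<lambda>t. complex_of_real (q t) * f t - g t))"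
    using i by (intro continuous_intros indefinite_integral_continuous_1) (auto simp: absolutely_integrable_on_def)
  then show "continuous_on {0..l} f'"
    by (rule continuous_on_eq) (rule edge_solutionD(2)[OF assms(1), symmetric])
qed

text \<open>The fixed point argument takes place in the norm weighted with \<open>exp (- k x)\<close>.\<close>

lemma edge_solution_exists:
  assumes g: "continuous_on {0..l} g"
  shows "\<exists>f f'. edge_solution q l f f' g \<and> f 0 = a \<and> f' 0 = b"
proof -
  let ?q = "\<lambda>t. complex_of_real (q t)"
  define K where "K = integral {0..l} (\<lambda>t. norm (?q t))"
  have qa: "?q absolutely_integrable_on {0..l}" by (rule absolutely_integrable_complex_of_real[OF q])
  have nq: "(\<lambda>t. norm (?q t)) integrable_on {0..l}"
    using qa by (auto simp: absolutely_integrable_on_def)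
  have K: "K \<ge> 0" unfolding K_def by (intro integral_nonneg nq) auto
  \<comment> \<open>In the weighted norm the inner integration against \<open>q\<close> costs a
    factor \<open>K\<close> and the outer one gains \<open>1 / k\<close>, so the map contracts by
    \<open>K / k\<close>, which is at most 1/2.\<close>
  define k where "k = 2 * K + 1"
  have k: "k > 0" using K by (simp add: k_def)
  \<comment> \<open>Bounded continuous functions are available on the whole line; clamping the
    argument to \<open>{0..l}\<close> extends functions on the interval to it.\<close>
  define c where "c = (\<lambda>x. max 0 (min l x))"
  have c: "c x \<in> {0..l}" for x using l by (auto simp: c_def)
  have cc: "continuous_on UNIV c" unfolding c_def by (intro continuous_intros)
  have c_id: "c x = x" if "x \<in> {0..l}" for x using that by (auto simp: c_def)
  \<comment> \<open>\<open>w\<close> stands for \<open>exp (- k x)\<close> times the unknown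
    function, so the weighted norm becomes the supremum norm; \<open>h\<close>, \<open>J\<close> and
    \<open>I\<close> give the right-hand side, the first and the second integration.\<close>
  define h where "h = (\<lambda>w t. ?q t * (exp (complex_of_real (k * t)) * w t) - g t)"
  define J where "J = (\<lambda>w s. b + integral {0..s} (h w))"
  define I where "I = (\<lambda>w x. a + integral {0..x} (J w))"
  define \<Psi> where "\<Psi> = (\<lambda>w x. exp (complex_of_real (- k * c x)) * I w (c x))"
  have h_int: "h w integrable_on {0..l}" if w: "continuous_on UNIV w" for w
  proof -
    have "continuous_on {0..l} (\<lambda>t. exp (complex_of_real (k * t)) * w t)"
      using w by (intro continuous_intros) (auto intro: continuous_on_subset)
    from edge_integrand[OF this g] show ?thesis by (auto simp: absolutely_integrable_on_def h_def)
  qed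
  have J_cont: "continuous_on {0..l} (J w)" if w: "continuous_on UNIV w" for w
    unfolding J_def by (intro continuous_intros indefinite_integral_continuous_1 h_int w)
  have J_int: "J w integrable_on {0..l}" if w: "continuous_on UNIV w" for w
    using J_cont[OF w] by (rule integrable_continuous_real)
  have I_cont: "continuous_on {0..l} (I w)" if w: "continuous_on UNIV w" for w
    unfolding I_def by (intro continuous_intros indefinite_integral_continuous_1 J_int w)
  have \<Psi>_bcont: "\<Psi> w \<in> bcontfun" if w: "continuous_on UNIV w" for w
  proof -
    let ?\<psi> = "\<lambda>x. exp (complex_of_real (- k * x)) * I w x"
    have cont: "continuous_on {0..l} ?\<psi>" by (intro continuous_intros I_cont w)
    have "continuous_on UNIV (?\<psi> \<circ> c)"
      by (rule continuous_on_compose[OF cc]) (rule continuous_on_subset[OF cont], use c in auto)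
    moreover have "bounded (range (?\<psi> \<circ> c))"
      by (rule bounded_subset[OF compact_imp_bounded[OF compact_continuous_image[OF cont]]]) (use c in auto)
    ultimately show ?thesis by (simp add: bcontfun_def \<Psi>_def o_def)
  qed
  define \<Phi> where "\<Phi> = (\<lambda>w. Bcontfun (\<Psi> (apply_bcontfun w)))"
  have ac: "continuous_on UNIV (apply_bcontfun w)" for w :: "real \<Rightarrow>\<^sub>C complex"
    using apply_bcontfun[of w] by (simp add: bcontfun_def)
  have \<Phi>: "apply_bcontfun (\<Phi> w) = \<Psi> (apply_bcontfun w)" for w
    unfolding \<Phi>_def by (rule Bcontfun_inverse[OF \<Psi>_bcont[OF ac]])
  have contr: "dist (\<Phi> w) (\<Phi> z) \<le> (1/2) * dist w z" for w z
  proof (rule dist_bound)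
    fix x0
    let ?w = "apply_bcontfun w" and ?z = "apply_bcontfun z" and ?D = "dist w z" and ?x = "c x0"
    have xl: "?x \<in> {0..l}" by (rule c)
    then have x: "0 \<le> ?x" "?x \<le> l" by auto
    have sub: "{0..s} \<subseteq> {0..l}" if "s \<in> {0..l}" for s using that by auto
    have hs: "h (apply_bcontfun u) integrable_on {0..s}" and Js: "J (apply_bcontfun u) integrable_on {0..s}"
      and nqs: "(\<lambda>t. norm (?q t)) integrable_on {0..s}" if "s \<in> {0..l}" for u s
      using integrable_subinterval_real[OF h_int[OF ac] sub[OF that]]
        integrable_subinterval_real[OF J_int[OF ac] sub[OF that]]
        integrable_subinterval_real[OF nq sub[OF that]] by auto
    have hd: "norm (J ?w s - J ?z s) \<le> K * ?D * exp (k * s)" if s: "s \<in> {0..l}" for s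
    proof -
      have "J ?w s - J ?z s = integral {0..s} (\<lambda>t. h ?w t - h ?z t)"
        unfolding J_def Henstock_Kurzweil_Integration.integral_diff[OF hs[OF s] hs[OF s]] by simp
      also have "norm \<dots> \<le> integral {0..s} (\<lambda>t. norm (?q t) * (exp (k * s) * ?D))"
      proof (rule integral_norm_bound_integral)
        show "(\<lambda>t. h ?w t - h ?z t) integrable_on {0..s}"
          by (intro integrable_diff hs s)
        show "(\<lambda>t. norm (?q t) * (exp (k * s) * ?D)) integrable_on {0..s}"
          by (intro integrable_on_mult_left nqs s)
        fix t assume t: "t \<in> {0..s}"
        have "h ?w t - h ?z t = ?q t * (exp (complex_of_real (k * t)) * (?w t - ?z t))"
          by (simp add: h_def algebra_simps)
        then have "norm (h ?w t - h ?z t) = norm (?q t) * (exp (k * t) * dist (?w t) (?z t))"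
          by (simp add: norm_mult dist_norm)
        also have "\<dots> \<le> norm (?q t) * (exp (k * s) * ?D)"
          using t k dist_bounded[of w t z] by (intro mult_left_mono mult_mono) auto
        finally show "norm (h ?w t - h ?z t) \<le> norm (?q t) * (exp (k * s) * ?D)" .
      qed
      also have "\<dots> = integral {0..s} (\<lambda>t. norm (?q t)) * (exp (k * s) * ?D)" by simp
      also have "\<dots> \<le> K * (exp (k * s) * ?D)"
        unfolding K_def by (intro mult_right_mono integral_subset_le nqs nq s sub) auto
      finally show ?thesis by (simp add: mult_ac)
    qed
    have exp_int: "((\<lambda>s. exp (k * s)) has_integral (exp (k * ?x) / k - exp (k * 0) / k)) {0..?x}"
      using x k by (intro fundamental_theorem_of_calculus)
        (auto intro!: derivative_eq_intros simp: has_real_derivative_iff_has_vector_derivative[symmetric])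
    have "norm (I ?w ?x - I ?z ?x) = norm (integral {0..?x} (\<lambda>s. J ?w s - J ?z s))"
      unfolding I_def Henstock_Kurzweil_Integration.integral_diff[OF Js[OF xl] Js[OF xl]] by simp
    also have "\<dots> \<le> integral {0..?x} (\<lambda>s. K * ?D * exp (k * s))"
    proof (rule integral_norm_bound_integral)
      show "(\<lambda>s. J ?w s - J ?z s) integrable_on {0..?x}"
        by (intro integrable_diff Js xl)
      show "(\<lambda>s. K * ?D * exp (k * s)) integrable_on {0..?x}"
        by (intro integrable_on_mult_right has_integral_integrable[OF exp_int])
      show "norm (J ?w s - J ?z s) \<le> K * ?D * exp (k * s)" if "s \<in> {0..?x}" for s
        using hd[of s] that x by auto
    qed
    also have "\<dots> = K * ?D * (exp (k * ?x) / k - exp (k * 0) / k)"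
      using integral_unique[OF exp_int] by simp
    also have "\<dots> \<le> K * ?D * (exp (k * ?x) / k)"
      using K k by (intro mult_left_mono) auto
    finally have "norm (I ?w ?x - I ?z ?x) \<le> K * ?D * (exp (k * ?x) / k)" .
    then have "exp (- k * ?x) * norm (I ?w ?x - I ?z ?x) \<le> exp (- k * ?x) * (K * ?D * (exp (k * ?x) / k))"
      by (rule mult_left_mono) simp
    also have "\<dots> = (K / k) * ?D"
      by (simp add: exp_minus field_simps)
    also have "\<dots> \<le> (1/2) * ?D"
      using K k by (intro mult_right_mono) (auto simp: k_def field_simps)
    finally have "exp (- k * ?x) * norm (I ?w ?x - I ?z ?x) \<le> (1/2) * ?D" .
    moreover have "dist (apply_bcontfun (\<Phi> w) x0) (apply_bcontfun (\<Phi> z) x0) =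
        exp (- k * ?x) * norm (I ?w ?x - I ?z ?x)"
    proof -
      have "\<Psi> ?w x0 - \<Psi> ?z x0 = exp (complex_of_real (- k * ?x)) * (I ?w ?x - I ?z ?x)"
        by (simp add: \<Psi>_def algebra_simps)
      then show ?thesis unfolding \<Phi> dist_norm by (simp add: norm_mult)
    qed
    ultimately show "dist (apply_bcontfun (\<Phi> w) x0) (apply_bcontfun (\<Phi> z) x0) \<le> (1/2) * ?D" by simp
  qed
  have "\<exists>!w. \<Phi> w = w"
    by (rule banach_fix_type[of "1/2"]) (use contr in auto)
  then obtain w where w: "\<Phi> w = w" by blast
  let ?w = "apply_bcontfun w"
  define f where "f = I ?w"
  define f' where "f' = J ?w"
  have fw: "f x = exp (complex_of_real (k * x)) * ?w x" if "x \<in> {0..l}" for x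
  proof -
    have "?w x = \<Psi> ?w x" using \<Phi>[of w] w by simp
    also have "\<dots> = exp (complex_of_real (- k * x)) * f x" using c_id[OF that] by (simp add: \<Psi>_def f_def)
    finally have "exp (complex_of_real (k * x)) * ?w x = exp (complex_of_real (k * x) + complex_of_real (- k * x)) * f x"
      by (simp only: exp_add mult.assoc)
    then show ?thesis by simp
  qed
  have "edge_solution q l f f' g"
    unfolding edge_solution_def
  proof (intro ballI conjI)
    fix x assume x: "x \<in> {0..l}"
    have "((\<lambda>u. a + integral {0..u} (J ?w)) has_vector_derivative 0 + J ?w x) (at x within {0..l})"
      by (intro has_vector_derivative_add has_vector_derivative_const
          integral_has_vector_derivative J_cont[OF ac] x)
    then show "(f has_vector_derivative f' x) (at x within {0..l})" by (simp add: f_def f'_def I_def)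
    have "integral {0..x} (h ?w) = integral {0..x} (\<lambda>t. ?q t * f t - g t)"
      using x by (intro Henstock_Kurzweil_Integration.integral_cong) (auto simp: h_def fw)
    then show "f' x = f' 0 + integral {0..x} (\<lambda>t. ?q t * f t - g t)"
      by (simp add: f'_def J_def)
  qed
  moreover have "f 0 = a" "f' 0 = b" by (simp_all add: f_def f'_def I_def J_def)
  ultimately show ?thesis by blast
qed

end

section \<open>Sobolev-type estimates and the quadratic form on an interval\<close>

definition c1_on :: "real \<Rightarrow> (real \<Rightarrow> complex) \<Rightarrow> (real \<Rightarrow> complex) \<Rightarrow> bool" where
  "c1_on l f f' \<longleftrightarrow> (\<forall>x\<in>{0..l}. (f has_vector_derivative f' x) (at x within {0..l})) \<and> continuous_on {0..l} f'"

definition sqnorm_on :: "real \<Rightarrow> (real \<Rightarrow> complex) \<Rightarrow> real" where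
  "sqnorm_on l f = integral {0..l} (\<lambda>t. (cmod (f t))\<^sup>2)"

lemma c1_on_continuous:
  assumes "c1_on l f f'"
  shows "continuous_on {0..l} f" "continuous_on {0..l} f'"
  unfolding continuous_on_eq_continuous_within
  using assms has_vector_derivative_continuous unfolding c1_on_def continuous_on_eq_continuous_within by blast+

lemma c1_on_derivative:
  assumes "c1_on l f f'" "0 \<le> a" "b \<le> l" "x \<in> {a..b}"
  shows "(f has_vector_derivative f' x) (at x within {a..b})"
proof -
  have "x \<in> {0..l}" using assms by auto
  then have "(f has_vector_derivative f' x) (at x within {0..l})" using assms(1) unfolding c1_on_def by blast
  then show ?thesis by (rule has_vector_derivative_within_subset) (use assms in auto)
qed

lemma c1_on_integral:
  assumes "c1_on l f f'" "0 \<le> a" "a \<le> b" "b \<le> l"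
  shows "(f' has_integral (f b - f a)) {a..b}"
  using assms by (intro fundamental_theorem_of_calculus c1_on_derivative) auto

lemma sqnorm_integrable:
  "continuous_on {a..b::real} f \<Longrightarrow> (\<lambda>t. (cmod (f t))\<^sup>2) integrable_on {a..b}"
  by (intro integrable_continuous_real continuous_intros)

lemma sqnorm_on_nonneg: "continuous_on {0..l} f \<Longrightarrow> 0 \<le> sqnorm_on l f"
  unfolding sqnorm_on_def by (intro integral_nonneg sqnorm_integrable) auto

lemma two_mult_le_weighted:
  fixes a b \<epsilon> :: real
  assumes "\<epsilon> > 0"
  shows "2 * (a * b) \<le> \<epsilon> * a\<^sup>2 + b\<^sup>2 / \<epsilon>"
proof -
  have "0 \<le> (\<epsilon> * a - b)\<^sup>2 / \<epsilon>" using assms by simp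
  also have "\<dots> = \<epsilon> * a\<^sup>2 + b\<^sup>2 / \<epsilon> - 2 * (a * b)"
    using assms by (simp add: power2_eq_square field_simps)
  finally show ?thesis by simp
qed

text \<open>The Hoelder modulus of H^1 functions with Young's inequality for
  \<open>norm (f' t)\<close> times 1 in place of Cauchy-Schwarz. The free \<open>\<epsilon>\<close>
  spares the square root and gives equicontinuity of H^1-bounded families.\<close>

lemma c1_on_modulus:
  assumes f: "c1_on l f f'" and xy: "0 \<le> x" "x \<le> y" "y \<le> l" and \<epsilon>: "\<epsilon> > 0"
  shows "cmod (f y - f x) \<le> \<epsilon> / 2 * sqnorm_on l f' + (y - x) / (2 * \<epsilon>)"
proof -
  note f'c = c1_on_continuous(2)[OF f]
  have sub: "{x..y} \<subseteq> {0..l}" using xy by auto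
  have i: "(\<lambda>t. (cmod (f' t))\<^sup>2) integrable_on {x..y}"
    by (rule sqnorm_integrable[OF continuous_on_subset[OF f'c sub]])
  have "f y - f x = integral {x..y} f'" using c1_on_integral[OF f xy] by (simp add: integral_unique)
  also have "norm \<dots> \<le> integral {x..y} (\<lambda>t. \<epsilon> / 2 * (cmod (f' t))\<^sup>2 + 1 / (2 * \<epsilon>))"
  proof (rule integral_norm_bound_integral)
    show "f' integrable_on {x..y}" using c1_on_integral[OF f xy] by (rule has_integral_integrable)
    show "(\<lambda>t. \<epsilon> / 2 * (cmod (f' t))\<^sup>2 + 1 / (2 * \<epsilon>)) integrable_on {x..y}"
      by (intro integrable_add integrable_on_mult_right i integrable_const_ivl)
    fix t
    show "norm (f' t) \<le> \<epsilon> / 2 * (cmod (f' t))\<^sup>2 + 1 / (2 * \<epsilon>)"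
      using two_mult_le_weighted[OF \<epsilon>, of "cmod (f' t)" 1] by (simp add: field_simps)
  qed
  also have "\<dots> = \<epsilon> / 2 * integral {x..y} (\<lambda>t. (cmod (f' t))\<^sup>2) + (y - x) / (2 * \<epsilon>)"
    using has_integral_add[OF has_integral_mult_right[OF integrable_integral[OF i], of "\<epsilon> / 2"]
      has_integral_const_real[of "1 / (2 * \<epsilon>)" x y]] xy by (simp add: integral_unique)
  also have "\<dots> \<le> \<epsilon> / 2 * sqnorm_on l f' + (y - x) / (2 * \<epsilon>)"
    unfolding sqnorm_on_def using \<epsilon>
    by (intro add_right_mono mult_left_mono integral_subset_le sub i sqnorm_integrable f'c) auto
  finally show ?thesis .
qed

text \<open>The minimum of |f|^2 is at most its mean, and the variation of |f|^2 is at most the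
  integral of 2 |f| |f'|, which Young's inequality splits. The factor of the derivative term can be
  made arbitrarily small, which is what allows absorption.\<close>

lemma c1_on_sup_bound:
  assumes f: "c1_on l f f'" and l: "0 < l" and x: "x \<in> {0..l}" and \<epsilon>: "\<epsilon> > 0"
  shows "(cmod (f x))\<^sup>2 \<le> \<epsilon> * sqnorm_on l f' + (1 / l + 1 / \<epsilon>) * sqnorm_on l f"
proof -
  note fc = c1_on_continuous[OF f]
  define h where "h = (\<lambda>t. (cmod (f t))\<^sup>2)"
  define h' where "h' = (\<lambda>t. 2 * (f t \<bullet> f' t))"
  have hc: "continuous_on {0..l} h" unfolding h_def by (intro continuous_intros fc)
  have h'c: "continuous_on {0..l} h'" unfolding h'_def by (intro continuous_intros fc)
  have deriv: "(h has_vector_derivative h' t) (at t within {a..b})" if "0 \<le> a" "b \<le> l" "t \<in> {a..b}" for a b t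
  proof -
    have "((\<lambda>t. f t \<bullet> f t) has_derivative (\<lambda>s. f t \<bullet> (s *\<^sub>R f' t) + (s *\<^sub>R f' t) \<bullet> f t)) (at t within {a..b})"
      using c1_on_derivative[OF f that] unfolding has_vector_derivative_def
      by (intro has_derivative_inner)
    then show ?thesis unfolding has_vector_derivative_def h_def h'_def power2_norm_eq_inner
      by (rule has_derivative_eq_rhs) (auto simp: inner_commute algebra_simps)
  qed
  have bnd: "\<bar>h' t\<bar> \<le> \<epsilon> * (cmod (f' t))\<^sup>2 + (cmod (f t))\<^sup>2 / \<epsilon>" for t
  proof -
    have "\<bar>h' t\<bar> \<le> 2 * (cmod (f' t) * cmod (f t))"
      unfolding h'_def using Cauchy_Schwarz_ineq2[of "f t" "f' t"] by (simp add: abs_mult mult.commute)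
    also have "\<dots> \<le> \<epsilon> * (cmod (f' t))\<^sup>2 + (cmod (f t))\<^sup>2 / \<epsilon>" by (rule two_mult_le_weighted[OF \<epsilon>])
    finally show ?thesis .
  qed
  let ?R = "\<epsilon> * sqnorm_on l f' + sqnorm_on l f / \<epsilon>"
  have \<epsilon>0: "\<epsilon> \<noteq> 0" using \<epsilon> by simp
  have i1: "(\<lambda>t. \<epsilon> * (cmod (f' t))\<^sup>2 + (cmod (f t))\<^sup>2 / \<epsilon>) integrable_on {0..l}"
    by (intro integrable_continuous_real continuous_intros fc) (use \<epsilon>0 in auto)
  have R: "integral {0..l} (\<lambda>t. \<epsilon> * (cmod (f' t))\<^sup>2 + (cmod (f t))\<^sup>2 / \<epsilon>) = ?R"
    unfolding sqnorm_on_def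
    by (subst Henstock_Kurzweil_Integration.integral_add)
       (auto intro!: integrable_continuous_real continuous_intros fc simp: \<epsilon>0)
  have var: "\<bar>h b - h a\<bar> \<le> ?R" if ab: "0 \<le> a" "a \<le> b" "b \<le> l" for a b
  proof -
    have hi: "(h' has_integral (h b - h a)) {a..b}"
      using ab by (intro fundamental_theorem_of_calculus deriv) auto
    have sub: "{a..b} \<subseteq> {0..l}" using ab by auto
    have i2: "(\<lambda>t. \<epsilon> * (cmod (f' t))\<^sup>2 + (cmod (f t))\<^sup>2 / \<epsilon>) integrable_on {a..b}"
      by (rule integrable_subinterval_real[OF i1 sub])
    have "\<bar>h b - h a\<bar> = norm (integral {a..b} h')" using hi by (simp add: integral_unique)
    also have "\<dots> \<le> integral {a..b} (\<lambda>t. \<epsilon> * (cmod (f' t))\<^sup>2 + (cmod (f t))\<^sup>2 / \<epsilon>)"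
      by (intro integral_norm_bound_integral has_integral_integrable[OF hi] i2) (use bnd in auto)
    also have "\<dots> \<le> ?R"
      unfolding R[symmetric] using \<epsilon> by (intro integral_subset_le sub i1 i2) auto
    finally show ?thesis .
  qed
  obtain y where y: "y \<in> {0..l}" "\<And>t. t \<in> {0..l} \<Longrightarrow> h y \<le> h t"
    using continuous_attains_inf[OF _ _ hc] l by auto
  have "h y * l = integral {0..l} (\<lambda>t. h y)" using l by simp
  also have "\<dots> \<le> integral {0..l} h"
    using y(2) by (intro integral_le integrable_continuous_real hc) auto
  finally have "h y \<le> sqnorm_on l f / l" using l by (simp add: sqnorm_on_def h_def field_simps)
  moreover have "\<bar>h x - h y\<bar> \<le> ?R"
    using var[of x y] var[of y x] x y(1) by (cases "x \<le> y") (auto simp: abs_minus_commute)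
  ultimately show ?thesis by (simp add: h_def algebra_simps)
qed

lemma absolutely_integrable_mult_continuous_real:
  fixes q h :: "real \<Rightarrow> real"
  assumes "q absolutely_integrable_on {a..b}" "continuous_on {a..b} h"
  shows "(\<lambda>t. q t * h t) absolutely_integrable_on {a..b}"
proof -
  have "(\<lambda>t. h t * q t) absolutely_integrable_on {a..b}"
  proof (rule absolutely_integrable_bounded_measurable_product_real[OF _ _ _ assms(1)])
    show "h \<in> borel_measurable (lebesgue_on {a..b})"
      using assms(2) by (intro continuous_imp_measurable_on_sets_lebesgue) auto
    show "bounded (h ` {a..b})"
      using assms(2) by (intro compact_imp_bounded compact_continuous_image) auto
  qed auto
  then show ?thesis by (simp add: mult.commute)
qed

lemma mult_sqnorm_integrable:
  fixes q :: "real \<Rightarrow> real"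
  assumes "q absolutely_integrable_on {a..b}" "continuous_on {a..b} f"
  shows "(\<lambda>t. q t * (cmod (f t))\<^sup>2) integrable_on {a..b}"
proof -
  have "continuous_on {a..b} (\<lambda>t. (cmod (f t))\<^sup>2)" by (intro continuous_intros assms)
  from absolutely_integrable_mult_continuous_real[OF assms(1) this] show ?thesis
    by (simp add: absolutely_integrable_on_def)
qed

lemma c1_form_lower_bound:
  assumes V: "V absolutely_integrable_on {0..l}" and l: "0 < l" and \<kappa>: "\<kappa> \<ge> 0"
  shows "\<exists>C. \<forall>f f'. c1_on l f f' \<longrightarrow>
    sqnorm_on l f' / 2 - C * sqnorm_on l f \<le>
      sqnorm_on l f' + integral {0..l} (\<lambda>t. V t * (cmod (f t))\<^sup>2) - \<kappa> * ((cmod (f 0))\<^sup>2 + (cmod (f l))\<^sup>2)"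
proof -
  have nV: "(\<lambda>t. \<bar>V t\<bar>) integrable_on {0..l}" and iV: "V integrable_on {0..l}"
    using V by (auto simp: absolutely_integrable_on_def)
  \<comment> \<open>The total weight with which the supremum of |f|^2 enters: the potential once,
    the two end points with \<open>\<kappa>\<close> each. The choice of \<open>\<epsilon>\<close>
    then lets these terms consume at most half of the derivative term.\<close>
  define W where "W = integral {0..l} (\<lambda>t. \<bar>V t\<bar>) + 2 * \<kappa>"
  have I: "0 \<le> integral {0..l} (\<lambda>t. \<bar>V t\<bar>)" by (intro integral_nonneg nV) auto
  then have W: "W \<ge> 0" using \<kappa> by (simp add: W_def)
  define \<epsilon> where "\<epsilon> = 1 / (2 * (W + 1))"
  have \<epsilon>: "\<epsilon> > 0" "W * \<epsilon> \<le> 1 / 2" using W by (auto simp: \<epsilon>_def field_simps)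
  show ?thesis
  proof (intro exI allI impI)
    fix f f' assume f: "c1_on l f f'"
    let ?S = "\<epsilon> * sqnorm_on l f' + (1 / l + 1 / \<epsilon>) * sqnorm_on l f"
    note fc = c1_on_continuous[OF f]
    have sup: "(cmod (f x))\<^sup>2 \<le> ?S" if "x \<in> {0..l}" for x
      by (rule c1_on_sup_bound[OF f l that \<epsilon>(1)])
    have iVf: "(\<lambda>t. V t * (cmod (f t))\<^sup>2) integrable_on {0..l}"
      by (rule mult_sqnorm_integrable[OF V fc(1)])
    have "norm (integral {0..l} (\<lambda>t. V t * (cmod (f t))\<^sup>2)) \<le> integral {0..l} (\<lambda>t. \<bar>V t\<bar> * ?S)"
    proof (intro integral_norm_bound_integral iVf integrable_on_mult_left nV)
      fix t assume "t \<in> {0..l}"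
      then show "norm (V t * (cmod (f t))\<^sup>2) \<le> \<bar>V t\<bar> * ?S"
        using sup[of t] by (simp add: abs_mult mult_left_mono)
    qed
    then have "- (integral {0..l} (\<lambda>t. \<bar>V t\<bar>) * ?S) \<le> integral {0..l} (\<lambda>t. V t * (cmod (f t))\<^sup>2)"
      by simp
    moreover have "\<kappa> * ((cmod (f 0))\<^sup>2 + (cmod (f l))\<^sup>2) \<le> \<kappa> * (?S + ?S)"
      using \<kappa> l by (intro mult_left_mono add_mono sup) auto
    ultimately have "- (W * ?S) \<le> integral {0..l} (\<lambda>t. V t * (cmod (f t))\<^sup>2) - \<kappa> * ((cmod (f 0))\<^sup>2 + (cmod (f l))\<^sup>2)"
      by (simp add: W_def algebra_simps)
    moreover have "W * ?S = (W * \<epsilon>) * sqnorm_on l f' + (W * (1 / l + 1 / \<epsilon>)) * sqnorm_on l f"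
      by (simp add: algebra_simps)
    moreover have "(W * \<epsilon>) * sqnorm_on l f' \<le> 1 / 2 * sqnorm_on l f'"
      using \<epsilon>(2) sqnorm_on_nonneg[OF fc(2)] by (rule mult_right_mono)
    ultimately show "sqnorm_on l f' / 2 - (W * (1 / l + 1 / \<epsilon>)) * sqnorm_on l f \<le>
      sqnorm_on l f' + integral {0..l} (\<lambda>t. V t * (cmod (f t))\<^sup>2) - \<kappa> * ((cmod (f 0))\<^sup>2 + (cmod (f l))\<^sup>2)"
      by simp
  qed
qed

context
  fixes q :: "real \<Rightarrow> real" and l :: real
  assumes q: "q absolutely_integrable_on {0..l}" and l: "0 < l"
begin

lemma edge_solution_c1:
  assumes "edge_solution q l f f' g" "continuous_on {0..l} g"
  shows "c1_on l f f'"
  using edge_solutionD(1)[OF assms(1)] edge_solution_continuous(2)[OF q l assms] by (auto simp: c1_on_def)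

text \<open>Integration by parts for \<open>f'\<close> against the conjugate of \<open>u\<close>,
  with the derivative of \<open>f'\<close> read off from the equation.\<close>

lemma edge_pairing:
  assumes f: "edge_solution q l f f' g" "continuous_on {0..l} g"
    and u: "edge_solution q l u u' h" "continuous_on {0..l} h"
  shows "((\<lambda>t. (complex_of_real (q t) * f t - g t) * cnj (u t) + f' t * cnj (u' t)) has_integral
    f' l * cnj (u l) - f' 0 * cnj (u 0)) {0..l}"
proof (rule indefinite_integral_mult)
  show "(\<lambda>t. complex_of_real (q t) * f t - g t) absolutely_integrable_on {0..l}"
    by (rule edge_solution_continuous(3)[OF q l f])
  show "(\<lambda>t. cnj (u' t)) absolutely_integrable_on {0..l}"
    by (intro absolutely_integrable_continuous_real continuous_intros edge_solution_continuous(2)[OF q l u])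
  show "f' x = f' 0 + integral {0..x} (\<lambda>t. complex_of_real (q t) * f t - g t)" if "x \<in> {0..l}" for x
    by (rule edge_solutionD(2)[OF f(1) that])
  show "cnj (u x) = cnj (u 0) + integral {0..x} (\<lambda>t. cnj (u' t))" if "x \<in> {0..l}" for x
  proof -
    have "(u' has_integral (u x - u 0)) {0..x}"
      using that by (intro c1_on_integral[OF edge_solution_c1[OF u]]) auto
    from has_integral_linear[OF this bounded_linear_cnj] show ?thesis
      by (simp add: o_def integral_unique)
  qed
qed (use l in simp)

text \<open>The pairing of \<open>f\<close> with \<open>u\<close> minus the conjugate of the pairing
  of \<open>u\<close> with \<open>f\<close>: the derivative terms cancel, and so do the terms with
  \<open>q\<close>, because \<open>q\<close> is real.\<close>

lemma edge_green:
  assumes f: "edge_solution q l f f' g" "continuous_on {0..l} g"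
    and u: "edge_solution q l u u' h" "continuous_on {0..l} h"
  shows "integral {0..l} (\<lambda>t. g t * cnj (u t)) - integral {0..l} (\<lambda>t. f t * cnj (h t)) =
    (f' 0 * cnj (u 0) - f' l * cnj (u l)) - (f 0 * cnj (u' 0) - f l * cnj (u' l))"
proof -
  note fc = c1_on_continuous[OF edge_solution_c1[OF f]] and uc = c1_on_continuous[OF edge_solution_c1[OF u]]
  from has_integral_linear[OF edge_pairing[OF u f] bounded_linear_cnj]
  have "((\<lambda>t. (complex_of_real (q t) * cnj (u t) - cnj (h t)) * f t + cnj (u' t) * f' t) has_integral
    cnj (u' l) * f l - cnj (u' 0) * f 0) {0..l}" by (simp add: o_def)
  from has_integral_diff[OF edge_pairing[OF f u] this]
  have "((\<lambda>t. f t * cnj (h t) - g t * cnj (u t)) has_integral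
    f' l * cnj (u l) - f' 0 * cnj (u 0) - (cnj (u' l) * f l - cnj (u' 0) * f 0)) {0..l}"
    by (rule has_integral_eq[rotated]) (simp add: algebra_simps)
  moreover have "integral {0..l} (\<lambda>t. f t * cnj (h t) - g t * cnj (u t)) =
      integral {0..l} (\<lambda>t. f t * cnj (h t)) - integral {0..l} (\<lambda>t. g t * cnj (u t))"
    by (intro Henstock_Kurzweil_Integration.integral_diff integrable_continuous_real continuous_intros fc uc f(2) u(2))
  ultimately show ?thesis by (simp add: integral_unique algebra_simps)
qed

lemma edge_energy:
  assumes f: "edge_solution q l f f' g" "continuous_on {0..l} g"
  shows "Re (integral {0..l} (\<lambda>t. g t * cnj (f t))) =
    sqnorm_on l f' + integral {0..l} (\<lambda>t. q t * (cmod (f t))\<^sup>2) + Re (f' 0 * cnj (f 0) - f' l * cnj (f l))"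
proof -
  note fc = c1_on_continuous[OF edge_solution_c1[OF f]]
  have gi: "(\<lambda>t. g t * cnj (f t)) integrable_on {0..l}"
    by (intro integrable_continuous_real continuous_intros fc f)
  have qi: "(\<lambda>t. q t * (cmod (f t))\<^sup>2) integrable_on {0..l}"
    by (rule mult_sqnorm_integrable[OF q fc(1)])
  have rg: "((\<lambda>t. Re (g t * cnj (f t))) has_integral Re (integral {0..l} (\<lambda>t. g t * cnj (f t)))) {0..l}"
    using has_integral_linear[OF integrable_integral[OF gi] bounded_linear_Re] by (simp add: o_def)
  have 1: "((\<lambda>t. q t * (cmod (f t))\<^sup>2 + (cmod (f' t))\<^sup>2 - Re (g t * cnj (f t))) has_integral
    integral {0..l} (\<lambda>t. q t * (cmod (f t))\<^sup>2) + sqnorm_on l f' - Re (integral {0..l} (\<lambda>t. g t * cnj (f t)))) {0..l}"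
    unfolding sqnorm_on_def
    by (intro has_integral_diff has_integral_add rg integrable_integral qi sqnorm_integrable fc)
  have 2: "((\<lambda>t. q t * (cmod (f t))\<^sup>2 + (cmod (f' t))\<^sup>2 - Re (g t * cnj (f t))) has_integral
    Re (f' l * cnj (f l) - f' 0 * cnj (f 0))) {0..l}"
  proof (rule has_integral_eq[rotated])
    show "((\<lambda>t. Re ((complex_of_real (q t) * f t - g t) * cnj (f t) + f' t * cnj (f' t))) has_integral
      Re (f' l * cnj (f l) - f' 0 * cnj (f 0))) {0..l}"
      using has_integral_linear[OF edge_pairing[OF f f] bounded_linear_Re] by (simp add: o_def)
    show "Re ((complex_of_real (q t) * f t - g t) * cnj (f t) + f' t * cnj (f' t)) =
      q t * (cmod (f t))\<^sup>2 + (cmod (f' t))\<^sup>2 - Re (g t * cnj (f t))" for t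
      unfolding cmod_power2 by (simp add: power2_eq_square algebra_simps)
  qed
  from has_integral_unique[OF 1 2] show ?thesis by simp
qed

end

section \<open>From the operator in L_2 to the integrated equation\<close>

lemma square_integrable_on_imp_integrable:
  fixes h :: "real \<Rightarrow> 'b::euclidean_space"
  assumes "square_integrable_on h {0..l}"
  shows "integrable (lebesgue_on {0..l}) h"
proof (rule Bochner_Integration.integrable_bound)
  have "finite_measure (lebesgue_on {0..l})" by (intro finite_measure_lebesgue_on) simp
  then have "integrable (lebesgue_on {0..l}) (\<lambda>x. 1 :: real)" by (simp add: finite_measure.integrable_const)
  then show "integrable (lebesgue_on {0..l}) (\<lambda>x. 1 + (norm (h x))\<^sup>2)"
    using assms by (intro Bochner_Integration.integrable_add) (auto simp: square_integrable_on_def)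
  show "h \<in> borel_measurable (lebesgue_on {0..l})" using assms by (simp add: square_integrable_on_def)
  have "norm (h x) \<le> 1 + (norm (h x))\<^sup>2" for x
  proof -
    have "2 * norm (h x) \<le> (norm (h x))\<^sup>2 + 1" using two_mult_le_weighted[of 1 "norm (h x)" 1] by simp
    then show ?thesis using norm_ge_zero[of "h x"] by linarith
  qed
  then show "AE x in lebesgue_on {0..l}. norm (h x) \<le> norm (1 + (norm (h x))\<^sup>2)"
    by (intro always_eventually) (auto intro: order.trans)
qed

lemma integrable_lebesgue_on_iff:
  fixes h :: "real \<Rightarrow> 'b::euclidean_space"
  shows "integrable (lebesgue_on {a..b}) h \<longleftrightarrow> h absolutely_integrable_on {a..b}"
  by (simp add: integrable_restrict_space set_integrable_def)

lemma AE_lebesgue_on_subset: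
  assumes "AE x in lebesgue_on {0..l::real}. P x" "y \<le> l"
  shows "AE x in lebesgue_on {0..y}. P x"
proof -
  have "AE x in lebesgue. x \<in> {0..l} \<longrightarrow> P x" using assms(1) by (simp add: AE_restrict_space_iff)
  then have "AE x in lebesgue. x \<in> {0..y} \<longrightarrow> P x" by (rule AE_mp) (use assms(2) in auto)
  then show ?thesis by (simp add: AE_restrict_space_iff)
qed

lemma potential_absolutely_integrable:
  fixes V :: "real \<Rightarrow> real"
  assumes "square_integrable_on V {0..l}"
  shows "(\<lambda>t. V t - m) absolutely_integrable_on {0..l}"
  using square_integrable_on_imp_integrable[OF assms] unfolding integrable_lebesgue_on_iff
  by (intro set_integral_diff) (auto intro: absolutely_integrable_continuous_real)

text \<open>A continuous function on a compact interval is bounded, so multiplying by the L_2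
  potential stays in L_2. Hence the second derivative read off from the integrated equation is
  admissible in \<open>H2_with_second_deriv\<close>.\<close>

lemma square_integrable_on_potential_mult:
  fixes V :: "real \<Rightarrow> real" and f :: "real \<Rightarrow> complex"
  assumes V: "square_integrable_on V {0..l}" and f: "continuous_on {0..l} f"
  shows "square_integrable_on (\<lambda>t. complex_of_real (V t - m) * f t) {0..l}"
proof -
  have Vm: "V \<in> borel_measurable (lebesgue_on {0..l})" and V2: "integrable (lebesgue_on {0..l}) (\<lambda>t. (V t)\<^sup>2)"
    using V by (auto simp: square_integrable_on_def)
  have fm: "f \<in> borel_measurable (lebesgue_on {0..l})"
    using f by (intro continuous_imp_measurable_on_sets_lebesgue) auto
  have Vi: "V absolutely_integrable_on {0..l}"
    using square_integrable_on_imp_integrable[OF V] unfolding integrable_lebesgue_on_iff .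
  have "(\<lambda>t. ((V t)\<^sup>2 - 2 * m * V t) + m\<^sup>2) absolutely_integrable_on {0..l}"
  proof (intro set_integral_add set_integral_diff)
    show "(\<lambda>t. (V t)\<^sup>2) absolutely_integrable_on {0..l}" using V2 unfolding integrable_lebesgue_on_iff .
    show "(\<lambda>t. 2 * m * V t) absolutely_integrable_on {0..l}" by (intro set_integrable_mult_right Vi)
    show "(\<lambda>t. m\<^sup>2) absolutely_integrable_on {0..l}"
      by (intro absolutely_integrable_continuous_real continuous_intros)
  qed
  then have "(\<lambda>t. (V t - m)\<^sup>2) absolutely_integrable_on {0..l}"
    by (simp add: power2_eq_square algebra_simps)
  then have "(\<lambda>t. (V t - m)\<^sup>2 * (cmod (f t))\<^sup>2) absolutely_integrable_on {0..l}"
    by (rule absolutely_integrable_mult_continuous_real) (intro continuous_intros f)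
  then have "integrable (lebesgue_on {0..l}) (\<lambda>t. (norm (complex_of_real (V t - m) * f t))\<^sup>2)"
    unfolding integrable_lebesgue_on_iff norm_mult norm_of_real power_mult_distrib by simp
  moreover have "(\<lambda>t. complex_of_real (V t - m) * f t) \<in> borel_measurable (lebesgue_on {0..l})"
    using Vm fm by measurable
  ultimately show ?thesis by (simp add: square_integrable_on_def)
qed

lemma lebesgue_on_integral_eq:
  fixes h :: "real \<Rightarrow> complex"
  assumes "integrable (lebesgue_on {0..l}) h" "y \<le> l"
  shows "integral\<^sup>L (lebesgue_on {0..y}) h = integral {0..y} h"
proof (rule lebesgue_integral_eq_integral)
  have "h absolutely_integrable_on {0..l}" using assms(1) unfolding integrable_lebesgue_on_iff .
  then have "h absolutely_integrable_on {0..y}" by (rule set_integrable_subset) (use assms(2) in auto)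
  then show "integrable (lebesgue_on {0..y}) h" unfolding integrable_lebesgue_on_iff .
qed simp

text \<open>The eigenvalue equation forces \<open>h\<close> to agree almost everywhere with
  \<open>(V - \<mu>) u\<close>, and only integrals of \<open>h\<close> matter. The number
  \<open>m\<close> is arbitrary: an eigenfunction for \<open>\<mu>\<close> solves the shifted
  equation with right-hand side \<open>(\<mu> - m) u\<close>.\<close>

lemma H2_eigenfunction_iff:
  fixes V :: "real \<Rightarrow> real" and u :: "real \<Rightarrow> complex"
  assumes V: "square_integrable_on V {0..l}" and l: "0 < l"
  shows "(\<exists>h. H2_with_second_deriv l u h \<and>
      (AE x in lebesgue_on {0..l}. - h x + complex_of_real (V x) * u x = complex_of_real \<mu> * u x)) \<longleftrightarrow>
    edge_solution (\<lambda>t. V t - m) l u (\<lambda>x. vector_derivative u (at x within {0..l}))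
      (\<lambda>t. complex_of_real (\<mu> - m) * u t)" (is "?L \<longleftrightarrow> ?R")
proof
  assume ?L
  then obtain h u' where h: "square_integrable_on h {0..l}"
    and u': "\<And>x. x \<in> {0..l} \<Longrightarrow> (u has_vector_derivative u' x) (at x within {0..l})"
      "\<And>x. x \<in> {0..l} \<Longrightarrow> u' x = u' 0 + integral\<^sup>L (lebesgue_on {0..x}) h"
    and ae: "AE x in lebesgue_on {0..l}. - h x + complex_of_real (V x) * u x = complex_of_real \<mu> * u x"
    unfolding H2_with_second_deriv_def by blast
  have d: "vector_derivative u (at x within {0..l}) = u' x" if "x \<in> {0..l}" for x
    by (rule vector_derivative_within_closed_interval[OF l that u'(1)[OF that]])
  have uc: "continuous_on {0..l} u"
    unfolding continuous_on_eq_continuous_within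
    using has_vector_derivative_continuous[OF u'(1)] by blast
  let ?k = "\<lambda>t. complex_of_real (V t - m) * u t - complex_of_real (\<mu> - m) * u t"
  let ?k' = "\<lambda>t. complex_of_real (V t - \<mu>) * u t"
  have kk: "?k = ?k'" by (simp add: fun_eq_iff algebra_simps)
  have hi: "integrable (lebesgue_on {0..l}) h" and ki: "integrable (lebesgue_on {0..l}) ?k'"
    using square_integrable_on_imp_integrable[OF h]
      square_integrable_on_imp_integrable[OF square_integrable_on_potential_mult[OF V uc]] by auto
  have int: "integral\<^sup>L (lebesgue_on {0..x}) h = integral {0..x} ?k" if "x \<in> {0..l}" for x
  proof -
    have x: "x \<le> l" using that by simp
    have "integral\<^sup>L (lebesgue_on {0..x}) h = integral\<^sup>L (lebesgue_on {0..x}) ?k'"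
    proof (rule integral_cong_AE)
      have sub: "{0..x} \<subseteq> {0..l}" using x by auto
      have "h absolutely_integrable_on {0..x}" "?k' absolutely_integrable_on {0..x}"
        using hi ki sub unfolding integrable_lebesgue_on_iff
        by (auto intro: set_integrable_subset)
      then have "integrable (lebesgue_on {0..x}) h" "integrable (lebesgue_on {0..x}) ?k'"
        unfolding integrable_lebesgue_on_iff .
      then show "h \<in> borel_measurable (lebesgue_on {0..x})" "?k' \<in> borel_measurable (lebesgue_on {0..x})"
        by auto
      show "AE t in lebesgue_on {0..x}. h t = ?k' t"
        using AE_lebesgue_on_subset[OF ae x]
        by (rule eventually_mono) (simp add: algebra_simps)
    qed
    also have "\<dots> = integral {0..x} ?k" unfolding kk by (rule lebesgue_on_integral_eq[OF ki x])
    finally show ?thesis .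
  qed
  show ?R unfolding edge_solution_def
  proof (intro ballI conjI)
    fix x assume x: "x \<in> {0..l}"
    show "(u has_vector_derivative vector_derivative u (at x within {0..l})) (at x within {0..l})"
      unfolding d[OF x] by (rule u'(1)[OF x])
    have 0: "0 \<in> {0..l}" using l by simp
    show "vector_derivative u (at x within {0..l}) = vector_derivative u (at 0 within {0..l}) + integral {0..x} ?k"
      unfolding d[OF x] d[OF 0] by (subst u'(2)[OF x]) (simp only: int[OF x])
  qed
next
  assume R: ?R
  let ?d = "\<lambda>x. vector_derivative u (at x within {0..l})"
  let ?k = "\<lambda>t. complex_of_real (V t - m) * u t - complex_of_real (\<mu> - m) * u t"
  let ?k' = "\<lambda>t. complex_of_real (V t - \<mu>) * u t"
  have kk: "?k = ?k'" by (simp add: fun_eq_iff algebra_simps)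
  have uc: "continuous_on {0..l} u"
    unfolding continuous_on_eq_continuous_within
    using has_vector_derivative_continuous[OF edge_solutionD(1)[OF R]] by blast
  have sq: "square_integrable_on ?k' {0..l}" by (rule square_integrable_on_potential_mult[OF V uc])
  have "H2_with_second_deriv l u ?k'"
    unfolding H2_with_second_deriv_def
  proof (intro conjI exI[of _ ?d] ballI sq)
    fix x assume x: "x \<in> {0..l}"
    show "(u has_vector_derivative ?d x) (at x within {0..l})" by (rule edge_solutionD(1)[OF R x])
    have "x \<le> l" using x by simp
    show "?d x = ?d 0 + integral\<^sup>L (lebesgue_on {0..x}) ?k'"
      unfolding lebesgue_on_integral_eq[OF square_integrable_on_imp_integrable[OF sq] \<open>x \<le> l\<close>]
      using edge_solutionD(2)[OF R x] unfolding kk .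
  qed
  moreover have "AE x in lebesgue_on {0..l}. - ?k' x + complex_of_real (V x) * u x = complex_of_real \<mu> * u x"
    by (intro always_eventually) (simp add: algebra_simps)
  ultimately show ?L by blast
qed

subsection \<open>Functions on a compact quantum graph\<close>

text \<open>Derivatives within a nondegenerate interval are unique, so whatever derivative an
  existence proof supplies may be replaced by the one that occurs in \<open>end_deriv\<close> and
  \<open>solves\<close>.\<close>

lemma edge_solution_vector_derivative:
  assumes "edge_solution q l u u' g" "0 < l"
  shows "edge_solution q l u (\<lambda>x. vector_derivative u (at x within {0..l})) g"
    and "\<And>x. x \<in> {0..l} \<Longrightarrow> vector_derivative u (at x within {0..l}) = u' x"
proof -
  show d: "vector_derivative u (at x within {0..l}) = u' x" if "x \<in> {0..l}" for x
    by (rule vector_derivative_within_closed_interval[OF assms(2) that edge_solutionD(1)[OF assms(1) that]])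
  have 0: "0 \<in> {0..l}" using assms(2) by simp
  show "edge_solution q l u (\<lambda>x. vector_derivative u (at x within {0..l})) g"
    unfolding edge_solution_def
  proof (intro ballI conjI)
    fix x assume x: "x \<in> {0..l}"
    show "(u has_vector_derivative vector_derivative u (at x within {0..l})) (at x within {0..l})"
      unfolding d[OF x] by (rule edge_solutionD(1)[OF assms(1) x])
    show "vector_derivative u (at x within {0..l}) = vector_derivative u (at 0 within {0..l}) +
        integral {0..x} (\<lambda>t. complex_of_real (q t) * u t - g t)"
      unfolding d[OF x] d[OF 0] by (rule edge_solutionD(2)[OF assms(1) x])
  qed
qed

lemma edge_solution_lincomb:
  assumes q: "q absolutely_integrable_on {0..l}" "0 < l"
    and f: "edge_solution q l f f' g" "continuous_on {0..l} g"
    and u: "edge_solution q l u u' h" "continuous_on {0..l} h"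
  shows "edge_solution q l (\<lambda>t. f t + c * u t) (\<lambda>t. f' t + c * u' t) (\<lambda>t. g t + c * h t)"
  unfolding edge_solution_def
proof (intro ballI conjI)
  fix x assume x: "x \<in> {0..l}"
  show "((\<lambda>t. f t + c * u t) has_vector_derivative f' x + c * u' x) (at x within {0..l})"
    by (intro has_vector_derivative_add has_vector_derivative_mult_right
        edge_solutionD(1)[OF f(1) x] edge_solutionD(1)[OF u(1) x])
  have sub: "{0..x} \<subseteq> {0..l}" using x by auto
  have "(\<lambda>t. complex_of_real (q t) * f t - g t) integrable_on {0..l}"
      "(\<lambda>t. complex_of_real (q t) * u t - h t) integrable_on {0..l}"
    using edge_solution_continuous(3)[OF q f] edge_solution_continuous(3)[OF q u]
    by (auto simp: absolutely_integrable_on_def)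
  from this[THEN integrable_subinterval_real[OF _ sub]]
  have "((\<lambda>t. (complex_of_real (q t) * f t - g t) + c * (complex_of_real (q t) * u t - h t)) has_integral
      integral {0..x} (\<lambda>t. complex_of_real (q t) * f t - g t) +
      c * integral {0..x} (\<lambda>t. complex_of_real (q t) * u t - h t)) {0..x}"
    by (intro has_integral_add has_integral_mult_right integrable_integral)
  then have "integral {0..x} (\<lambda>t. complex_of_real (q t) * (f t + c * u t) - (g t + c * h t)) =
      integral {0..x} (\<lambda>t. complex_of_real (q t) * f t - g t) +
      c * integral {0..x} (\<lambda>t. complex_of_real (q t) * u t - h t)"
    by (intro integral_unique) (simp add: algebra_simps)
  then show "f' x + c * u' x = f' 0 + c * u' 0 +
      integral {0..x} (\<lambda>t. complex_of_real (q t) * (f t + c * u t) - (g t + c * h t))"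
    by (subst edge_solutionD(2)[OF f(1) x], subst edge_solutionD(2)[OF u(1) x]) (simp add: algebra_simps)
qed

lemma sum_nth_distinct:
  "distinct xs \<Longrightarrow> (\<Sum>i<length xs. h (xs ! i)) = (\<Sum>x\<in>set xs. h x)"
  by (rule sum.reindex_bij_betw[OF bij_betw_nth]) auto

locale graph_vertex =
  fixes \<Gamma> :: "('v, 'e) quantum_graph" and v :: 'v
  assumes cqg: "compact_quantum_graph \<Gamma>" and v: "v \<in> verts (skeleton \<Gamma>)"
begin

abbreviation Es :: "'e set" where "Es \<equiv> arcs (skeleton \<Gamma>)"
abbreviation Vs :: "'v set" where "Vs \<equiv> verts (skeleton \<Gamma>)"

lemma finite_Es: "finite Es" and Es_nonempty: "Es \<noteq> {}" and finite_Vs: "finite Vs"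
  and tail_Vs: "e \<in> Es \<Longrightarrow> tail (skeleton \<Gamma>) e \<in> Vs" and head_Vs: "e \<in> Es \<Longrightarrow> head (skeleton \<Gamma>) e \<in> Vs"
  using cqg unfolding compact_quantum_graph_def
  by (auto intro: fin_digraph.finite_arcs fin_digraph.finite_verts
      wf_digraph.tail_in_verts wf_digraph.head_in_verts dest: fin_digraph.axioms)

lemma len_pos: "e \<in> Es \<Longrightarrow> 0 < len \<Gamma> e"
  and potential_sq: "e \<in> Es \<Longrightarrow> square_integrable_on (potential \<Gamma> e) {0..len \<Gamma> e}"
  and ends_distinct: "w \<in> Vs \<Longrightarrow> distinct (ends \<Gamma> w)"
  and ends_set: "w \<in> Vs \<Longrightarrow> set (ends \<Gamma> w) = edge_ends_at (skeleton \<Gamma>) w"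
  and vcond_sa: "w \<in> Vs \<Longrightarrow> self_adjoint_cond (deg \<Gamma> w) (vcond \<Gamma> w)"
  using cqg unfolding compact_quantum_graph_def by auto

lemma potential_int: "e \<in> Es \<Longrightarrow> (\<lambda>t. potential \<Gamma> e t - m) absolutely_integrable_on {0..len \<Gamma> e}"
  by (rule potential_absolutely_integrable[OF potential_sq])

definition edge_ends :: "('e \<times> side) set" where "edge_ends = Es \<times> UNIV"

lemma UNIV_side: "UNIV = {Init, Term}"
  using side.exhaust by auto

lemma finite_edge_ends: "finite edge_ends"
  using finite_Es by (simp add: edge_ends_def UNIV_side)

lemma sum_edge_ends: "sum h edge_ends = (\<Sum>e\<in>Es. h (e, Init) + h (e, Term))"
proof -
  have "sum h edge_ends = (\<Sum>e\<in>Es. \<Sum>s\<in>UNIV. h (e, s))"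
    by (simp add: edge_ends_def sum.cartesian_product)
  then show ?thesis by (simp add: UNIV_side)
qed

lemma ends_subset: "w \<in> Vs \<Longrightarrow> set (ends \<Gamma> w) \<subseteq> edge_ends"
  by (auto simp: ends_set edge_ends_at_def edge_ends_def)

lemma edge_ends_UN: "edge_ends = (\<Union>w\<in>Vs. set (ends \<Gamma> w))"
proof
  show "edge_ends \<subseteq> (\<Union>w\<in>Vs. set (ends \<Gamma> w))"
  proof
    fix \<epsilon> assume "\<epsilon> \<in> edge_ends"
    then obtain e s where \<epsilon>: "\<epsilon> = (e, s)" "e \<in> Es" by (auto simp: edge_ends_def)
    then show "\<epsilon> \<in> (\<Union>w\<in>Vs. set (ends \<Gamma> w))"
      using tail_Vs[OF \<epsilon>(2)] head_Vs[OF \<epsilon>(2)]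
      by (cases s) (auto simp: ends_set edge_ends_at_def)
  qed
qed (use ends_subset in blast)

lemma ends_disjoint: "w \<in> Vs \<Longrightarrow> w' \<in> Vs \<Longrightarrow> w \<noteq> w' \<Longrightarrow> set (ends \<Gamma> w) \<inter> set (ends \<Gamma> w') = {}"
  by (auto simp: ends_set edge_ends_at_def)

lemma sum_edge_ends_vertices: "sum h edge_ends = (\<Sum>w\<in>Vs. \<Sum>\<epsilon>\<in>set (ends \<Gamma> w). h \<epsilon>)"
  unfolding edge_ends_UN using finite_Vs ends_disjoint by (intro sum.UNION_disjoint) auto

text \<open>The vertex conditions number as many as the edge ends, two per edge, and so do the
  initial data (value and slope on each edge). This is what makes the system for the resolvent
  square.\<close>

lemma card_edge_ends: "card edge_ends = card (SIGMA w:Vs. {..<deg \<Gamma> w})"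
proof -
  have "card edge_ends = (\<Sum>w\<in>Vs. card (set (ends \<Gamma> w)))"
    unfolding edge_ends_UN using finite_Vs ends_disjoint by (intro card_UN_disjoint) auto
  also have "\<dots> = (\<Sum>w\<in>Vs. card {..<deg \<Gamma> w})"
    by (intro sum.cong refl) (simp add: distinct_card ends_distinct)
  finally show ?thesis using finite_Vs by simp
qed

text \<open>Continuity is required along the edges but not across vertices. Vanishing off the graph
  makes \<open>graph_ip\<close> definite and matches the convention for
  \<open>operator_domain\<close>.\<close>

definition graph_continuous :: "('e \<Rightarrow> real \<Rightarrow> complex) set" where
  "graph_continuous = {f. (\<forall>e x. e \<notin> Es \<or> x \<notin> {0..len \<Gamma> e} \<longrightarrow> f e x = 0) \<and>
     (\<forall>e\<in>Es. continuous_on {0..len \<Gamma> e} (f e))}"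

definition graph_ip :: "('e \<Rightarrow> real \<Rightarrow> complex) \<Rightarrow> ('e \<Rightarrow> real \<Rightarrow> complex) \<Rightarrow> complex" where
  "graph_ip f g = (\<Sum>e\<in>Es. integral {0..len \<Gamma> e} (\<lambda>t. f e t * cnj (g e t)))"

lemma graph_continuousD:
  "f \<in> graph_continuous \<Longrightarrow> e \<in> Es \<Longrightarrow> continuous_on {0..len \<Gamma> e} (f e)"
  "f \<in> graph_continuous \<Longrightarrow> e \<notin> Es \<or> x \<notin> {0..len \<Gamma> e} \<Longrightarrow> f e x = 0"
  by (auto simp: graph_continuous_def)

lemma graph_ip_self: "graph_ip f f = complex_of_real (\<Sum>e\<in>Es. sqnorm_on (len \<Gamma> e) (f e))"
  if f: "f \<in> graph_continuous"
proof -
  have "integral {0..len \<Gamma> e} (\<lambda>t. f e t * cnj (f e t)) = complex_of_real (sqnorm_on (len \<Gamma> e) (f e))"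
    if e: "e \<in> Es" for e
  proof -
    have "((\<lambda>t. complex_of_real ((cmod (f e t))\<^sup>2)) has_integral complex_of_real (sqnorm_on (len \<Gamma> e) (f e))) {0..len \<Gamma> e}"
      unfolding sqnorm_on_def
      using has_integral_linear[OF integrable_integral[OF sqnorm_integrable[OF graph_continuousD(1)[OF f e]]]
          bounded_linear_of_real] by (simp add: o_def)
    then show ?thesis by (simp add: complex_norm_square integral_unique del: of_real_power)
  qed
  then show ?thesis by (simp add: graph_ip_def)
qed

sublocale GC: inner_space scale_fun graph_continuous graph_ip
proof (unfold_locales)
  have ii: "(\<lambda>t. f e t * cnj (g e t)) integrable_on {0..len \<Gamma> e}"
    if "f \<in> graph_continuous" "g \<in> graph_continuous" "e \<in> Es" for f g e
    using that by (intro integrable_continuous_real continuous_intros graph_continuousD)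
  show "graph_fun.subspace graph_continuous"
    by (rule graph_fun.subspaceI)
       (auto simp: graph_continuous_def scale_fun_def zero_fun_def plus_fun_def intro!: continuous_intros)
  fix x y z :: "'e \<Rightarrow> real \<Rightarrow> complex" and c :: complex
  assume x: "x \<in> graph_continuous"
  show "0 \<le> Re (graph_ip x x)"
    unfolding graph_ip_self[OF x] by (auto intro!: sum_nonneg sqnorm_on_nonneg graph_continuousD(1)[OF x])
  {
    assume z: "z \<in> graph_continuous"
    show "graph_ip (scale_fun c x) z = c * graph_ip x z"
      by (simp add: graph_ip_def scale_fun_def mult.assoc sum_distrib_left)
    assume y: "y \<in> graph_continuous"
    show "graph_ip (x + y) z = graph_ip x z + graph_ip y z"
      unfolding graph_ip_def sum.distrib[symmetric]
    proof (intro sum.cong refl)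
      fix e assume "e \<in> Es"
      from has_integral_add[OF integrable_integral[OF ii[OF x z this]] integrable_integral[OF ii[OF y z this]]]
      show "integral {0..len \<Gamma> e} (\<lambda>t. (x + y) e t * cnj (z e t)) =
          integral {0..len \<Gamma> e} (\<lambda>t. x e t * cnj (z e t)) + integral {0..len \<Gamma> e} (\<lambda>t. y e t * cnj (z e t))"
        by (intro integral_unique) (simp add: plus_fun_def algebra_simps)
    qed
  }
  {
    assume y: "y \<in> graph_continuous"
    show "graph_ip y x = cnj (graph_ip x y)"
      unfolding graph_ip_def cnj_sum
    proof (intro sum.cong refl)
      fix e assume "e \<in> Es"
      from has_integral_linear[OF integrable_integral[OF ii[OF x y this]] bounded_linear_cnj]
      show "integral {0..len \<Gamma> e} (\<lambda>t. y e t * cnj (x e t)) = cnj (integral {0..len \<Gamma> e} (\<lambda>t. x e t * cnj (y e t)))"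
        by (intro integral_unique) (simp add: o_def mult.commute)
    qed
  }
  assume 0: "Re (graph_ip x x) = 0"
  have "x e t = 0" for e t
  proof (cases "e \<in> Es \<and> t \<in> {0..len \<Gamma> e}")
    case True
    then have e: "e \<in> Es" and t: "t \<in> {0..len \<Gamma> e}" by auto
    note xc = graph_continuousD(1)[OF x e]
    have "(\<Sum>e\<in>Es. sqnorm_on (len \<Gamma> e) (x e)) = 0" using 0 unfolding graph_ip_self[OF x] by simp
    then have "sqnorm_on (len \<Gamma> e) (x e) = 0"
      using e finite_Es sqnorm_on_nonneg[OF graph_continuousD(1)[OF x]]
      by (subst (asm) sum_nonneg_eq_0_iff) auto
    then have "((\<lambda>t. (cmod (x e t))\<^sup>2) has_integral 0) {0..len \<Gamma> e}"
      using integrable_integral[OF sqnorm_integrable[OF xc]] by (simp add: sqnorm_on_def)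
    then have "((\<lambda>t. (cmod (x e t))\<^sup>2) has_integral 0) (cbox 0 (len \<Gamma> e))" by simp
    moreover have "continuous_on (cbox 0 (len \<Gamma> e)) (\<lambda>t. (cmod (x e t))\<^sup>2)"
      using xc by (auto intro: continuous_intros)
    ultimately show ?thesis
      using has_integral_0_cbox_imp_0[of 0 "len \<Gamma> e" "\<lambda>t. (cmod (x e t))\<^sup>2" t] t len_pos[OF e] by auto
  qed (use graph_continuousD(2)[OF x, of e t] in auto)
  then show "x = 0" by (simp add: fun_eq_iff)
qed

abbreviation dd :: "('e \<Rightarrow> real \<Rightarrow> complex) \<Rightarrow> 'e \<Rightarrow> real \<Rightarrow> complex" where
  "dd f e x \<equiv> vector_derivative (f e) (at x within {0..len \<Gamma> e})"

text \<open>\<open>solves m f g\<close> says that \<open>- f'' + V f - m f = g\<close> on the edges, without vertex conditions.\<close>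

definition solves :: "real \<Rightarrow> ('e \<Rightarrow> real \<Rightarrow> complex) \<Rightarrow> ('e \<Rightarrow> real \<Rightarrow> complex) \<Rightarrow> bool" where
  "solves m f g \<longleftrightarrow> f \<in> graph_continuous \<and> g \<in> graph_continuous \<and>
     (\<forall>e\<in>Es. edge_solution (\<lambda>t. potential \<Gamma> e t - m) (len \<Gamma> e) (f e) (dd f e) (g e))"

lemma solvesD:
  assumes "solves m f g"
  shows "f \<in> graph_continuous" "g \<in> graph_continuous"
    "e \<in> Es \<Longrightarrow> edge_solution (\<lambda>t. potential \<Gamma> e t - m) (len \<Gamma> e) (f e) (dd f e) (g e)"
    "e \<in> Es \<Longrightarrow> continuous_on {0..len \<Gamma> e} (g e)"
    "e \<in> Es \<Longrightarrow> c1_on (len \<Gamma> e) (f e) (dd f e)"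
proof -
  show 1: "f \<in> graph_continuous" "g \<in> graph_continuous"
    and 3: "e \<in> Es \<Longrightarrow> edge_solution (\<lambda>t. potential \<Gamma> e t - m) (len \<Gamma> e) (f e) (dd f e) (g e)" for e
    using assms by (auto simp: solves_def)
  show 4: "e \<in> Es \<Longrightarrow> continuous_on {0..len \<Gamma> e} (g e)" for e by (rule graph_continuousD(1)[OF 1(2)])
  show "e \<in> Es \<Longrightarrow> c1_on (len \<Gamma> e) (f e) (dd f e)"
    by (rule edge_solution_c1[OF potential_int len_pos 3 4])
qed

lemma solves_lincomb:
  assumes f: "solves m f g" and u: "solves m u h"
  shows "solves m (f + scale_fun c u) (g + scale_fun c h)"
    and "\<epsilon> \<in> edge_ends \<Longrightarrow> end_value \<Gamma> (f + scale_fun c u) \<epsilon> = end_value \<Gamma> f \<epsilon> + c * end_value \<Gamma> u \<epsilon>"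
    and "\<epsilon> \<in> edge_ends \<Longrightarrow> end_deriv \<Gamma> (f + scale_fun c u) \<epsilon> = end_deriv \<Gamma> f \<epsilon> + c * end_deriv \<Gamma> u \<epsilon>"
proof -
  have fe: "(f + scale_fun c u) e = (\<lambda>t. f e t + c * u e t)" "(g + scale_fun c h) e = (\<lambda>t. g e t + c * h e t)" for e
    by (auto simp: scale_fun_def plus_fun_def)
  have sol: "edge_solution (\<lambda>t. potential \<Gamma> e t - m) (len \<Gamma> e) ((f + scale_fun c u) e)
      (\<lambda>t. dd f e t + c * dd u e t) ((g + scale_fun c h) e)" if e: "e \<in> Es" for e
    unfolding fe
    by (rule edge_solution_lincomb[OF potential_int[OF e] len_pos[OF e] solvesD(3)[OF f e] solvesD(4)[OF f e]
        solvesD(3)[OF u e] solvesD(4)[OF u e]])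
  note vd = edge_solution_vector_derivative[OF sol len_pos]
  show "solves m (f + scale_fun c u) (g + scale_fun c h)"
    unfolding solves_def
    using vd(1) solvesD(1,2)[OF f] solvesD(1,2)[OF u] by auto
  show "end_value \<Gamma> (f + scale_fun c u) \<epsilon> = end_value \<Gamma> f \<epsilon> + c * end_value \<Gamma> u \<epsilon>"
  proof -
    obtain e s where "\<epsilon> = (e, s)" by fastforce
    then show ?thesis by (cases s) (auto simp: scale_fun_def)
  qed
  assume "\<epsilon> \<in> edge_ends"
  then obtain e s where \<epsilon>: "\<epsilon> = (e, s)" "e \<in> Es" by (auto simp: edge_ends_def)
  then show "end_deriv \<Gamma> (f + scale_fun c u) \<epsilon> = end_deriv \<Gamma> f \<epsilon> + c * end_deriv \<Gamma> u \<epsilon>"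
    using vd(2)[OF \<epsilon>(2) \<epsilon>(2), of 0] vd(2)[OF \<epsilon>(2) \<epsilon>(2), of "len \<Gamma> e"] len_pos[OF \<epsilon>(2)]
    by (cases s) auto
qed

lemma solves_zero: "solves m 0 0"
proof -
  have "edge_solution (\<lambda>t. potential \<Gamma> e t - m) (len \<Gamma> e) (\<lambda>t. 0) (\<lambda>t. 0) (\<lambda>t. 0)" for e
    by (simp add: edge_solution_def)
  from edge_solution_vector_derivative(1)[OF this len_pos] show ?thesis
    by (simp add: solves_def zero_fun_def graph_continuous_def)
qed

lemma solves_sum:
  assumes "finite J" "\<And>j. j \<in> J \<Longrightarrow> solves m (f j) (g j)"
  shows "solves m (\<Sum>j\<in>J. scale_fun (c j) (f j)) (\<Sum>j\<in>J. scale_fun (c j) (g j)) \<and>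
    (\<forall>\<epsilon>\<in>edge_ends. end_value \<Gamma> (\<Sum>j\<in>J. scale_fun (c j) (f j)) \<epsilon> = (\<Sum>j\<in>J. c j * end_value \<Gamma> (f j) \<epsilon>) \<and>
      end_deriv \<Gamma> (\<Sum>j\<in>J. scale_fun (c j) (f j)) \<epsilon> = (\<Sum>j\<in>J. c j * end_deriv \<Gamma> (f j) \<epsilon>))"
  using assms
proof (induction J rule: finite_induct)
  case empty
  have "end_value \<Gamma> 0 \<epsilon> = 0 \<and> end_deriv \<Gamma> 0 \<epsilon> = 0" if ee: "\<epsilon> \<in> edge_ends" for \<epsilon>
  proof -
    obtain e s where \<epsilon>: "\<epsilon> = (e, s)" "e \<in> Es" using ee by (auto simp: edge_ends_def)
    have "vector_derivative (\<lambda>t. 0 :: complex) (at x within {0..len \<Gamma> e}) = 0" if "x \<in> {0..len \<Gamma> e}" for x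
      by (rule vector_derivative_within_closed_interval[OF len_pos[OF \<epsilon>(2)] that has_vector_derivative_const])
    then show ?thesis using \<epsilon>(1) len_pos[OF \<epsilon>(2)] by (cases s) (auto simp: zero_fun_def)
  qed
  then show ?case unfolding sum.empty using solves_zero by blast
next
  case (insert j J)
  then have IH: "solves m (\<Sum>j\<in>J. scale_fun (c j) (f j)) (\<Sum>j\<in>J. scale_fun (c j) (g j))" and j: "solves m (f j) (g j)"
    by auto
  have eq: "(\<Sum>j\<in>insert j J. scale_fun (c j) (h j)) = (\<Sum>j\<in>J. scale_fun (c j) (h j)) + scale_fun (c j) (h j)"
    for h :: "'a \<Rightarrow> 'e \<Rightarrow> real \<Rightarrow> complex"
    by (simp only: sum.insert[OF insert.hyps] add.commute)
  have eq': "(\<Sum>j\<in>insert j J. c j * h j) = (\<Sum>j\<in>J. c j * h j) + c j * h j" for h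
    by (simp only: sum.insert[OF insert.hyps] add.commute)
  have IH': "end_value \<Gamma> (\<Sum>j\<in>J. scale_fun (c j) (f j)) \<epsilon> = (\<Sum>j\<in>J. c j * end_value \<Gamma> (f j) \<epsilon>)"
      "end_deriv \<Gamma> (\<Sum>j\<in>J. scale_fun (c j) (f j)) \<epsilon> = (\<Sum>j\<in>J. c j * end_deriv \<Gamma> (f j) \<epsilon>)"
    if "\<epsilon> \<in> edge_ends" for \<epsilon>
    using insert.IH insert.prems that by auto
  show ?case
    unfolding eq eq'
  proof (intro conjI ballI)
    fix \<epsilon> assume \<epsilon>: "\<epsilon> \<in> edge_ends"
    note lc = solves_lincomb(2,3)[OF IH j \<epsilon>, where c = "c j"]
    show "end_value \<Gamma> ((\<Sum>j\<in>J. scale_fun (c j) (f j)) + scale_fun (c j) (f j)) \<epsilon> =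
        (\<Sum>j\<in>J. c j * end_value \<Gamma> (f j) \<epsilon>) + c j * end_value \<Gamma> (f j) \<epsilon>"
      unfolding lc IH'[OF \<epsilon>] ..
    show "end_deriv \<Gamma> ((\<Sum>j\<in>J. scale_fun (c j) (f j)) + scale_fun (c j) (f j)) \<epsilon> =
        (\<Sum>j\<in>J. c j * end_deriv \<Gamma> (f j) \<epsilon>) + c j * end_deriv \<Gamma> (f j) \<epsilon>"
      unfolding lc IH'[OF \<epsilon>] ..
  qed (rule solves_lincomb(1)[OF IH j])
qed

lemma end_lincomb_diff:
  assumes "solves m f g" "solves m u h"
  shows "solves m (f - u) (g - h)"
    "\<epsilon> \<in> edge_ends \<Longrightarrow> end_value \<Gamma> (f - u) \<epsilon> = end_value \<Gamma> f \<epsilon> - end_value \<Gamma> u \<epsilon>"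
    "\<epsilon> \<in> edge_ends \<Longrightarrow> end_deriv \<Gamma> (f - u) \<epsilon> = end_deriv \<Gamma> f \<epsilon> - end_deriv \<Gamma> u \<epsilon>"
proof -
  have "f + scale_fun (-1) u = f - u" "g + scale_fun (-1) h = g - h"
    by (auto simp: scale_fun_def fun_eq_iff)
  with solves_lincomb[OF assms, where c = "-1"]
  show "solves m (f - u) (g - h)"
    "\<epsilon> \<in> edge_ends \<Longrightarrow> end_value \<Gamma> (f - u) \<epsilon> = end_value \<Gamma> f \<epsilon> - end_value \<Gamma> u \<epsilon>"
    "\<epsilon> \<in> edge_ends \<Longrightarrow> end_deriv \<Gamma> (f - u) \<epsilon> = end_deriv \<Gamma> f \<epsilon> - end_deriv \<Gamma> u \<epsilon>" by auto
qed

subsection \<open>Vertex conditions\<close>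

lemma vertex_vec:
  "vertex_values \<Gamma> f w \<in> carrier_vec (deg \<Gamma> w)" "vertex_derivs \<Gamma> f w \<in> carrier_vec (deg \<Gamma> w)"
  "i < deg \<Gamma> w \<Longrightarrow> vec_index (vertex_values \<Gamma> f w) i = end_value \<Gamma> f (ends \<Gamma> w ! i)"
  "i < deg \<Gamma> w \<Longrightarrow> vec_index (vertex_derivs \<Gamma> f w) i = end_deriv \<Gamma> f (ends \<Gamma> w ! i)"
  by (simp_all add: vertex_values_def vertex_derivs_def vec_of_list_index carrier_dim_vec)

lemma sum_deg: "w \<in> Vs \<Longrightarrow> (\<Sum>i<deg \<Gamma> w. h (ends \<Gamma> w ! i)) = (\<Sum>\<epsilon>\<in>set (ends \<Gamma> w). h \<epsilon>)"
  by (rule sum_nth_distinct[OF ends_distinct])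

definition other_conds :: "('e \<Rightarrow> real \<Rightarrow> complex) \<Rightarrow> bool" where
  "other_conds f \<longleftrightarrow> (\<forall>w\<in>Vs - {v}. vcond \<Gamma> w (vertex_values \<Gamma> f w) (vertex_derivs \<Gamma> f w))"

text \<open>If no edge ends at \<open>v\<close>, the default 0 makes every
  \<open>\<delta>\<close>-type condition hold in scalar form, in agreement with
  \<open>delta_cond\<close> on empty vectors.\<close>

definition value_at :: "('e \<Rightarrow> real \<Rightarrow> complex) \<Rightarrow> complex" where
  "value_at f = (if ends \<Gamma> v = [] then 0 else end_value \<Gamma> f (hd (ends \<Gamma> v)))"

definition flux :: "('e \<Rightarrow> real \<Rightarrow> complex) \<Rightarrow> complex" where
  "flux f = (\<Sum>\<epsilon>\<in>set (ends \<Gamma> v). end_deriv \<Gamma> f \<epsilon>)"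

definition cont_at :: "('e \<Rightarrow> real \<Rightarrow> complex) \<Rightarrow> bool" where
  "cont_at f \<longleftrightarrow> (\<forall>\<epsilon>\<in>set (ends \<Gamma> v). end_value \<Gamma> f \<epsilon> = value_at f)"

definition graph_conds :: "ereal \<Rightarrow> ('e \<Rightarrow> real \<Rightarrow> complex) \<Rightarrow> bool" where
  "graph_conds a f \<longleftrightarrow> other_conds f \<and> cont_at f \<and>
     (if a = \<infinity> then value_at f = 0 else flux f = complex_of_real (real_of_ereal a) * value_at f)"

lemma flux_vertex: "(\<Sum>i<deg \<Gamma> v. vec_index (vertex_derivs \<Gamma> f v) i) = flux f"
  unfolding flux_def sum_deg[OF v, symmetric] by (intro sum.cong refl) (simp add: vertex_vec)

lemma delta_cond_iff:
  "delta_cond a (vertex_values \<Gamma> f v) (vertex_derivs \<Gamma> f v) \<longleftrightarrow> cont_at f \<and>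
     (if a = \<infinity> then value_at f = 0 else flux f = complex_of_real (real_of_ereal a) * value_at f)"
proof -
  have dims: "dim_vec (vertex_values \<Gamma> f v) = deg \<Gamma> v" "dim_vec (vertex_derivs \<Gamma> f v) = deg \<Gamma> v"
    using vertex_vec(1,2)[of f v] by auto
  have all: "(\<forall>i<deg \<Gamma> v. vec_index (vertex_values \<Gamma> f v) i = c) \<longleftrightarrow> (\<forall>\<epsilon>\<in>set (ends \<Gamma> v). end_value \<Gamma> f \<epsilon> = c)" for c
    by (simp add: vertex_vec all_set_conv_all_nth)
  have const: "(\<forall>\<epsilon>\<in>set (ends \<Gamma> v). end_value \<Gamma> f \<epsilon> = c) \<longleftrightarrow> cont_at f \<and> value_at f = c"
    if "ends \<Gamma> v \<noteq> []" for c
    using that by (auto simp: cont_at_def value_at_def)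
  show ?thesis
  proof (cases "ends \<Gamma> v = []")
    case True
    then show ?thesis by (auto simp: delta_cond_def dims cont_at_def value_at_def flux_def)
  next
    case False
    show ?thesis unfolding delta_cond_def dims all const[OF False] flux_vertex by auto
  qed
qed

lemma graph_conds_iff:
  "graph_conds a f \<longleftrightarrow> (\<forall>w\<in>Vs. vcond (with_delta \<Gamma> v a) w (vertex_values \<Gamma> f w) (vertex_derivs \<Gamma> f w))"
  unfolding graph_conds_def other_conds_def with_delta_def using v delta_cond_iff[of a f] by auto

lemma vcond_with_delta_linear:
  assumes "a \<noteq> -\<infinity>" "w \<in> Vs"
  shows "linear_cond (deg \<Gamma> w) (vcond (with_delta \<Gamma> v a) w)"
  using assms delta_cond_linear self_adjoint_cond_linear[OF vcond_sa] by (auto simp: with_delta_def)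

text \<open>The edge ends are regrouped by vertices; at each vertex other than \<open>v\<close> the
  contribution vanishes by symmetry of its self-adjoint condition.\<close>

lemma boundary_other:
  assumes "other_conds f" "other_conds u"
  shows "(\<Sum>\<epsilon>\<in>edge_ends. end_deriv \<Gamma> f \<epsilon> * cnj (end_value \<Gamma> u \<epsilon>) - end_value \<Gamma> f \<epsilon> * cnj (end_deriv \<Gamma> u \<epsilon>)) =
    (\<Sum>\<epsilon>\<in>set (ends \<Gamma> v). end_deriv \<Gamma> f \<epsilon> * cnj (end_value \<Gamma> u \<epsilon>) - end_value \<Gamma> f \<epsilon> * cnj (end_deriv \<Gamma> u \<epsilon>))"
proof -
  let ?h = "\<lambda>\<epsilon>. end_deriv \<Gamma> f \<epsilon> * cnj (end_value \<Gamma> u \<epsilon>) - end_value \<Gamma> f \<epsilon> * cnj (end_deriv \<Gamma> u \<epsilon>)"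
  have "(\<Sum>\<epsilon>\<in>set (ends \<Gamma> w). ?h \<epsilon>) = 0" if w: "w \<in> Vs - {v}" for w
  proof -
    have wV: "w \<in> Vs" using w by simp
    have "(\<Sum>\<epsilon>\<in>set (ends \<Gamma> w). ?h \<epsilon>) = (\<Sum>i<deg \<Gamma> w. ?h (ends \<Gamma> w ! i))"
      by (rule sum_deg[OF wV, symmetric])
    also have "\<dots> = (\<Sum>i<deg \<Gamma> w. vec_index (vertex_derivs \<Gamma> f w) i * cnj (vec_index (vertex_values \<Gamma> u w) i)) -
       (\<Sum>i<deg \<Gamma> w. vec_index (vertex_values \<Gamma> f w) i * cnj (vec_index (vertex_derivs \<Gamma> u w) i))"
      unfolding sum_subtractf[symmetric] by (intro sum.cong refl) (simp add: vertex_vec)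
    also have "\<dots> = 0"
      using assms w self_adjoint_cond_symmetric[OF vcond_sa[OF wV] vertex_vec(1)[of f w] vertex_vec(2)[of f w] _
          vertex_vec(1)[of u w] vertex_vec(2)[of u w]]
      by (auto simp: other_conds_def)
    finally show ?thesis .
  qed
  then show ?thesis
    unfolding sum_edge_ends_vertices using v finite_Vs by (subst sum.remove[of Vs v]) auto
qed

text \<open>At \<open>v\<close> only continuity is assumed, so that \<open>f\<close> and
  \<open>u\<close> may satisfy \<open>\<delta>\<close>-type conditions with different coefficients.
  This is the case in both places where the two operators are compared.\<close>

lemma graph_green:
  assumes f: "solves m f g" "other_conds f" "cont_at f" and u: "solves m u h" "other_conds u" "cont_at u"
  shows "graph_ip g u - graph_ip f h = flux f * cnj (value_at u) - value_at f * cnj (flux u)"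
proof -
  have "graph_ip g u - graph_ip f h =
    (\<Sum>\<epsilon>\<in>edge_ends. end_deriv \<Gamma> f \<epsilon> * cnj (end_value \<Gamma> u \<epsilon>) - end_value \<Gamma> f \<epsilon> * cnj (end_deriv \<Gamma> u \<epsilon>))"
    unfolding graph_ip_def sum_subtractf[symmetric] sum_edge_ends
  proof (intro sum.cong refl)
    fix e assume e: "e \<in> Es"
    show "integral {0..len \<Gamma> e} (\<lambda>t. g e t * cnj (u e t)) - integral {0..len \<Gamma> e} (\<lambda>t. f e t * cnj (h e t)) =
      end_deriv \<Gamma> f (e, Init) * cnj (end_value \<Gamma> u (e, Init)) - end_value \<Gamma> f (e, Init) * cnj (end_deriv \<Gamma> u (e, Init)) +
      (end_deriv \<Gamma> f (e, Term) * cnj (end_value \<Gamma> u (e, Term)) - end_value \<Gamma> f (e, Term) * cnj (end_deriv \<Gamma> u (e, Term)))"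
      using edge_green[OF potential_int[OF e] len_pos[OF e] solvesD(3)[OF f(1) e] solvesD(4)[OF f(1) e]
        solvesD(3)[OF u(1) e] solvesD(4)[OF u(1) e]] by simp
  qed
  also have "\<dots> = (\<Sum>\<epsilon>\<in>set (ends \<Gamma> v). end_deriv \<Gamma> f \<epsilon> * cnj (end_value \<Gamma> u \<epsilon>) - end_value \<Gamma> f \<epsilon> * cnj (end_deriv \<Gamma> u \<epsilon>))"
    by (rule boundary_other[OF f(2) u(2)])
  also have "\<dots> = (\<Sum>\<epsilon>\<in>set (ends \<Gamma> v). end_deriv \<Gamma> f \<epsilon> * cnj (value_at u) - value_at f * cnj (end_deriv \<Gamma> u \<epsilon>))"
    using f(3) u(3) by (intro sum.cong) (auto simp: cont_at_def)
  also have "\<dots> = flux f * cnj (value_at u) - value_at f * cnj (flux u)"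
    by (simp add: flux_def sum_subtractf sum_distrib_left sum_distrib_right)
  finally show ?thesis .
qed

text \<open>At \<open>v\<close> the subtraction trades the flux for \<open>\<alpha>\<close> times
  the squared value, so no condition beyond continuity is imposed there; elsewhere
  \<open>self_adjoint_cond_bound\<close> applies. The constant \<open>\<kappa>\<close> dominates all
  of these bounds.\<close>

lemma boundary_form_bound:
  "\<exists>\<kappa>\<ge>0. \<forall>f. other_conds f \<longrightarrow> cont_at f \<longrightarrow>
    - \<kappa> * (\<Sum>\<epsilon>\<in>edge_ends. (cmod (end_value \<Gamma> f \<epsilon>))\<^sup>2) \<le>
    Re (\<Sum>\<epsilon>\<in>edge_ends. end_deriv \<Gamma> f \<epsilon> * cnj (end_value \<Gamma> f \<epsilon>)) -
      Re ((flux f - complex_of_real \<alpha> * value_at f) * cnj (value_at f))"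
proof -
  have "\<exists>K\<ge>0. \<forall>f. vcond \<Gamma> w (vertex_values \<Gamma> f w) (vertex_derivs \<Gamma> f w) \<longrightarrow>
      cmod (\<Sum>\<epsilon>\<in>set (ends \<Gamma> w). end_deriv \<Gamma> f \<epsilon> * cnj (end_value \<Gamma> f \<epsilon>)) \<le>
        K * (\<Sum>\<epsilon>\<in>set (ends \<Gamma> w). (cmod (end_value \<Gamma> f \<epsilon>))\<^sup>2)" if w: "w \<in> Vs" for w
  proof -
    obtain K where K: "K \<ge> 0" "\<And>F F'. F \<in> carrier_vec (deg \<Gamma> w) \<Longrightarrow> F' \<in> carrier_vec (deg \<Gamma> w) \<Longrightarrow> vcond \<Gamma> w F F' \<Longrightarrow>
      cmod (\<Sum>i<deg \<Gamma> w. vec_index F' i * cnj (vec_index F i)) \<le> K * (\<Sum>i<deg \<Gamma> w. (cmod (vec_index F i))\<^sup>2)"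
      using self_adjoint_cond_bound[OF vcond_sa[OF w]] by blast
    show ?thesis
      using K(2)[OF vertex_vec(1,2)] K(1)
      by (intro exI[of _ K] conjI allI impI) (auto simp: vertex_vec sum_deg[OF w, symmetric])
  qed
  then have "\<forall>w\<in>Vs. \<exists>K\<ge>0. \<forall>f. vcond \<Gamma> w (vertex_values \<Gamma> f w) (vertex_derivs \<Gamma> f w) \<longrightarrow>
      cmod (\<Sum>\<epsilon>\<in>set (ends \<Gamma> w). end_deriv \<Gamma> f \<epsilon> * cnj (end_value \<Gamma> f \<epsilon>)) \<le>
        K * (\<Sum>\<epsilon>\<in>set (ends \<Gamma> w). (cmod (end_value \<Gamma> f \<epsilon>))\<^sup>2)" by (rule ballI)
  from bchoice[OF this] obtain K where K: "\<And>w. w \<in> Vs \<Longrightarrow> K w \<ge> 0"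
    "\<And>w f. w \<in> Vs \<Longrightarrow> vcond \<Gamma> w (vertex_values \<Gamma> f w) (vertex_derivs \<Gamma> f w) \<Longrightarrow>
      cmod (\<Sum>\<epsilon>\<in>set (ends \<Gamma> w). end_deriv \<Gamma> f \<epsilon> * cnj (end_value \<Gamma> f \<epsilon>)) \<le>
        K w * (\<Sum>\<epsilon>\<in>set (ends \<Gamma> w). (cmod (end_value \<Gamma> f \<epsilon>))\<^sup>2)" by blast
  define \<kappa> where "\<kappa> = (\<Sum>w\<in>Vs. K w) + \<bar>\<alpha>\<bar>"
  have \<kappa>: "K w \<le> \<kappa>" if "w \<in> Vs" for w
    using member_le_sum[of w Vs K] that K(1) finite_Vs by (auto simp: \<kappa>_def)
  have \<kappa>\<alpha>: "\<bar>\<alpha>\<bar> \<le> \<kappa>" "0 \<le> \<kappa>" using K(1) sum_nonneg[of Vs K] by (auto simp: \<kappa>_def)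
  show ?thesis
  proof (intro exI conjI allI impI)
    fix f assume f: "other_conds f" "cont_at f"
    let ?b = "\<lambda>w. \<Sum>\<epsilon>\<in>set (ends \<Gamma> w). end_deriv \<Gamma> f \<epsilon> * cnj (end_value \<Gamma> f \<epsilon>)"
    let ?s = "\<lambda>w. \<Sum>\<epsilon>\<in>set (ends \<Gamma> w). (cmod (end_value \<Gamma> f \<epsilon>))\<^sup>2"
    have s0: "0 \<le> ?s w" for w by (intro sum_nonneg) auto
    have other: "- \<kappa> * ?s w \<le> Re (?b w)" if w: "w \<in> Vs - {v}" for w
    proof -
      have "\<bar>Re (?b w)\<bar> \<le> K w * ?s w"
        using K(2)[of w f] f(1) w abs_Re_le_cmod[of "?b w"] unfolding other_conds_def by force
      also have "\<dots> \<le> \<kappa> * ?s w" using \<kappa>[of w] w s0 by (intro mult_right_mono) auto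
      finally show ?thesis by simp
    qed
    have bv: "?b v = flux f * cnj (value_at f)"
      using f(2) unfolding flux_def sum_distrib_right cont_at_def by (intro sum.cong) auto
    have vv: "(cmod (value_at f))\<^sup>2 \<le> ?s v"
    proof (cases "ends \<Gamma> v = []")
      case False
      then have "hd (ends \<Gamma> v) \<in> set (ends \<Gamma> v)" by simp
      from member_le_sum[OF this, of "\<lambda>\<epsilon>. (cmod (end_value \<Gamma> f \<epsilon>))\<^sup>2"] show ?thesis
        using False by (simp add: value_at_def)
    qed (simp add: value_at_def)
    have "Re ((flux f - complex_of_real \<alpha> * value_at f) * cnj (value_at f)) =
        Re (flux f * cnj (value_at f)) - \<alpha> * (cmod (value_at f))\<^sup>2"
      unfolding cmod_power2 by (simp add: algebra_simps power2_eq_square)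
    then have "Re (?b v) - Re ((flux f - complex_of_real \<alpha> * value_at f) * cnj (value_at f)) = \<alpha> * (cmod (value_at f))\<^sup>2"
      unfolding bv by simp
    moreover have "- (\<kappa> * ?s v) \<le> \<alpha> * (cmod (value_at f))\<^sup>2"
    proof -
      have "\<bar>\<alpha>\<bar> * (cmod (value_at f))\<^sup>2 \<le> \<kappa> * ?s v" using \<kappa>\<alpha> vv by (intro mult_mono) auto
      moreover have "- (\<bar>\<alpha>\<bar> * (cmod (value_at f))\<^sup>2) \<le> \<alpha> * (cmod (value_at f))\<^sup>2"
        using mult_right_mono[of "-\<bar>\<alpha>\<bar>" \<alpha> "(cmod (value_at f))\<^sup>2"] by simp
      ultimately show ?thesis by simp
    qed
    ultimately have atv: "- \<kappa> * ?s v \<le> Re (?b v) - Re ((flux f - complex_of_real \<alpha> * value_at f) * cnj (value_at f))"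
      by simp
    have "- \<kappa> * (\<Sum>\<epsilon>\<in>edge_ends. (cmod (end_value \<Gamma> f \<epsilon>))\<^sup>2) = - \<kappa> * ?s v + (\<Sum>w\<in>Vs - {v}. - \<kappa> * ?s w)"
      unfolding sum_edge_ends_vertices using v finite_Vs
      by (subst sum.remove[of Vs v]) (auto simp: sum_distrib_left sum_negf algebra_simps)
    also have "\<dots> \<le> (Re (?b v) - Re ((flux f - complex_of_real \<alpha> * value_at f) * cnj (value_at f))) + (\<Sum>w\<in>Vs - {v}. Re (?b w))"
      by (intro add_mono atv sum_mono other)
    also have "\<dots> = Re (\<Sum>\<epsilon>\<in>edge_ends. end_deriv \<Gamma> f \<epsilon> * cnj (end_value \<Gamma> f \<epsilon>)) -
      Re ((flux f - complex_of_real \<alpha> * value_at f) * cnj (value_at f))"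
      unfolding sum_edge_ends_vertices using v finite_Vs by (subst sum.remove[of Vs v]) auto
    finally show "- \<kappa> * (\<Sum>\<epsilon>\<in>edge_ends. (cmod (end_value \<Gamma> f \<epsilon>))\<^sup>2) \<le>
      Re (\<Sum>\<epsilon>\<in>edge_ends. end_deriv \<Gamma> f \<epsilon> * cnj (end_value \<Gamma> f \<epsilon>)) -
        Re ((flux f - complex_of_real \<alpha> * value_at f) * cnj (value_at f))" .
  qed (rule \<kappa>\<alpha>(2))
qed

text \<open>The right-hand side of the estimate is the quadratic form of \<open>H\<^sub>\<alpha> - m\<close> at \<open>f\<close>; for \<open>f\<close> outside
  the operator domain it differs from \<open>\<langle>g, f\<rangle>\<close> by a term at \<open>v\<close>.\<close>

lemma graph_form_bound:
  "\<exists>m. \<forall>f g. solves m f g \<longrightarrow> other_conds f \<longrightarrow> cont_at f \<longrightarrow>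
     (\<Sum>e\<in>Es. sqnorm_on (len \<Gamma> e) (dd f e)) / 2 + Re (graph_ip f f) \<le>
     Re (graph_ip g f) - Re ((flux f - complex_of_real \<alpha> * value_at f) * cnj (value_at f))"
proof -
  obtain \<kappa> where \<kappa>: "\<kappa> \<ge> 0" "\<And>f. other_conds f \<Longrightarrow> cont_at f \<Longrightarrow>
    - \<kappa> * (\<Sum>\<epsilon>\<in>edge_ends. (cmod (end_value \<Gamma> f \<epsilon>))\<^sup>2) \<le>
    Re (\<Sum>\<epsilon>\<in>edge_ends. end_deriv \<Gamma> f \<epsilon> * cnj (end_value \<Gamma> f \<epsilon>)) -
      Re ((flux f - complex_of_real \<alpha> * value_at f) * cnj (value_at f))"
    using boundary_form_bound[of \<alpha>] by blast
  have "\<exists>C. \<forall>f f'. c1_on (len \<Gamma> e) f f' \<longrightarrow>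
    sqnorm_on (len \<Gamma> e) f' / 2 - C * sqnorm_on (len \<Gamma> e) f \<le>
      sqnorm_on (len \<Gamma> e) f' + integral {0..len \<Gamma> e} (\<lambda>t. potential \<Gamma> e t * (cmod (f t))\<^sup>2)
        - \<kappa> * ((cmod (f 0))\<^sup>2 + (cmod (f (len \<Gamma> e)))\<^sup>2)" if e: "e \<in> Es" for e
    using potential_int[OF e, of 0] by (intro c1_form_lower_bound[OF _ len_pos[OF e] \<kappa>(1)]) simp
  then have "\<forall>e\<in>Es. \<exists>C. \<forall>f f'. c1_on (len \<Gamma> e) f f' \<longrightarrow>
    sqnorm_on (len \<Gamma> e) f' / 2 - C * sqnorm_on (len \<Gamma> e) f \<le>
      sqnorm_on (len \<Gamma> e) f' + integral {0..len \<Gamma> e} (\<lambda>t. potential \<Gamma> e t * (cmod (f t))\<^sup>2)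
        - \<kappa> * ((cmod (f 0))\<^sup>2 + (cmod (f (len \<Gamma> e)))\<^sup>2)" by (rule ballI)
  from bchoice[OF this] obtain C where C: "\<And>e f f'. e \<in> Es \<Longrightarrow> c1_on (len \<Gamma> e) f f' \<Longrightarrow>
    sqnorm_on (len \<Gamma> e) f' / 2 - C e * sqnorm_on (len \<Gamma> e) f \<le>
      sqnorm_on (len \<Gamma> e) f' + integral {0..len \<Gamma> e} (\<lambda>t. potential \<Gamma> e t * (cmod (f t))\<^sup>2)
        - \<kappa> * ((cmod (f 0))\<^sup>2 + (cmod (f (len \<Gamma> e)))\<^sup>2)" by blast
  \<comment> \<open>Chosen such that \<open>- C e - m\<close> is at least 1 on every edge: after
    absorption the squared norm of \<open>f\<close> itself is still left with coefficient 1.\<close>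
  define m where "m = - (\<Sum>e\<in>Es. \<bar>C e\<bar>) - 1"
  have Cm: "1 \<le> - C e - m" if "e \<in> Es" for e
    using member_le_sum[of e Es "\<lambda>e. \<bar>C e\<bar>"] that finite_Es by (auto simp: m_def)
  show ?thesis
  proof (intro exI allI impI)
    fix f g assume f: "solves m f g" "other_conds f" "cont_at f"
    let ?l = "len \<Gamma>" and ?V = "potential \<Gamma>"
    let ?R = "Re ((flux f - complex_of_real \<alpha> * value_at f) * cnj (value_at f))"
    let ?E = "\<lambda>e. sqnorm_on (?l e) (dd f e)" and ?N = "\<lambda>e. sqnorm_on (?l e) (f e)"
    let ?P = "\<lambda>e. integral {0..?l e} (\<lambda>t. ?V e t * (cmod (f e t))\<^sup>2)"
    let ?b = "\<lambda>e. (cmod (f e 0))\<^sup>2 + (cmod (f e (?l e)))\<^sup>2"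
    have edge: "Re (integral {0..?l e} (\<lambda>t. g e t * cnj (f e t))) =
        ?E e + ?P e - m * ?N e + Re (end_deriv \<Gamma> f (e, Init) * cnj (end_value \<Gamma> f (e, Init)) +
          end_deriv \<Gamma> f (e, Term) * cnj (end_value \<Gamma> f (e, Term)))" if e: "e \<in> Es" for e
    proof -
      note fc = graph_continuousD(1)[OF solvesD(1)[OF f(1)] e]
      have "(\<lambda>t. ?V e t * (cmod (f e t))\<^sup>2) integrable_on {0..?l e}"
        using mult_sqnorm_integrable[OF potential_int[OF e, of 0] fc] by simp
      from has_integral_diff[OF integrable_integral[OF this]
          has_integral_mult_right[OF integrable_integral[OF sqnorm_integrable[OF fc]], of m]]
      have "integral {0..?l e} (\<lambda>t. (?V e t - m) * (cmod (f e t))\<^sup>2) = ?P e - m * ?N e"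
        unfolding sqnorm_on_def by (intro integral_unique) (simp add: algebra_simps)
      with edge_energy[OF potential_int[OF e] len_pos[OF e] solvesD(3)[OF f(1) e] solvesD(4)[OF f(1) e]]
      show ?thesis by simp
    qed
    have "(\<Sum>e\<in>Es. ?E e) / 2 + Re (graph_ip f f) = (\<Sum>e\<in>Es. ?E e / 2 + ?N e)"
      unfolding graph_ip_self[OF solvesD(1)[OF f(1)]] by (simp add: sum_divide_distrib sum.distrib)
    also have "\<dots> \<le> (\<Sum>e\<in>Es. ?E e + ?P e - m * ?N e - \<kappa> * ?b e)"
    proof (intro sum_mono)
      fix e assume e: "e \<in> Es"
      have "?N e \<le> (- C e - m) * ?N e"
        using mult_right_mono[OF Cm[OF e] sqnorm_on_nonneg[OF graph_continuousD(1)[OF solvesD(1)[OF f(1)] e]]] by simp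
      then show "?E e / 2 + ?N e \<le> ?E e + ?P e - m * ?N e - \<kappa> * ?b e"
        using C[OF e solvesD(5)[OF f(1) e]] by (simp add: algebra_simps)
    qed
    also have "\<dots> = (\<Sum>e\<in>Es. ?E e + ?P e - m * ?N e) - \<kappa> * (\<Sum>\<epsilon>\<in>edge_ends. (cmod (end_value \<Gamma> f \<epsilon>))\<^sup>2)"
      unfolding sum_edge_ends sum_subtractf sum_distrib_left by simp
    also have "\<dots> \<le> (\<Sum>e\<in>Es. ?E e + ?P e - m * ?N e) +
        (Re (\<Sum>\<epsilon>\<in>edge_ends. end_deriv \<Gamma> f \<epsilon> * cnj (end_value \<Gamma> f \<epsilon>)) - ?R)"
      using \<kappa>(2)[OF f(2,3)] by simp
    also have "\<dots> = Re (graph_ip g f) - ?R"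
      unfolding graph_ip_def Re_sum sum_edge_ends by (simp add: edge sum.distrib)
    finally show "(\<Sum>e\<in>Es. ?E e) / 2 + Re (graph_ip f f) \<le> Re (graph_ip g f) - ?R" .
  qed
qed

end

subsection \<open>The resolvent\<close>

lemma linear_cond_lincomb:
  assumes C: "linear_cond d C" and F: "F \<in> carrier_vec d" "F' \<in> carrier_vec d" "C F F'"
    and G: "G \<in> carrier_vec d" "G' \<in> carrier_vec d" "C G G'"
    and H: "H \<in> carrier_vec d" "H' \<in> carrier_vec d"
    "\<And>i. i < d \<Longrightarrow> vec_index H i = vec_index F i + c * vec_index G i"
    "\<And>i. i < d \<Longrightarrow> vec_index H' i = vec_index F' i + c * vec_index G' i"
  shows "C H H'"
proof -
  obtain a b where ab: "\<And>F F'. F \<in> carrier_vec d \<Longrightarrow> F' \<in> carrier_vec d \<Longrightarrow>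
      C F F' \<longleftrightarrow> (\<forall>i<d. (\<Sum>j<d. a i j * vec_index F j + b i j * vec_index F' j) = 0)"
    using C unfolding linear_cond_def by metis
  have "(\<Sum>j<d. a i j * vec_index H j + b i j * vec_index H' j) =
      (\<Sum>j<d. a i j * vec_index F j + b i j * vec_index F' j) +
      c * (\<Sum>j<d. a i j * vec_index G j + b i j * vec_index G' j)" for i
    unfolding sum_distrib_left sum.distrib[symmetric]
    by (intro sum.cong refl) (simp add: H algebra_simps)
  moreover have "\<forall>i<d. (\<Sum>j<d. a i j * vec_index F j + b i j * vec_index F' j) = 0"
    "\<forall>i<d. (\<Sum>j<d. a i j * vec_index G j + b i j * vec_index G' j) = 0"
    using ab[OF F(1,2)] ab[OF G(1,2)] F(3) G(3) by blast+
  ultimately show ?thesis unfolding ab[OF H(1,2)] by simp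
qed

context graph_vertex
begin

lemma end_zero: "\<epsilon> \<in> edge_ends \<Longrightarrow> end_value \<Gamma> 0 \<epsilon> = 0" "\<epsilon> \<in> edge_ends \<Longrightarrow> end_deriv \<Gamma> 0 \<epsilon> = 0"
proof -
  assume "\<epsilon> \<in> edge_ends"
  with solves_sum[of "{} :: nat set" m "\<lambda>_. 0" "\<lambda>_. 0" "\<lambda>_. 0"]
  show "end_value \<Gamma> 0 \<epsilon> = 0" "end_deriv \<Gamma> 0 \<epsilon> = 0" unfolding sum.empty by auto
qed

lemma vertex_lincomb:
  assumes "solves m f g" "solves m u h" "w \<in> Vs" "i < deg \<Gamma> w"
  shows "vec_index (vertex_values \<Gamma> (f + scale_fun c u) w) i =
      vec_index (vertex_values \<Gamma> f w) i + c * vec_index (vertex_values \<Gamma> u w) i"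
    "vec_index (vertex_derivs \<Gamma> (f + scale_fun c u) w) i =
      vec_index (vertex_derivs \<Gamma> f w) i + c * vec_index (vertex_derivs \<Gamma> u w) i"
proof -
  have "ends \<Gamma> w ! i \<in> edge_ends" using ends_subset[OF assms(3)] nth_mem[OF assms(4)] by blast
  then show "vec_index (vertex_values \<Gamma> (f + scale_fun c u) w) i =
      vec_index (vertex_values \<Gamma> f w) i + c * vec_index (vertex_values \<Gamma> u w) i"
    "vec_index (vertex_derivs \<Gamma> (f + scale_fun c u) w) i =
      vec_index (vertex_derivs \<Gamma> f w) i + c * vec_index (vertex_derivs \<Gamma> u w) i"
    using solves_lincomb(2,3)[OF assms(1,2)] by (simp_all only: vertex_vec(3,4)[OF assms(4)])
qed

lemma graph_conds_lincomb:
  assumes "a \<noteq> -\<infinity>" and f: "solves m f g" "graph_conds a f" and u: "solves m u h" "graph_conds a u"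
  shows "graph_conds a (f + scale_fun c u)"
  unfolding graph_conds_iff
proof
  fix w assume w: "w \<in> Vs"
  show "vcond (with_delta \<Gamma> v a) w (vertex_values \<Gamma> (f + scale_fun c u) w) (vertex_derivs \<Gamma> (f + scale_fun c u) w)"
    by (rule linear_cond_lincomb[OF vcond_with_delta_linear[OF assms(1) w] vertex_vec(1,2) _ vertex_vec(1,2) _ vertex_vec(1,2)
        vertex_lincomb[OF f(1) u(1) w]])
       (use f(2) u(2) w in \<open>auto simp: graph_conds_iff\<close>)
qed

lemma value_flux_lincomb:
  assumes "solves m f g" "solves m u h"
  shows "value_at (f + scale_fun c u) = value_at f + c * value_at u"
    "flux (f + scale_fun c u) = flux f + c * flux u"
proof -
  have sub: "\<epsilon> \<in> edge_ends" if "\<epsilon> \<in> set (ends \<Gamma> v)" for \<epsilon> using ends_subset[OF v] that by auto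
  show "value_at (f + scale_fun c u) = value_at f + c * value_at u"
  proof (cases "ends \<Gamma> v = []")
    case False
    then have "hd (ends \<Gamma> v) \<in> edge_ends" by (intro sub) simp
    from solves_lincomb(2)[OF assms this] False show ?thesis by (simp only: value_at_def if_False)
  qed (simp add: value_at_def)
  show "flux (f + scale_fun c u) = flux f + c * flux u"
    unfolding flux_def sum_distrib_left sum.distrib[symmetric]
    by (intro sum.cong refl solves_lincomb(3)[OF assms] sub)
qed

text \<open>For differences of functions that satisfy different conditions at \<open>v\<close>,
  where \<open>graph_conds_lincomb\<close> is not applicable.\<close>

lemma cont_other_lincomb:
  assumes f: "solves m f g" "other_conds f" "cont_at f" and u: "solves m u h" "other_conds u" "cont_at u"
  shows "other_conds (f + scale_fun c u)" "cont_at (f + scale_fun c u)"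
proof -
  have sub: "\<epsilon> \<in> edge_ends" if "\<epsilon> \<in> set (ends \<Gamma> v)" for \<epsilon> using ends_subset[OF v] that by auto
  show "cont_at (f + scale_fun c u)"
    unfolding cont_at_def value_flux_lincomb(1)[OF f(1) u(1)]
  proof
    fix \<epsilon> assume "\<epsilon> \<in> set (ends \<Gamma> v)"
    then show "end_value \<Gamma> (f + scale_fun c u) \<epsilon> = value_at f + c * value_at u"
      using f(3) u(3) solves_lincomb(2)[OF f(1) u(1) sub] unfolding cont_at_def by metis
  qed
  show "other_conds (f + scale_fun c u)"
    unfolding other_conds_def
  proof
    fix w assume w: "w \<in> Vs - {v}"
    then have wV: "w \<in> Vs" by simp
    show "vcond \<Gamma> w (vertex_values \<Gamma> (f + scale_fun c u) w) (vertex_derivs \<Gamma> (f + scale_fun c u) w)"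
      by (rule linear_cond_lincomb[OF self_adjoint_cond_linear[OF vcond_sa[OF wV]] vertex_vec(1,2) _ vertex_vec(1,2) _ vertex_vec(1,2)
          vertex_lincomb[OF f(1) u(1) wV]])
         (use f(2) u(2) w in \<open>auto simp: other_conds_def\<close>)
  qed
qed

lemma diff_eq_lincomb: "f - u = f + scale_fun (-1) u"
  by (auto simp: scale_fun_def fun_eq_iff)

definition extend :: "('e \<Rightarrow> real \<Rightarrow> complex) \<Rightarrow> 'e \<Rightarrow> real \<Rightarrow> complex" where
  "extend h = (\<lambda>e t. if e \<in> Es \<and> t \<in> {0..len \<Gamma> e} then h e t else 0)"

lemma edge_solution_cong:
  assumes "edge_solution q l f f' g" "\<And>t. t \<in> {0..l} \<Longrightarrow> f t = f2 t"
  shows "edge_solution q l f2 f' g"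
  unfolding edge_solution_def
proof (intro ballI conjI)
  fix x assume x: "x \<in> {0..l}"
  show "(f2 has_vector_derivative f' x) (at x within {0..l})"
    using has_vector_derivative_transform[OF x _ edge_solutionD(1)[OF assms(1) x]] assms(2) by auto
  have "integral {0..x} (\<lambda>t. complex_of_real (q t) * f t - g t) = integral {0..x} (\<lambda>t. complex_of_real (q t) * f2 t - g t)"
    using x assms(2) by (intro Henstock_Kurzweil_Integration.integral_cong) auto
  then show "f' x = f' 0 + integral {0..x} (\<lambda>t. complex_of_real (q t) * f2 t - g t)"
    using edge_solutionD(2)[OF assms(1) x] by (simp only:)
qed

lemma solves_extend:
  assumes g: "g \<in> graph_continuous"
    and h: "\<And>e. e \<in> Es \<Longrightarrow> edge_solution (\<lambda>t. potential \<Gamma> e t - m) (len \<Gamma> e) (h e) (h' e) (g e)"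
  shows "solves m (extend h) g"
    "e \<in> Es \<Longrightarrow> end_value \<Gamma> (extend h) (e, Init) = h e 0"
    "e \<in> Es \<Longrightarrow> end_deriv \<Gamma> (extend h) (e, Init) = h' e 0"
proof -
  have sol: "edge_solution (\<lambda>t. potential \<Gamma> e t - m) (len \<Gamma> e) (extend h e) (h' e) (g e)" if e: "e \<in> Es" for e
    by (rule edge_solution_cong[OF h[OF e]]) (use e in \<open>simp add: extend_def\<close>)
  have "extend h \<in> graph_continuous"
    unfolding graph_continuous_def
    using edge_solution_continuous(1)[OF potential_int len_pos sol graph_continuousD(1)[OF g]]
    by (auto simp: extend_def)
  then show "solves m (extend h) g"
    using edge_solution_vector_derivative(1)[OF sol len_pos] g by (simp add: solves_def)
  assume e: "e \<in> Es"
  then show "end_value \<Gamma> (extend h) (e, Init) = h e 0" using len_pos[OF e] by (simp add: extend_def)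
  show "end_deriv \<Gamma> (extend h) (e, Init) = h' e 0"
    using edge_solution_vector_derivative(2)[OF sol[OF e] len_pos[OF e], of 0] len_pos[OF e] by simp
qed

text \<open>A basis of the solutions of the homogeneous equation, indexed by edge ends:
  \<open>(e, Init)\<close> prescribes the initial value on \<open>e\<close>, while
  \<open>(e, Term)\<close> merely labels the second datum, the initial slope.\<close>

lemma edge_basis_exists:
  "\<exists>B. \<forall>\<epsilon>\<in>edge_ends. solves m (B \<epsilon>) 0 \<and> (\<forall>e\<in>Es.
     end_value \<Gamma> (B \<epsilon>) (e, Init) = (if (e, Init) = \<epsilon> then 1 else 0) \<and>
     end_deriv \<Gamma> (B \<epsilon>) (e, Init) = (if (e, Term) = \<epsilon> then 1 else 0))"
proof -
  have "\<exists>b. solves m b 0 \<and> (\<forall>e\<in>Es.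
     end_value \<Gamma> b (e, Init) = (if (e, Init) = (e0, s) then 1 else 0) \<and>
     end_deriv \<Gamma> b (e, Init) = (if (e, Term) = (e0, s) then 1 else 0))" for e0 s
  proof -
    have "\<exists>f f'. edge_solution (\<lambda>t. potential \<Gamma> e t - m) (len \<Gamma> e) f f' (\<lambda>t. 0) \<and>
        f 0 = (if (e, Init) = (e0, s) then 1 else 0) \<and> f' 0 = (if (e, Term) = (e0, s) then 1 else 0)" if "e \<in> Es" for e
      using that by (intro edge_solution_exists[OF potential_int len_pos]) auto
    then have "\<forall>e\<in>Es. \<exists>p. edge_solution (\<lambda>t. potential \<Gamma> e t - m) (len \<Gamma> e) (fst p) (snd p) (\<lambda>t. 0) \<and>
        fst p 0 = (if (e, Init) = (e0, s) then 1 else 0) \<and> snd p 0 = (if (e, Term) = (e0, s) then 1 else 0)"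
      by simp
    from bchoice[OF this] obtain p where p: "\<And>e. e \<in> Es \<Longrightarrow> edge_solution (\<lambda>t. potential \<Gamma> e t - m) (len \<Gamma> e) (fst (p e)) (snd (p e)) (\<lambda>t. 0)"
        "\<And>e. e \<in> Es \<Longrightarrow> fst (p e) 0 = (if (e, Init) = (e0, s) then 1 else 0)"
        "\<And>e. e \<in> Es \<Longrightarrow> snd (p e) 0 = (if (e, Term) = (e0, s) then 1 else 0)" by blast
    have 0: "(0 :: 'e \<Rightarrow> real \<Rightarrow> complex) e = (\<lambda>t. 0)" for e by (simp add: zero_fun_def)
    have p0: "edge_solution (\<lambda>t. potential \<Gamma> e t - m) (len \<Gamma> e) (fst (p e)) (snd (p e)) ((0 :: 'e \<Rightarrow> real \<Rightarrow> complex) e)"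
      if "e \<in> Es" for e unfolding 0 by (rule p(1)[OF that])
    note ext = solves_extend[of 0 m "\<lambda>e. fst (p e)" "\<lambda>e. snd (p e)", OF GC.X_simps(1) p0]
    show ?thesis
    proof (intro exI[of _ "extend (\<lambda>e. fst (p e))"] conjI ballI)
      show "solves m (extend (\<lambda>e. fst (p e))) 0" using ext(1) by blast
      fix e assume e: "e \<in> Es"
      show "end_value \<Gamma> (extend (\<lambda>e. fst (p e))) (e, Init) = (if (e, Init) = (e0, s) then 1 else 0)"
        using ext(2)[OF _ e] p(2)[OF e] by simp
      show "end_deriv \<Gamma> (extend (\<lambda>e. fst (p e))) (e, Init) = (if (e, Term) = (e0, s) then 1 else 0)"
        using ext(3)[OF _ e] p(3)[OF e] by simp
    qed
  qed
  then have "\<forall>\<epsilon>\<in>edge_ends. \<exists>b. solves m b 0 \<and> (\<forall>e\<in>Es.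
     end_value \<Gamma> b (e, Init) = (if (e, Init) = \<epsilon> then 1 else 0) \<and>
     end_deriv \<Gamma> b (e, Init) = (if (e, Term) = \<epsilon> then 1 else 0))" by force
  from bchoice[OF this] show ?thesis .
qed

lemma particular_solution_exists:
  assumes g: "g \<in> graph_continuous"
  shows "\<exists>f. solves m f g"
proof -
  have "\<forall>e\<in>Es. \<exists>p. edge_solution (\<lambda>t. potential \<Gamma> e t - m) (len \<Gamma> e) (fst p) (snd p) (g e)"
    using edge_solution_exists[OF potential_int len_pos graph_continuousD(1)[OF g]] by fastforce
  from bchoice[OF this] obtain p where
    p: "\<And>e. e \<in> Es \<Longrightarrow> edge_solution (\<lambda>t. potential \<Gamma> e t - m) (len \<Gamma> e) (fst (p e)) (snd (p e)) (g e)" by blast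
  from solves_extend(1)[OF g, of m "\<lambda>e. fst (p e)" "\<lambda>e. snd (p e)", OF p] show ?thesis by blast
qed

lemma vertex_functionals_exist:
  assumes "a \<noteq> -\<infinity>"
  shows "\<exists>A B. \<forall>f. graph_conds a f \<longleftrightarrow> (\<forall>(w, i)\<in>(SIGMA w:Vs. {..<deg \<Gamma> w}).
    (\<Sum>j<deg \<Gamma> w. A w i j * end_value \<Gamma> f (ends \<Gamma> w ! j) + B w i j * end_deriv \<Gamma> f (ends \<Gamma> w ! j)) = 0)"
proof -
  have "\<forall>w\<in>Vs. \<exists>p. \<forall>F\<in>carrier_vec (deg \<Gamma> w). \<forall>F'\<in>carrier_vec (deg \<Gamma> w).
     vcond (with_delta \<Gamma> v a) w F F' \<longleftrightarrow>
       (\<forall>i<deg \<Gamma> w. (\<Sum>j<deg \<Gamma> w. fst p i j * vec_index F j + snd p i j * vec_index F' j) = 0)"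
    using vcond_with_delta_linear[OF assms] unfolding linear_cond_def by simp
  from bchoice[OF this] obtain p where p: "\<And>w F F'. w \<in> Vs \<Longrightarrow> F \<in> carrier_vec (deg \<Gamma> w) \<Longrightarrow> F' \<in> carrier_vec (deg \<Gamma> w) \<Longrightarrow>
     vcond (with_delta \<Gamma> v a) w F F' \<longleftrightarrow>
       (\<forall>i<deg \<Gamma> w. (\<Sum>j<deg \<Gamma> w. fst (p w) i j * vec_index F j + snd (p w) i j * vec_index F' j) = 0)"
    by blast
  have "graph_conds a f \<longleftrightarrow> (\<forall>w\<in>Vs. \<forall>i<deg \<Gamma> w.
    (\<Sum>j<deg \<Gamma> w. fst (p w) i j * end_value \<Gamma> f (ends \<Gamma> w ! j) + snd (p w) i j * end_deriv \<Gamma> f (ends \<Gamma> w ! j)) = 0)" for f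
    unfolding graph_conds_iff
  proof (intro ball_cong refl)
    fix w assume w: "w \<in> Vs"
    show "vcond (with_delta \<Gamma> v a) w (vertex_values \<Gamma> f w) (vertex_derivs \<Gamma> f w) \<longleftrightarrow> (\<forall>i<deg \<Gamma> w.
    (\<Sum>j<deg \<Gamma> w. fst (p w) i j * end_value \<Gamma> f (ends \<Gamma> w ! j) + snd (p w) i j * end_deriv \<Gamma> f (ends \<Gamma> w ! j)) = 0)"
      unfolding p[OF w vertex_vec(1,2)] by (simp add: vertex_vec(3,4))
  qed
  then show ?thesis
    by (intro exI[of _ "\<lambda>w. fst (p w)"] exI[of _ "\<lambda>w. snd (p w)"]) (auto simp: Sigma_def)
qed

end

text \<open>\<open>\<alpha>\<close> is the smaller of the two coefficients and \<open>m\<close> the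
  shift belonging to it; every condition with coefficient \<open>a \<ge> \<alpha>\<close> is treated
  with this same \<open>m\<close>.\<close>

locale graph_resolvent = graph_vertex \<Gamma> v
  for \<Gamma> :: "('v, 'e) quantum_graph" and v :: 'v +
  fixes \<alpha> m :: real
  assumes form_bound: "\<And>f g. \<lbrakk>solves m f g; other_conds f; cont_at f\<rbrakk> \<Longrightarrow>
     (\<Sum>e\<in>Es. sqnorm_on (len \<Gamma> e) (dd f e)) / 2 + Re (graph_ip f f) \<le>
     Re (graph_ip g f) - Re ((flux f - complex_of_real \<alpha> * value_at f) * cnj (value_at f))"
begin

lemma sum_deriv_nonneg: "solves m f g \<Longrightarrow> 0 \<le> (\<Sum>e\<in>Es. sqnorm_on (len \<Gamma> e) (dd f e))"
  by (intro sum_nonneg sqnorm_on_nonneg c1_on_continuous(2)[OF solvesD(5)])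

text \<open>A larger finite coefficient \<open>r\<close> contributes \<open>(r - \<alpha>)\<close>
  times the squared value at \<open>v\<close>, and a Dirichlet condition contributes 0. Hence
  coercivity at \<open>\<alpha>\<close> passes to all larger coefficients.\<close>

lemma robin_nonneg:
  assumes "ereal \<alpha> \<le> a" "graph_conds a f"
  shows "0 \<le> Re ((flux f - complex_of_real \<alpha> * value_at f) * cnj (value_at f))"
proof (cases "a = \<infinity>")
  case True
  then show ?thesis using assms(2) by (simp add: graph_conds_def)
next
  case False
  then obtain r where r: "a = ereal r" "\<alpha> \<le> r" using assms(1) by (cases a) auto
  then have "flux f - complex_of_real \<alpha> * value_at f = complex_of_real (r - \<alpha>) * value_at f"
    using assms(2) by (simp add: graph_conds_def algebra_simps)
  then have "Re ((flux f - complex_of_real \<alpha> * value_at f) * cnj (value_at f)) = (r - \<alpha>) * (cmod (value_at f))\<^sup>2"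
    unfolding cmod_power2 by (simp add: algebra_simps power2_eq_square)
  then show ?thesis using r by simp
qed

lemma coercive:
  assumes "ereal \<alpha> \<le> a" "solves m f g" "graph_conds a f"
  shows "(\<Sum>e\<in>Es. sqnorm_on (len \<Gamma> e) (dd f e)) / 2 + Re (graph_ip f f) \<le> Re (graph_ip g f)"
  using form_bound[OF assms(2)] assms(3) robin_nonneg[OF assms(1,3)] by (auto simp: graph_conds_def)

lemma kernel_trivial:
  assumes "ereal \<alpha> \<le> a" "solves m f 0" "graph_conds a f"
  shows "f = 0"
proof -
  have "Re (graph_ip f f) \<le> 0"
    using coercive[OF assms] sum_deriv_nonneg[OF assms(2)] solvesD(1)[OF assms(2)] by simp
  then show ?thesis using GC.ip_nonneg[of f] GC.ip_definite[of f] solvesD(1)[OF assms(2)] by simp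
qed

lemma resolvent_unique:
  assumes a: "ereal \<alpha> \<le> a" and f: "solves m f g" "graph_conds a f" and u: "solves m u g" "graph_conds a u"
  shows "f = u"
proof -
  have "a \<noteq> -\<infinity>" using a by auto
  from graph_conds_lincomb[OF this f u, of "-1"] have "graph_conds a (f - u)"
    unfolding diff_eq_lincomb .
  moreover have "solves m (f - u) 0" using end_lincomb_diff(1)[OF f(1) u(1)] unfolding diff_self .
  ultimately have "f - u = 0" using kernel_trivial[OF a] by blast
  then show ?thesis unfolding right_minus_eq .
qed

text \<open>A particular solution \<open>P\<close> on the edges is corrected by a homogeneous
  solution \<open>z x\<close>. The vertex conditions form a square linear system for
  \<open>x\<close>, injective since coercivity leaves only 0 as a homogeneous solution satisfying
  them.\<close>

lemma resolvent_exists: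
  assumes a: "ereal \<alpha> \<le> a" and g: "g \<in> graph_continuous"
  shows "\<exists>f. solves m f g \<and> graph_conds a f"
proof -
  have a': "a \<noteq> -\<infinity>" using a by auto
  let ?I = "SIGMA w:Vs. {..<deg \<Gamma> w}"
  obtain A B where AB: "\<And>f. graph_conds a f \<longleftrightarrow> (\<forall>(w, i)\<in>?I.
    (\<Sum>j<deg \<Gamma> w. A w i j * end_value \<Gamma> f (ends \<Gamma> w ! j) + B w i j * end_deriv \<Gamma> f (ends \<Gamma> w ! j)) = 0)"
    using vertex_functionals_exist[OF a'] by blast
  define \<Lambda> where "\<Lambda> = (\<lambda>(w, i) f. \<Sum>j<deg \<Gamma> w. A w i j * end_value \<Gamma> f (ends \<Gamma> w ! j) + B w i j * end_deriv \<Gamma> f (ends \<Gamma> w ! j))"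
  have conds: "graph_conds a f \<longleftrightarrow> (\<forall>p\<in>?I. \<Lambda> p f = 0)" for f
    unfolding AB \<Lambda>_def by (simp add: case_prod_unfold)
  obtain b where b: "\<And>\<epsilon>. \<epsilon> \<in> edge_ends \<Longrightarrow> solves m (b \<epsilon>) 0"
      "\<And>\<epsilon> e. \<epsilon> \<in> edge_ends \<Longrightarrow> e \<in> Es \<Longrightarrow> end_value \<Gamma> (b \<epsilon>) (e, Init) = (if (e, Init) = \<epsilon> then 1 else 0)"
      "\<And>\<epsilon> e. \<epsilon> \<in> edge_ends \<Longrightarrow> e \<in> Es \<Longrightarrow> end_deriv \<Gamma> (b \<epsilon>) (e, Init) = (if (e, Term) = \<epsilon> then 1 else 0)"
    using edge_basis_exists[of m] by blast
  obtain P where P: "solves m P g" using particular_solution_exists[OF g] by blast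
  define z where "z = (\<lambda>x. \<Sum>\<epsilon>\<in>edge_ends. scale_fun (x \<epsilon>) (b \<epsilon>))"
  have zero_sum: "(\<Sum>\<epsilon>\<in>edge_ends. scale_fun (x \<epsilon>) 0) = (0 :: 'e \<Rightarrow> real \<Rightarrow> complex)" for x
    by (intro sum.neutral ballI graph_fun.scale_zero_right)
  have z: "solves m (z x) 0" "\<And>\<delta>. \<delta> \<in> edge_ends \<Longrightarrow> end_value \<Gamma> (z x) \<delta> = (\<Sum>\<epsilon>\<in>edge_ends. x \<epsilon> * end_value \<Gamma> (b \<epsilon>) \<delta>)"
    "\<And>\<delta>. \<delta> \<in> edge_ends \<Longrightarrow> end_deriv \<Gamma> (z x) \<delta> = (\<Sum>\<epsilon>\<in>edge_ends. x \<epsilon> * end_deriv \<Gamma> (b \<epsilon>) \<delta>)" for x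
  proof -
    have zx: "(\<Sum>\<epsilon>\<in>edge_ends. scale_fun (x \<epsilon>) (b \<epsilon>)) = z x" by (simp only: z_def)
    show "solves m (z x) 0" "\<And>\<delta>. \<delta> \<in> edge_ends \<Longrightarrow> end_value \<Gamma> (z x) \<delta> = (\<Sum>\<epsilon>\<in>edge_ends. x \<epsilon> * end_value \<Gamma> (b \<epsilon>) \<delta>)"
      "\<And>\<delta>. \<delta> \<in> edge_ends \<Longrightarrow> end_deriv \<Gamma> (z x) \<delta> = (\<Sum>\<epsilon>\<in>edge_ends. x \<epsilon> * end_deriv \<Gamma> (b \<epsilon>) \<delta>)"
      using solves_sum[OF finite_edge_ends, of m b "\<lambda>_. 0" x] b(1) unfolding zero_sum zx by auto
  qed
  have in_ends: "ends \<Gamma> w ! j \<in> edge_ends" if "w \<in> Vs" "j < deg \<Gamma> w" for w j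
    using ends_subset[OF that(1)] nth_mem[OF that(2)] by blast
  have \<Lambda>z: "\<Lambda> p (z x) = (\<Sum>\<epsilon>\<in>edge_ends. \<Lambda> p (b \<epsilon>) * x \<epsilon>)" if p: "p \<in> ?I" for p x
  proof -
    obtain w i where wi: "p = (w, i)" "w \<in> Vs" using p by auto
    have "\<Lambda> p (z x) = (\<Sum>j<deg \<Gamma> w. \<Sum>\<epsilon>\<in>edge_ends.
        (A w i j * end_value \<Gamma> (b \<epsilon>) (ends \<Gamma> w ! j) + B w i j * end_deriv \<Gamma> (b \<epsilon>) (ends \<Gamma> w ! j)) * x \<epsilon>)"
      unfolding \<Lambda>_def wi prod.case
    proof (intro sum.cong refl)
      fix j assume "j \<in> {..<deg \<Gamma> w}"
      then have j: "ends \<Gamma> w ! j \<in> edge_ends" using in_ends[OF wi(2)] by simp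
      show "A w i j * end_value \<Gamma> (z x) (ends \<Gamma> w ! j) + B w i j * end_deriv \<Gamma> (z x) (ends \<Gamma> w ! j) =
        (\<Sum>\<epsilon>\<in>edge_ends. (A w i j * end_value \<Gamma> (b \<epsilon>) (ends \<Gamma> w ! j) + B w i j * end_deriv \<Gamma> (b \<epsilon>) (ends \<Gamma> w ! j)) * x \<epsilon>)"
        unfolding z(2,3)[OF j] sum_distrib_left sum.distrib[symmetric]
        by (intro sum.cong refl) (simp add: algebra_simps)
    qed
    also have "\<dots> = (\<Sum>\<epsilon>\<in>edge_ends. \<Lambda> p (b \<epsilon>) * x \<epsilon>)"
      unfolding \<Lambda>_def wi prod.case sum_distrib_right by (rule sum.swap)
    finally show ?thesis .
  qed
  have \<Lambda>_add: "\<Lambda> p (P + scale_fun 1 (z x)) = \<Lambda> p P + \<Lambda> p (z x)" if p: "p \<in> ?I" for p x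
  proof -
    obtain w i where wi: "p = (w, i)" "w \<in> Vs" using p by auto
    show ?thesis
      unfolding \<Lambda>_def wi prod.case sum.distrib[symmetric]
    proof (intro sum.cong refl)
      fix j assume "j \<in> {..<deg \<Gamma> w}"
      then have j: "ends \<Gamma> w ! j \<in> edge_ends" using in_ends[OF wi(2)] by simp
      show "A w i j * end_value \<Gamma> (P + scale_fun 1 (z x)) (ends \<Gamma> w ! j) + B w i j * end_deriv \<Gamma> (P + scale_fun 1 (z x)) (ends \<Gamma> w ! j) =
        A w i j * end_value \<Gamma> P (ends \<Gamma> w ! j) + B w i j * end_deriv \<Gamma> P (ends \<Gamma> w ! j) +
        (A w i j * end_value \<Gamma> (z x) (ends \<Gamma> w ! j) + B w i j * end_deriv \<Gamma> (z x) (ends \<Gamma> w ! j))"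
        unfolding solves_lincomb(2,3)[OF P z(1) j, where c = 1] by (simp add: algebra_simps)
    qed
  qed
  have "\<exists>x. \<forall>p\<in>?I. (\<Sum>\<epsilon>\<in>edge_ends. \<Lambda> p (b \<epsilon>) * x \<epsilon>) = - \<Lambda> p P"
  proof (rule square_system_solvable)
    show "finite ?I" using finite_Vs by simp
    show "finite edge_ends" by (rule finite_edge_ends)
    show "card ?I = card edge_ends" by (rule card_edge_ends[symmetric])
    fix x assume "\<forall>p\<in>?I. (\<Sum>\<epsilon>\<in>edge_ends. \<Lambda> p (b \<epsilon>) * x \<epsilon>) = 0"
    then have "graph_conds a (z x)" unfolding conds using \<Lambda>z by simp
    then have z0: "z x = 0" by (rule kernel_trivial[OF a z(1)])
    \<comment> \<open>The coefficients of \<open>z x\<close> are its initial values and slopes, so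
      they vanish together with \<open>z x\<close>.\<close>
    show "\<forall>\<epsilon>\<in>edge_ends. x \<epsilon> = 0"
    proof
      fix \<epsilon> assume \<epsilon>: "\<epsilon> \<in> edge_ends"
      then obtain e s where es: "\<epsilon> = (e, s)" "e \<in> Es" by (auto simp: edge_ends_def)
      have ei: "(e, Init) \<in> edge_ends" using es by (simp add: edge_ends_def)
      show "x \<epsilon> = 0"
      proof (cases s)
        case Init
        have "0 = (\<Sum>\<delta>\<in>edge_ends. x \<delta> * end_value \<Gamma> (b \<delta>) (e, Init))"
          using z(2)[OF ei, of x] end_zero(1)[OF ei] unfolding z0 by simp
        also have "\<dots> = (\<Sum>\<delta>\<in>edge_ends. if \<epsilon> = \<delta> then x \<delta> else 0)"
          by (intro sum.cong refl) (simp only: b(2)[OF _ es(2)] es Init, simp)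
        also have "\<dots> = x \<epsilon>" using finite_edge_ends \<epsilon> by (simp add: sum.delta')
        finally show ?thesis by simp
      next
        case Term
        have "0 = (\<Sum>\<delta>\<in>edge_ends. x \<delta> * end_deriv \<Gamma> (b \<delta>) (e, Init))"
          using z(3)[OF ei, of x] end_zero(2)[OF ei] unfolding z0 by simp
        also have "\<dots> = (\<Sum>\<delta>\<in>edge_ends. if \<epsilon> = \<delta> then x \<delta> else 0)"
          by (intro sum.cong refl) (simp only: b(3)[OF _ es(2)] es Term, simp)
        also have "\<dots> = x \<epsilon>" using finite_edge_ends \<epsilon> by (simp add: sum.delta')
        finally show ?thesis by simp
      qed
    qed
  qed
  then obtain x where x: "\<And>p. p \<in> ?I \<Longrightarrow> (\<Sum>\<epsilon>\<in>edge_ends. \<Lambda> p (b \<epsilon>) * x \<epsilon>) = - \<Lambda> p P" by blast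
  have "graph_conds a (P + scale_fun 1 (z x))"
    unfolding conds
  proof
    fix p assume "p \<in> ?I"
    then show "\<Lambda> p (P + scale_fun 1 (z x)) = 0" unfolding \<Lambda>_add[OF \<open>p \<in> ?I\<close>] \<Lambda>z[OF \<open>p \<in> ?I\<close>] x[OF \<open>p \<in> ?I\<close>] by simp
  qed
  moreover have "solves m (P + scale_fun 1 (z x)) g"
    using solves_lincomb(1)[OF P z(1), of 1 x] unfolding graph_fun.scale_zero_right add_0_right .
  ultimately show ?thesis by blast
qed

definition resolvent :: "ereal \<Rightarrow> ('e \<Rightarrow> real \<Rightarrow> complex) \<Rightarrow> 'e \<Rightarrow> real \<Rightarrow> complex" where
  "resolvent a g = (THE f. solves m f g \<and> graph_conds a f)"

lemma resolvent:
  assumes "ereal \<alpha> \<le> a" "g \<in> graph_continuous"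
  shows "solves m (resolvent a g) g" "graph_conds a (resolvent a g)"
proof -
  have "\<exists>!f. solves m f g \<and> graph_conds a f"
    using resolvent_exists[OF assms] resolvent_unique[OF assms(1)] by blast
  from theI'[OF this] show "solves m (resolvent a g) g" "graph_conds a (resolvent a g)"
    unfolding resolvent_def by blast+
qed

lemma resolvent_eqI:
  assumes "ereal \<alpha> \<le> a" "solves m f g" "graph_conds a f"
  shows "resolvent a g = f"
  using resolvent[OF assms(1) solvesD(2)[OF assms(2)]] by (intro resolvent_unique[OF assms(1) _ _ assms(2,3)])

end

section \<open>Compactness on the whole graph\<close>

context graph_vertex
begin

text \<open>To apply the theorem of Arzela and Ascoli once, the edges are laid out as parallel
  segments at different integer coordinates in the plane; their union is compact and a function on
  the graph becomes one function on it.\<close>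

lemma graph_compactness:
  assumes f: "\<And>n e. e \<in> Es \<Longrightarrow> c1_on (len \<Gamma> e) (f n e) (f' n e)"
    and bound: "\<And>n e. e \<in> Es \<Longrightarrow> sqnorm_on (len \<Gamma> e) (f' n e) \<le> 1"
      "\<And>n e. e \<in> Es \<Longrightarrow> sqnorm_on (len \<Gamma> e) (f n e) \<le> 1"
  shows "\<exists>y k. y \<in> graph_continuous \<and> strict_mono (k :: nat \<Rightarrow> nat) \<and>
    (\<forall>\<epsilon>>0. \<exists>N. \<forall>n\<ge>N. \<forall>e\<in>Es. \<forall>t\<in>{0..len \<Gamma> e}. cmod (f (k n) e t - y e t) < \<epsilon>)"
proof -
  obtain idx :: "'e \<Rightarrow> nat" where idx: "inj_on idx Es"
    using finite_imp_inj_to_nat_seg[OF finite_Es] by blast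
  define ed where "ed = (\<lambda>r::real. inv_into Es idx (nat \<lfloor>r\<rfloor>))"
  have ed: "ed (real (idx e)) = e" if "e \<in> Es" for e using idx that by (simp add: ed_def)
  define S where "S = (\<Union>e\<in>Es. {real (idx e)} \<times> {0..len \<Gamma> e})"
  define F where "F = (\<lambda>n p. f n (ed (fst p)) (snd p))"
  have S_compact: "compact S"
    unfolding S_def using finite_Es by (intro compact_UN compact_Times) auto
  \<comment> \<open>\<open>c1_on_sup_bound\<close> with weight 1 bounds the squared modulus on
    \<open>e\<close> by \<open>2 + 1 / len \<Gamma> e\<close>. As \<open>M\<close> is at least 1, it
    bounds the modulus as well.\<close>
  define M where "M = (\<Sum>e\<in>Es. 2 + 1 / len \<Gamma> e) + 1"
  have M: "2 + 1 / len \<Gamma> e \<le> M" if "e \<in> Es" for e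
  proof -
    have "2 + 1 / len \<Gamma> e \<le> (\<Sum>e\<in>Es. 2 + 1 / len \<Gamma> e)"
    proof (rule member_le_sum[OF that _ finite_Es])
      fix x assume "x \<in> Es - {e}"
      then show "0 \<le> 2 + 1 / len \<Gamma> x" using len_pos[of x] by (intro add_nonneg_nonneg) auto
    qed
    then show ?thesis by (simp add: M_def)
  qed
  obtain g k where g: "continuous_on S g" "strict_mono (k :: nat \<Rightarrow> nat)"
    "\<And>\<epsilon>. 0 < \<epsilon> \<Longrightarrow> \<exists>N. \<forall>n x. n \<ge> N \<and> x \<in> S \<longrightarrow> norm (F (k n) x - g x) < \<epsilon>"
  proof (rule Arzela_Ascoli[OF S_compact, of F M])
    fix n p assume "p \<in> S"
    then obtain e t where p: "p = (real (idx e), t)" "e \<in> Es" "t \<in> {0..len \<Gamma> e}" by (auto simp: S_def)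
    have "(cmod (f n e t))\<^sup>2 \<le> 1 * sqnorm_on (len \<Gamma> e) (f' n e) + (1 / len \<Gamma> e + 1 / 1) * sqnorm_on (len \<Gamma> e) (f n e)"
      by (rule c1_on_sup_bound[OF f[OF p(2)] len_pos[OF p(2)] p(3)]) simp
    also have "\<dots> \<le> 1 * 1 + (1 / len \<Gamma> e + 1 / 1) * 1"
      using len_pos[OF p(2)] bound[OF p(2), of n] by (intro add_mono mult_left_mono) auto
    also have "\<dots> \<le> M" using M[OF p(2)] by simp
    also have "M \<le> M\<^sup>2"
    proof -
      have "1 \<le> M" using M[OF p(2)] len_pos[OF p(2)] by (smt (verit) divide_pos_pos)
      then show ?thesis by (simp add: power2_eq_square)
    qed
    finally have "(cmod (f n e t))\<^sup>2 \<le> M\<^sup>2" .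
    moreover have "0 \<le> M" using M[OF p(2)] len_pos[OF p(2)] by (smt (verit) divide_pos_pos)
    ultimately have "cmod (f n e t) \<le> M" by (rule power2_le_imp_le)
    then show "norm (F n p) \<le> M" using p by (simp add: F_def ed)
  next
    fix p and \<epsilon> :: real assume "p \<in> S" and \<epsilon>: "0 < \<epsilon>"
    then obtain e t where p: "p = (real (idx e), t)" "e \<in> Es" "t \<in> {0..len \<Gamma> e}" by (auto simp: S_def)
    \<comment> \<open>Distance below 1/2 forces both points onto the same edge, and distance below
      \<open>\<epsilon>^2 / 2\<close> makes the second term of the modulus at most
      \<open>\<epsilon> / 4\<close>.\<close>
    define d where "d = min (1/2) (\<epsilon>\<^sup>2 / 2)"
    have d: "0 < d" using \<epsilon> by (simp add: d_def)
    show "\<exists>d. 0 < d \<and> (\<forall>n p'. p' \<in> S \<and> norm (p - p') < d \<longrightarrow> norm (F n p - F n p') < \<epsilon>)"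
    proof (intro exI[of _ d] conjI allI impI d)
      fix n p' assume "p' \<in> S \<and> norm (p - p') < d"
      then obtain e' t' where p': "p' = (real (idx e'), t')" "e' \<in> Es" "t' \<in> {0..len \<Gamma> e'}" and nd: "norm (p - p') < d"
        by (auto simp: S_def)
      have "\<bar>real (idx e) - real (idx e')\<bar> \<le> norm (p - p')" "\<bar>t - t'\<bar> \<le> norm (p - p')"
        using norm_fst_le[of "real (idx e) - real (idx e')" "t - t'"]
          norm_snd_le[of "t - t'" "real (idx e) - real (idx e')"] p(1) p'(1) by auto
      then have close: "\<bar>real (idx e) - real (idx e')\<bar> < 1/2" "\<bar>t - t'\<bar> < \<epsilon>\<^sup>2 / 2"
        using nd by (auto simp: d_def)
      then have "idx e = idx e'" by linarith
      then have ee: "e' = e" using idx p(2) p'(2) by (auto dest: inj_onD)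
      have mod: "cmod (f n e y - f n e x) \<le> \<epsilon> / 2 + \<bar>t - t'\<bar> / (2 * \<epsilon>)"
        if xy: "x \<in> {0..len \<Gamma> e}" "y \<in> {0..len \<Gamma> e}" "x \<le> y" "y - x = \<bar>t - t'\<bar>" for x y
      proof -
        have "cmod (f n e y - f n e x) \<le> \<epsilon> / 2 * sqnorm_on (len \<Gamma> e) (f' n e) + (y - x) / (2 * \<epsilon>)"
          using xy by (intro c1_on_modulus[OF f[OF p(2)]] \<epsilon>) auto
        also have "\<dots> \<le> \<epsilon> / 2 * 1 + (y - x) / (2 * \<epsilon>)"
          using \<epsilon> bound(1)[OF p(2), of n] by (intro add_right_mono mult_left_mono) auto
        finally show ?thesis using xy(4) by simp
      qed
      have "cmod (f n e t - f n e t') \<le> \<epsilon> / 2 + \<bar>t - t'\<bar> / (2 * \<epsilon>)"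
        using mod[of t t'] mod[of t' t] p(3) p'(3) unfolding ee
        by (cases "t \<le> t'") (auto simp: norm_minus_commute)
      also have "\<dots> < \<epsilon> / 2 + (\<epsilon>\<^sup>2 / 2) / (2 * \<epsilon>)"
        using close(2) \<epsilon> by (intro add_strict_left_mono divide_strict_right_mono) auto
      also have "\<dots> \<le> \<epsilon>" using \<epsilon> by (simp add: power2_eq_square field_simps)
      finally show "norm (F n p - F n p') < \<epsilon>" using p p' by (simp add: F_def ed ee)
    qed
  qed blast
  define y where "y = extend (\<lambda>e t. g (real (idx e), t))"
  have "y \<in> graph_continuous"
  proof -
    have "continuous_on {0..len \<Gamma> e} (y e)" if e: "e \<in> Es" for e
    proof -
      have "continuous_on {0..len \<Gamma> e} (\<lambda>t. g (real (idx e), t))"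
        by (rule continuous_on_compose2[OF g(1)]) (use e in \<open>auto intro!: continuous_intros simp: S_def\<close>)
      then show ?thesis by (rule continuous_on_eq) (use e in \<open>simp add: y_def extend_def\<close>)
    qed
    then show ?thesis by (auto simp: graph_continuous_def y_def extend_def)
  qed
  moreover have "\<exists>N. \<forall>n\<ge>N. \<forall>e\<in>Es. \<forall>t\<in>{0..len \<Gamma> e}. cmod (f (k n) e t - y e t) < \<epsilon>" if \<epsilon>: "\<epsilon> > 0" for \<epsilon>
  proof -
    obtain N where N: "\<And>n x. n \<ge> N \<Longrightarrow> x \<in> S \<Longrightarrow> norm (F (k n) x - g x) < \<epsilon>" using g(3)[OF \<epsilon>] by blast
    have "cmod (f (k n) e t - y e t) < \<epsilon>" if "n \<ge> N" "e \<in> Es" "t \<in> {0..len \<Gamma> e}" for n e t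
    proof -
      have "(real (idx e), t) \<in> S" using that by (auto simp: S_def)
      from N[OF that(1) this] show ?thesis using that(2,3) by (simp add: F_def ed y_def extend_def)
    qed
    then show ?thesis by blast
  qed
  ultimately show ?thesis using g(2) by blast
qed

lemma uniform_imp_nrm2_tendsto:
  assumes h: "\<And>n. h n \<in> graph_continuous" "y \<in> graph_continuous"
    and u: "\<And>\<epsilon>. \<epsilon> > 0 \<Longrightarrow> \<exists>N. \<forall>n\<ge>N. \<forall>e\<in>Es. \<forall>t\<in>{0..len \<Gamma> e}. cmod (h n e t - y e t) < \<epsilon>"
  shows "(\<lambda>n. Re (graph_ip (h n - y) (h n - y))) \<longlonglongrightarrow> 0"
proof (rule LIMSEQ_I)
  fix \<delta> :: real assume \<delta>: "0 < \<delta>"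
  \<comment> \<open>Total length plus 1: the surplus keeps \<open>W\<close> positive and turns the
    final estimate into a strict one.\<close>
  define W where "W = (\<Sum>e\<in>Es. len \<Gamma> e) + 1"
  have W: "W > 0" unfolding W_def using len_pos by (intro add_nonneg_pos sum_nonneg) (auto intro: less_imp_le)
  define \<epsilon> where "\<epsilon> = sqrt (\<delta> / W)"
  have \<epsilon>: "\<epsilon> > 0" "\<epsilon>\<^sup>2 = \<delta> / W" using \<delta> W by (auto simp: \<epsilon>_def)
  obtain N where N: "\<And>n e t. n \<ge> N \<Longrightarrow> e \<in> Es \<Longrightarrow> t \<in> {0..len \<Gamma> e} \<Longrightarrow> cmod (h n e t - y e t) < \<epsilon>"
    using u[OF \<epsilon>(1)] by blast
  have "norm (Re (graph_ip (h n - y) (h n - y)) - 0) < \<delta>" if n: "n \<ge> N" for n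
  proof -
    have hy: "h n - y \<in> graph_continuous" using h by (intro GC.X_simps)
    have "sqnorm_on (len \<Gamma> e) ((h n - y) e) \<le> len \<Gamma> e * \<epsilon>\<^sup>2" if e: "e \<in> Es" for e
    proof -
      have "sqnorm_on (len \<Gamma> e) ((h n - y) e) \<le> integral {0..len \<Gamma> e} (\<lambda>t. \<epsilon>\<^sup>2)"
        unfolding sqnorm_on_def
      proof (rule integral_le[OF sqnorm_integrable[OF graph_continuousD(1)[OF hy e]] integrable_const_ivl])
        fix t assume "t \<in> {0..len \<Gamma> e}"
        from N[OF n e this] show "(cmod ((h n - y) e t))\<^sup>2 \<le> \<epsilon>\<^sup>2" by (intro power_mono) auto
      qed
      then show ?thesis using len_pos[OF e] by simp
    qed
    then have "Re (graph_ip (h n - y) (h n - y)) \<le> (\<Sum>e\<in>Es. len \<Gamma> e * \<epsilon>\<^sup>2)"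
      unfolding graph_ip_self[OF hy] Re_complex_of_real by (rule sum_mono)
    also have "\<dots> = (W - 1) * \<epsilon>\<^sup>2" by (simp add: W_def sum_distrib_right)
    also have "\<dots> < \<delta>" using \<epsilon> W \<delta> by (simp add: field_simps)
    finally show ?thesis using GC.ip_nonneg[OF hy] by simp
  qed
  then show "\<exists>N. \<forall>n\<ge>N. norm (Re (graph_ip (h n - y) (h n - y)) - 0) < \<delta>" by blast
qed

end

context graph_resolvent
begin

text \<open>Doubling the coercivity estimate and applying \<open>ip_le\<close> to the right-hand
  side absorbs one squared norm of the solution; the rest is the H^1 bound with constant 1.\<close>

lemma resolvent_bounds:
  assumes a: "ereal \<alpha> \<le> a" and g: "g \<in> graph_continuous"
  shows "(\<Sum>e\<in>Es. sqnorm_on (len \<Gamma> e) (dd (resolvent a g) e)) \<le> Re (graph_ip g g)"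
    "Re (graph_ip (resolvent a g) (resolvent a g)) \<le> Re (graph_ip g g)"
proof -
  let ?f = "resolvent a g"
  note f = resolvent[OF a g]
  note fX = solvesD(1)[OF f(1)]
  have "2 * Re (graph_ip g ?f) \<le> Re (graph_ip g g) + Re (graph_ip ?f ?f)" by (rule GC.ip_le[OF g fX])
  then have *: "(\<Sum>e\<in>Es. sqnorm_on (len \<Gamma> e) (dd ?f e)) + Re (graph_ip ?f ?f) \<le> Re (graph_ip g g)"
    using coercive[OF a f] by simp
  show "(\<Sum>e\<in>Es. sqnorm_on (len \<Gamma> e) (dd ?f e)) \<le> Re (graph_ip g g)"
    using * GC.ip_nonneg[OF fX] by linarith
  show "Re (graph_ip ?f ?f) \<le> Re (graph_ip g g)" using * sum_deriv_nonneg[OF f(1)] by linarith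
qed

lemma resolvent_lincomb:
  assumes a: "ereal \<alpha> \<le> a" and g: "g \<in> graph_continuous" "h \<in> graph_continuous"
  shows "resolvent a (g + scale_fun c h) = resolvent a g + scale_fun c (resolvent a h)"
proof (rule resolvent_eqI[OF a])
  have "a \<noteq> -\<infinity>" using a by auto
  from graph_conds_lincomb[OF this resolvent[OF a g(1)] resolvent[OF a g(2)]]
  show "graph_conds a (resolvent a g + scale_fun c (resolvent a h))" .
  show "solves m (resolvent a g + scale_fun c (resolvent a h)) (g + scale_fun c h)"
    by (rule solves_lincomb(1)[OF resolvent(1)[OF a g(1)] resolvent(1)[OF a g(2)]])
qed

lemma resolvent_zero: "ereal \<alpha> \<le> a \<Longrightarrow> resolvent a 0 = 0"
  by (rule kernel_trivial[OF _ resolvent(1,2)]) auto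

text \<open>Because the coefficient is real, the term at \<open>v\<close> in Green's formula
  disappears for two functions with the same condition. This is the symmetry of the
  resolvent.\<close>

lemma flux_robin_symmetric:
  assumes a: "ereal \<alpha> \<le> a" and f: "graph_conds a f" and u: "graph_conds a u"
  shows "flux f * cnj (value_at u) = value_at f * cnj (flux u)"
  using f u by (auto simp: graph_conds_def split: if_splits)

lemma resolvent_compact_positive:
  assumes a: "ereal \<alpha> \<le> a"
  shows "compact_positive_operator scale_fun graph_continuous graph_ip (resolvent a)"
proof unfold_locales
  show closed: "resolvent a x \<in> graph_continuous" if "x \<in> graph_continuous" for x
    by (rule solvesD(1)[OF resolvent(1)[OF a that]])
  fix x y c assume x: "x \<in> graph_continuous"
  show "resolvent a (scale_fun c x) = scale_fun c (resolvent a x)"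
    using resolvent_lincomb[OF a GC.X_simps(1) x, of c] unfolding resolvent_zero[OF a] add_0_left .
  {
    assume y: "y \<in> graph_continuous"
    show "resolvent a (x + y) = resolvent a x + resolvent a y"
      using resolvent_lincomb[OF a x y, of 1] unfolding graph_fun.scale_one .
    have "graph_ip x (resolvent a y) - graph_ip (resolvent a x) y = 0"
      using graph_green[OF resolvent(1)[OF a x] _ _ resolvent(1)[OF a y]] resolvent(2)[OF a x] resolvent(2)[OF a y]
        flux_robin_symmetric[OF a resolvent(2)[OF a x] resolvent(2)[OF a y]]
      by (simp add: graph_conds_def)
    then show "graph_ip (resolvent a x) y = graph_ip x (resolvent a y)" by simp
  }
  assume x0: "x \<noteq> 0"
  \<comment> \<open>If 0 solves the equation with right-hand side \<open>x\<close>, all indefinite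
    integrals of \<open>x\<close> vanish, and differentiating them gives
    \<open>x = 0\<close>.\<close>
  have "resolvent a x \<noteq> 0"
  proof
    assume 0: "resolvent a x = 0"
    have "x e t = 0" for e t
    proof (cases "e \<in> Es \<and> t \<in> {0..len \<Gamma> e}")
      case True
      then have e: "e \<in> Es" and t: "t \<in> {0..len \<Gamma> e}" by auto
      have sol: "solves m 0 x" using resolvent(1)[OF a x] unfolding 0 .
      have zero: "(0 :: 'e \<Rightarrow> real \<Rightarrow> complex) e = (\<lambda>t. 0)" by (simp add: zero_fun_def)
      have d0: "vector_derivative (\<lambda>t. 0 :: complex) (at u within {0..len \<Gamma> e}) = 0" if "u \<in> {0..len \<Gamma> e}" for u
        by (rule vector_derivative_within_closed_interval[OF len_pos[OF e] that has_vector_derivative_const])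
      have int0: "integral {0..u} (\<lambda>t. - x e t) = 0" if u: "u \<in> {0..len \<Gamma> e}" for u
      proof -
        have "0 \<in> {0..len \<Gamma> e}" using len_pos[OF e] by simp
        then show ?thesis
          using edge_solutionD(2)[OF solvesD(3)[OF sol e] u] unfolding zero d0[OF u] by (simp add: d0)
      qed
      have "((\<lambda>u. integral {0..u} (\<lambda>t. - x e t)) has_vector_derivative - x e t) (at t within {0..len \<Gamma> e})"
        using graph_continuousD(1)[OF x e] by (intro integral_has_vector_derivative[OF _ t] continuous_intros)
      from has_vector_derivative_transform[OF t int0[symmetric] this]
      have "((\<lambda>u. 0) has_vector_derivative - x e t) (at t within {0..len \<Gamma> e})" .
      from vector_derivative_within_closed_interval[OF len_pos[OF e] t this] d0[OF t]
      show ?thesis by simp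
    qed (use graph_continuousD(2)[OF x, of e t] in auto)
    then show False using x0 by (simp add: fun_eq_iff)
  qed
  \<comment> \<open>Coercivity bounds this from below by the squared norm of
    \<open>resolvent a x\<close>.\<close>
  then show "0 < Re (graph_ip (resolvent a x) x)"
    using coercive[OF a resolvent[OF a x]] GC.nrm2_pos[OF closed[OF x]] sum_deriv_nonneg[OF resolvent(1)[OF a x]]
      GC.ip_cnj[OF x closed[OF x]] by simp
next
  show "\<exists>C. \<forall>x\<in>graph_continuous. Re (graph_ip (resolvent a x) (resolvent a x)) \<le> C * Re (graph_ip x x)"
    using resolvent_bounds(2)[OF a] by (intro exI[of _ 1]) simp
next
  fix f :: "nat \<Rightarrow> 'e \<Rightarrow> real \<Rightarrow> complex"
  assume f: "\<And>n. f n \<in> graph_continuous" "\<And>n. Re (graph_ip (f n) (f n)) \<le> 1"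
  let ?h = "\<lambda>n. resolvent a (f n)"
  note h = resolvent(1)[OF a f(1)]
  have c1: "c1_on (len \<Gamma> e) (?h n e) (dd (?h n) e)" if "e \<in> Es" for n e
    by (rule solvesD(5)[OF h that])
  have b1: "sqnorm_on (len \<Gamma> e) (dd (?h n) e) \<le> 1" if e: "e \<in> Es" for n e
  proof -
    have "sqnorm_on (len \<Gamma> e) (dd (?h n) e) \<le> (\<Sum>e\<in>Es. sqnorm_on (len \<Gamma> e) (dd (?h n) e))"
      using finite_Es e sqnorm_on_nonneg[OF c1_on_continuous(2)[OF c1]] by (intro member_le_sum) auto
    then show ?thesis using resolvent_bounds(1)[OF a f(1)[of n]] f(2)[of n] by linarith
  qed
  have b2: "sqnorm_on (len \<Gamma> e) (?h n e) \<le> 1" if e: "e \<in> Es" for n e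
  proof -
    have "sqnorm_on (len \<Gamma> e) (?h n e) \<le> (\<Sum>e\<in>Es. sqnorm_on (len \<Gamma> e) (?h n e))"
      using finite_Es e sqnorm_on_nonneg[OF c1_on_continuous(1)[OF c1]] by (intro member_le_sum) auto
    also have "\<dots> = Re (graph_ip (?h n) (?h n))" unfolding graph_ip_self[OF solvesD(1)[OF h]] by simp
    finally show ?thesis using resolvent_bounds(2)[OF a f(1)[of n]] f(2)[of n] by linarith
  qed
  obtain y k where y: "y \<in> graph_continuous" "strict_mono (k :: nat \<Rightarrow> nat)"
    "\<And>\<epsilon>. \<epsilon> > 0 \<Longrightarrow> \<exists>N. \<forall>n\<ge>N. \<forall>e\<in>Es. \<forall>t\<in>{0..len \<Gamma> e}. cmod (?h (k n) e t - y e t) < \<epsilon>"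
    using graph_compactness[of ?h "\<lambda>n. dd (?h n)", OF c1 b1 b2] by blast
  have "(\<lambda>n. Re (graph_ip (?h (k n) - y) (?h (k n) - y))) \<longlonglongrightarrow> 0"
    by (rule uniform_imp_nrm2_tendsto[OF solvesD(1)[OF h] y(1) y(3)])
  then show "\<exists>y k. y \<in> graph_continuous \<and> strict_mono k \<and>
      (\<lambda>n. Re (graph_ip (resolvent a (f (k n)) - y) (resolvent a (f (k n)) - y))) \<longlonglongrightarrow> 0"
    using y(1,2) by blast
qed

end

subsection \<open>Comparison of the spectra\<close>

lemma sum_graph_fun_apply: "(sum F J) e t = (\<Sum>j\<in>J. F j e (t::real) :: complex)"
  by (induction J rule: infinite_finite_induct) auto

context graph_vertex
begin

text \<open>Orthogonality to \<open>B\<close> imposes \<open>card B\<close> equations on the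
  \<open>card B + 1\<close> coefficients of a polynomial supported on one edge. A nontrivial
  solution gives a nonzero function, since a nonzero polynomial has finitely many roots.\<close>

lemma graph_continuous_infinite_dimensional:
  assumes B: "finite B" "B \<subseteq> graph_continuous"
  shows "\<exists>f\<in>graph_continuous. f \<noteq> 0 \<and> (\<forall>e\<in>B. graph_ip f e = 0)"
proof -
  obtain e0 where e0: "e0 \<in> Es" using Es_nonempty by blast
  define b where "b = (\<lambda>n::nat. extend (\<lambda>e t. if e = e0 then complex_of_real t ^ n else 0))"
  have bX: "b n \<in> graph_continuous" for n
  proof -
    have "continuous_on {0..len \<Gamma> e} (b n e)" if "e \<in> Es" for e
    proof -
      have "continuous_on {0..len \<Gamma> e} (\<lambda>t. if e = e0 then complex_of_real t ^ n else 0)"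
        by (cases "e = e0") (auto intro!: continuous_intros)
      then show ?thesis by (rule continuous_on_eq) (use that in \<open>simp add: b_def extend_def\<close>)
    qed
    then show ?thesis by (auto simp: graph_continuous_def b_def extend_def)
  qed
  obtain c where c: "\<exists>n\<in>{..card B}. c n \<noteq> 0" "\<And>y. y \<in> B \<Longrightarrow> (\<Sum>n\<in>{..card B}. graph_ip (b n) y * c n) = 0"
    using homogeneous_system_nontrivial[of B "{..card B}" "\<lambda>y n. graph_ip (b n) y"] B(1) by auto
  define f where "f = (\<Sum>n\<in>{..card B}. scale_fun (c n) (b n))"
  have fX: "f \<in> graph_continuous" unfolding f_def using bX by (intro GC.X_simps)
  have "graph_ip f y = 0" if y: "y \<in> B" for y
  proof -
    have yX: "y \<in> graph_continuous" using y B by auto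
    have "graph_ip f y = (\<Sum>n\<in>{..card B}. graph_ip (scale_fun (c n) (b n)) y)"
      unfolding f_def by (rule GC.ip_sum[OF GC.X_simps(4)[OF bX] yX])
    also have "\<dots> = (\<Sum>n\<in>{..card B}. graph_ip (b n) y * c n)"
      by (intro sum.cong refl) (simp add: GC.ip_scale[OF bX yX])
    finally show ?thesis using c(2)[OF y] by simp
  qed
  moreover have "f \<noteq> 0"
  proof
    assume f0: "f = 0"
    obtain k where k: "k \<le> card B" "c k \<noteq> 0" using c(1) by auto
    have "complex_of_real ` {0..len \<Gamma> e0} \<subseteq> {z. (\<Sum>n\<le>card B. c n * z ^ n) = 0}"
    proof
      fix z assume "z \<in> complex_of_real ` {0..len \<Gamma> e0}"
      then obtain t where t: "z = complex_of_real t" "t \<in> {0..len \<Gamma> e0}" by blast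
      have "(\<Sum>n\<le>card B. c n * z ^ n) = (\<Sum>n\<in>{..card B}. scale_fun (c n) (b n) e0 t)"
        using t e0 by (intro sum.cong) (auto simp: b_def extend_def scale_fun_def)
      also have "\<dots> = f e0 t" unfolding f_def sum_graph_fun_apply ..
      finally show "z \<in> {z. (\<Sum>n\<le>card B. c n * z ^ n) = 0}" unfolding f0 by simp
    qed
    moreover have "finite {z. (\<Sum>n\<le>card B. c n * z ^ n) = 0}"
      by (rule polyfun_roots_finite[of c k]) (use k in auto)
    ultimately have "finite (complex_of_real ` {0..len \<Gamma> e0})" by (rule finite_subset)
    then have "finite {0..len \<Gamma> e0}" by (rule finite_imageD) (simp add: inj_on_def)
    then show False using len_pos[OF e0] infinite_Icc by blast
  qed
  ultimately show ?thesis using fX by blast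
qed

lemma end_with_delta:
  "end_value (with_delta \<Gamma> v a) = end_value \<Gamma>" "end_deriv (with_delta \<Gamma> v a) = end_deriv \<Gamma>"
proof -
  have "end_value (with_delta \<Gamma> v a) f \<epsilon> = end_value \<Gamma> f \<epsilon>" "end_deriv (with_delta \<Gamma> v a) f \<epsilon> = end_deriv \<Gamma> f \<epsilon>" for f \<epsilon>
  proof -
    obtain e s where "\<epsilon> = (e, s)" by fastforce
    then show "end_value (with_delta \<Gamma> v a) f \<epsilon> = end_value \<Gamma> f \<epsilon>" "end_deriv (with_delta \<Gamma> v a) f \<epsilon> = end_deriv \<Gamma> f \<epsilon>"
      by (cases s; simp add: with_delta_def)+
  qed
  then show "end_value (with_delta \<Gamma> v a) = end_value \<Gamma>" "end_deriv (with_delta \<Gamma> v a) = end_deriv \<Gamma>"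
    by (intro ext; simp only:)+
qed

lemma vertex_with_delta:
  "vertex_values (with_delta \<Gamma> v a) f w = vertex_values \<Gamma> f w"
  "vertex_derivs (with_delta \<Gamma> v a) f w = vertex_derivs \<Gamma> f w"
  unfolding vertex_values_def vertex_derivs_def end_with_delta by (simp_all add: with_delta_def)

text \<open>Valid for every \<open>m\<close>. The shift of the form bound links eigenspaces with the
  resolvent; \<open>m = 0\<close> is used where only the eigenvalue equation itself matters.\<close>

lemma eigenspace_with_delta:
  "eigenspace (with_delta \<Gamma> v a) \<mu> = {f. solves m f (scale_fun (complex_of_real (\<mu> - m)) f) \<and> graph_conds a f}"
proof -
  have wd: "skeleton (with_delta \<Gamma> v a) = skeleton \<Gamma>" "len (with_delta \<Gamma> v a) = len \<Gamma>"
      "potential (with_delta \<Gamma> v a) = potential \<Gamma>" by (simp_all add: with_delta_def)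
  have sc: "scale_fun c f e = (\<lambda>t. c * f e t)" for c and f :: "'e \<Rightarrow> real \<Rightarrow> complex" and e by (simp add: scale_fun_def)
  have eig: "(\<exists>h. H2_with_second_deriv (len \<Gamma> e) (f e) h \<and>
        (AE x in lebesgue_on {0..len \<Gamma> e}. - h x + complex_of_real (potential \<Gamma> e x) * f e x =
          scale_fun (complex_of_real \<mu>) f e x)) \<longleftrightarrow>
      edge_solution (\<lambda>t. potential \<Gamma> e t - m) (len \<Gamma> e) (f e) (dd f e) (scale_fun (complex_of_real (\<mu> - m)) f e)"
    if e: "e \<in> Es" for e f
    unfolding sc by (rule H2_eigenfunction_iff[OF potential_sq[OF e] len_pos[OF e]])
  have maps: "maps_to (with_delta \<Gamma> v a) f (scale_fun (complex_of_real \<mu>) f) \<longleftrightarrow>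
      (\<forall>e x. e \<notin> Es \<or> x \<notin> {0..len \<Gamma> e} \<longrightarrow> f e x = 0) \<and> graph_conds a f \<and>
      (\<forall>e\<in>Es. edge_solution (\<lambda>t. potential \<Gamma> e t - m) (len \<Gamma> e) (f e) (dd f e) (scale_fun (complex_of_real (\<mu> - m)) f e))"
    (is "?L \<longleftrightarrow> ?R") for f
  proof
    assume ?L
    then show ?R
      unfolding maps_to_def operator_domain_def wd vertex_with_delta graph_conds_iff using eig by simp
  next
    assume R: ?R
    then have "\<forall>e\<in>Es. \<exists>h. H2_with_second_deriv (len \<Gamma> e) (f e) h \<and>
        (AE x in lebesgue_on {0..len \<Gamma> e}. - h x + complex_of_real (potential \<Gamma> e x) * f e x =
          scale_fun (complex_of_real \<mu>) f e x)" using eig by simp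
    with R show ?L
      unfolding maps_to_def operator_domain_def wd vertex_with_delta graph_conds_iff by blast
  qed
  have cont: "continuous_on {0..len \<Gamma> e} (f e)"
    if "edge_solution (\<lambda>t. potential \<Gamma> e t - m) (len \<Gamma> e) (f e) (dd f e) g" for f e g
    unfolding continuous_on_eq_continuous_within
    using has_vector_derivative_continuous[OF edge_solutionD(1)[OF that]] by blast
  have "f \<in> eigenspace (with_delta \<Gamma> v a) \<mu> \<longleftrightarrow> solves m f (scale_fun (complex_of_real (\<mu> - m)) f) \<and> graph_conds a f" for f
  proof
    assume "f \<in> eigenspace (with_delta \<Gamma> v a) \<mu>"
    then have R: "\<forall>e x. e \<notin> Es \<or> x \<notin> {0..len \<Gamma> e} \<longrightarrow> f e x = 0" "graph_conds a f"
      "\<And>e. e \<in> Es \<Longrightarrow> edge_solution (\<lambda>t. potential \<Gamma> e t - m) (len \<Gamma> e) (f e) (dd f e) (scale_fun (complex_of_real (\<mu> - m)) f e)"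
      unfolding eigenspace_def mem_Collect_eq maps by blast+
    have "continuous_on {0..len \<Gamma> e} (f e)" if "e \<in> Es" for e by (rule cont[where e = e and f = f, OF R(3)[OF that]])
    then have "f \<in> graph_continuous" unfolding graph_continuous_def using R(1) by blast
    then show "solves m f (scale_fun (complex_of_real (\<mu> - m)) f) \<and> graph_conds a f"
      unfolding solves_def using R(2,3) GC.X_simps(4) by blast
  next
    assume "solves m f (scale_fun (complex_of_real (\<mu> - m)) f) \<and> graph_conds a f"
    then show "f \<in> eigenspace (with_delta \<Gamma> v a) \<mu>"
      unfolding eigenspace_def mem_Collect_eq maps solves_def graph_continuous_def by blast
  qed
  then show ?thesis by blast
qed

lemma value_flux_zero: "value_at 0 = 0" "flux 0 = 0"
proof -
  have sub: "\<epsilon> \<in> edge_ends" if "\<epsilon> \<in> set (ends \<Gamma> v)" for \<epsilon> using ends_subset[OF v] that by auto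
  show "value_at 0 = 0"
  proof (cases "ends \<Gamma> v = []")
    case False
    then have "hd (ends \<Gamma> v) \<in> edge_ends" by (intro sub) simp
    from end_zero(1)[OF this] False show ?thesis by (simp only: value_at_def if_False)
  qed (simp add: value_at_def)
  show "flux 0 = 0" unfolding flux_def by (rule sum.neutral) (use end_zero(2)[OF sub] in blast)
qed

lemma value_flux_scale:
  assumes "solves m f g"
  shows "value_at (scale_fun c f) = c * value_at f" "flux (scale_fun c f) = c * flux f"
  using value_flux_lincomb[OF solves_zero assms, of c] unfolding value_flux_zero add_0_left .

lemma vertex_values_nonzero:
  assumes "graph_conds a f" "vertex_values \<Gamma> f v \<noteq> 0\<^sub>v (deg \<Gamma> v)"
  shows "value_at f \<noteq> 0"
proof
  assume 0: "value_at f = 0"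
  have "vec_index (vertex_values \<Gamma> f v) i = 0" if "i < deg \<Gamma> v" for i
    using assms(1) 0 that by (auto simp: vertex_vec(3) graph_conds_def cont_at_def)
  then have "vertex_values \<Gamma> f v = 0\<^sub>v (deg \<Gamma> v)"
    using vertex_vec(1)[of f v] by (intro eq_vecI) auto
  then show False using assms(2) by simp
qed

text \<open>By Green's formula an eigenfunction \<open>g\<close> for \<open>\<alpha>\<close> at the same eigenvalue vanishes at \<open>v\<close>, together
  with its flux; so it satisfies every \<open>\<delta>\<close>-type condition and is proportional to \<open>f\<close>.\<close>

lemma simple_eigenvalue_not_common:
  assumes a: "ereal \<alpha> < a" and mult: "multiplicity_of (with_delta \<Gamma> v a) \<mu> = 1"
    and f: "f \<in> eigenspace (with_delta \<Gamma> v a) \<mu>" "f \<noteq> 0" "value_at f \<noteq> 0 \<or> flux f \<noteq> 0"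
  shows "multiplicity_of (with_delta \<Gamma> v (ereal \<alpha>)) \<mu> = 0"
proof (rule ccontr)
  assume "multiplicity_of (with_delta \<Gamma> v (ereal \<alpha>)) \<mu> \<noteq> 0"
  then have "\<not> eigenspace (with_delta \<Gamma> v (ereal \<alpha>)) \<mu> \<subseteq> graph_fun.span {}"
    using graph_fun.dim_le_card[of "eigenspace (with_delta \<Gamma> v (ereal \<alpha>)) \<mu>" "{}"] by (auto simp: multiplicity_of_def)
  then obtain g where g: "g \<in> eigenspace (with_delta \<Gamma> v (ereal \<alpha>)) \<mu>" "g \<noteq> 0" by auto
  note es = eigenspace_with_delta[where m = 0]
  let ?c = "complex_of_real (\<mu> - 0)"
  have fs: "solves 0 f (scale_fun ?c f)" "graph_conds a f" using f(1) unfolding es by auto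
  have gs: "solves 0 g (scale_fun ?c g)" "graph_conds (ereal \<alpha>) g" using g(1) unfolding es by auto
  have fX: "f \<in> graph_continuous" and gX: "g \<in> graph_continuous" using solvesD(1)[OF fs(1)] solvesD(1)[OF gs(1)] by auto
  have "graph_ip (scale_fun ?c f) g - graph_ip f (scale_fun ?c g) = flux f * cnj (value_at g) - value_at f * cnj (flux g)"
    using fs(2) gs(2) by (intro graph_green[OF fs(1) _ _ gs(1)]) (auto simp: graph_conds_def)
  then have "flux f * cnj (value_at g) = value_at f * cnj (flux g)"
    unfolding GC.ip_scale[OF fX gX] GC.ip_scale_right[OF gX fX] by simp
  moreover have fg: "flux g = complex_of_real \<alpha> * value_at g" using gs(2) by (simp add: graph_conds_def)
  ultimately have "(flux f - complex_of_real \<alpha> * value_at f) * cnj (value_at g) = 0"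
    by (simp add: algebra_simps)
  \<comment> \<open>Under Dirichlet the value vanishes, so the flux cannot; under a finite
    coefficient \<open>r\<close> the defect is \<open>(r - \<alpha>)\<close> times the value, which
    is nonzero since otherwise the flux would vanish too.\<close>
  moreover have "flux f - complex_of_real \<alpha> * value_at f \<noteq> 0"
  proof (cases "a = \<infinity>")
    case True
    then show ?thesis using fs(2) f(3) by (simp add: graph_conds_def)
  next
    case False
    then obtain r where r: "a = ereal r" "\<alpha> < r" using a by (cases a) auto
    then have "flux f = complex_of_real r * value_at f" using fs(2) by (simp add: graph_conds_def)
    then show ?thesis using r(2) f(3) by (auto simp flip: left_diff_distrib of_real_diff)
  qed
  ultimately have g0: "value_at g = 0" by simp
  then have "flux g = 0" using fg by simp
  then have "graph_conds a g" using g0 gs(2) by (simp add: graph_conds_def)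
  then have gE: "g \<in> eigenspace (with_delta \<Gamma> v a) \<mu>" unfolding es using gs(1) by simp
  \<comment> \<open>A space of dimension one is contained in the span of a single vector, so
    \<open>f\<close> and \<open>g\<close> are multiples of it.\<close>
  obtain B where B: "eigenspace (with_delta \<Gamma> v a) \<mu> \<subseteq> graph_fun.span B" "card B = 1"
    using graph_fun.basis_exists[of "eigenspace (with_delta \<Gamma> v a) \<mu>"] mult unfolding multiplicity_of_def by metis
  then obtain b where b: "B = {b}" by (auto simp: card_1_singleton_iff)
  from f(1) gE B(1) obtain c1 c2 where c12: "f = scale_fun c1 b" "g = scale_fun c2 b"
    unfolding b graph_fun.span_singleton by blast
  have "c1 \<noteq> 0" using f(2) c12(1) by auto
  then have gf: "g = scale_fun (c2 / c1) f" unfolding c12 graph_fun.scale_scale by simp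
  have "c2 / c1 \<noteq> 0" using g(2) gf by auto
  then show False
    using value_flux_scale[OF fs(1), of "c2 / c1"] g0 \<open>flux g = 0\<close> f(3) unfolding gf[symmetric] by auto
qed

end

section \<open>Comparison of two resolvents\<close>

context graph_resolvent
begin

text \<open>The difference \<open>w\<close> of the two resolvents at \<open>x\<close> solves the
  homogeneous equation, and Green's formula turns \<open>graph_ip w x\<close> into two terms at
  \<open>v\<close>. That of \<open>w\<close> has the right sign by the form bound with right-hand
  side 0, that of \<open>?u\<close> by \<open>robin_nonneg\<close>.\<close>

lemma resolvent_antimono:
  assumes a: "ereal \<alpha> \<le> a" and x: "x \<in> graph_continuous"
  shows "Re (graph_ip (resolvent a x) x) \<le> Re (graph_ip (resolvent (ereal \<alpha>) x) x)"
proof -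
  let ?f = "resolvent (ereal \<alpha>) x" and ?u = "resolvent a x"
  define w where "w = ?f - ?u"
  define R where "R = (\<lambda>h. flux h - complex_of_real \<alpha> * value_at h)"
  note f = resolvent[OF order_refl x] and u = resolvent[OF a x]
  note fX = solvesD(1)[OF f(1)] and uX = solvesD(1)[OF u(1)]
  have fc: "other_conds ?f" "cont_at ?f" "R ?f = 0" and uc: "other_conds ?u" "cont_at ?u"
    using f(2) u(2) by (auto simp: graph_conds_def R_def)
  have w: "solves m w 0" "other_conds w" "cont_at w"
    using end_lincomb_diff(1)[OF f(1) u(1)] cont_other_lincomb[OF f(1) fc(1,2) u(1) uc, of "-1"]
    unfolding w_def diff_self diff_eq_lincomb by blast+
  have vw: "value_at w = value_at ?f - value_at ?u" "flux w = flux ?f - flux ?u"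
    using value_flux_lincomb[OF f(1) u(1), of "-1"] unfolding w_def diff_eq_lincomb by simp_all
  have Rw: "R w = - R ?u" using fc(3) by (simp add: R_def vw algebra_simps)
  have "graph_ip 0 ?f - graph_ip w x = flux w * cnj (value_at ?f) - value_at w * cnj (flux ?f)"
    by (rule graph_green[OF w f(1) fc(1,2)])
  moreover have "flux ?f = complex_of_real \<alpha> * value_at ?f" using fc(3) by (simp add: R_def)
  ultimately have "graph_ip w x = - (R w * cnj (value_at ?f))"
    using GC.ip_zero(1)[OF fX] by (simp add: R_def algebra_simps)
  also have "value_at ?f = value_at w + value_at ?u" by (simp add: vw)
  finally have "graph_ip w x = - (R w * cnj (value_at w)) + R ?u * cnj (value_at ?u)"
    by (simp add: Rw algebra_simps)
  moreover have "0 \<le> Re (R ?u * cnj (value_at ?u))" using robin_nonneg[OF a u(2)] by (simp add: R_def)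
  moreover have "0 \<le> - Re (R w * cnj (value_at w))"
    using form_bound[OF w] sum_deriv_nonneg[OF w(1)] GC.ip_nonneg[OF solvesD(1)[OF w(1)]]
      GC.ip_zero(1)[OF solvesD(1)[OF w(1)]] by (simp add: R_def)
  ultimately have "0 \<le> Re (graph_ip w x)" by simp
  then show ?thesis unfolding w_def GC.ip_diff[OF fX uX x] by simp
qed

text \<open>The amount by which \<open>resolvent a x\<close> misses the condition with coefficient
  \<open>\<alpha>\<close>. It is the single linear functional on whose kernel both resolvents
  agree.\<close>

definition robin_defect :: "ereal \<Rightarrow> ('e \<Rightarrow> real \<Rightarrow> complex) \<Rightarrow> complex" where
  "robin_defect a x = flux (resolvent a x) - complex_of_real \<alpha> * value_at (resolvent a x)"

lemma robin_defect_lincomb: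
  assumes a: "ereal \<alpha> \<le> a" and x: "x \<in> graph_continuous" "y \<in> graph_continuous"
  shows "robin_defect a (x + scale_fun c y) = robin_defect a x + c * robin_defect a y"
  unfolding robin_defect_def resolvent_lincomb[OF a x]
    value_flux_lincomb[OF resolvent(1)[OF a x(1)] resolvent(1)[OF a x(2)]]
  by (simp add: algebra_simps)

lemma robin_defect_zero:
  assumes a: "ereal \<alpha> \<le> a" and x: "x \<in> graph_continuous" "robin_defect a x = 0"
  shows "resolvent (ereal \<alpha>) x = resolvent a x"
proof (rule resolvent_eqI[OF order_refl resolvent(1)[OF a x(1)]])
  show "graph_conds (ereal \<alpha>) (resolvent a x)"
    using resolvent(2)[OF a x(1)] x(2) by (simp add: graph_conds_def robin_defect_def)
qed

abbreviation count :: "ereal \<Rightarrow> real \<Rightarrow> nat" where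
  "count a \<equiv> compact_positive_operator.eigenvalue_count scale_fun graph_continuous (resolvent a)"

abbreviation geom :: "ereal \<Rightarrow> real \<Rightarrow> nat" where
  "geom a \<equiv> compact_positive_operator.geom_mult scale_fun graph_continuous (resolvent a)"

text \<open>Two uses of the variational comparison: with no functional, by monotonicity of the
  resolvents, and in the other direction with the one functional \<open>robin_defect a\<close>,
  which accounts for the additional 1.\<close>

lemma count_interlace:
  assumes a: "ereal \<alpha> \<le> a" and t: "t > 0"
  shows "count a t \<le> count (ereal \<alpha>) t" "count (ereal \<alpha>) t \<le> count a t + 1"
proof -
  note c = resolvent_compact_positive[OF a] resolvent_compact_positive[OF order_refl]
  show "count a t \<le> count (ereal \<alpha>) t"
    using GC.eigenvalue_count_le[OF c(2,1), of "{}"] resolvent_antimono[OF a] t by simp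
  have "count (ereal \<alpha>) t \<le> count a t + card {robin_defect a}"
  proof (rule GC.eigenvalue_count_le[OF c])
    show "l (x + y) = l x + l y" if "l \<in> {robin_defect a}" "x \<in> graph_continuous" "y \<in> graph_continuous" for l x y
      using robin_defect_lincomb[OF a that(2,3), of 1] that(1) unfolding graph_fun.scale_one by simp
    have "robin_defect a 0 = 0"
      unfolding robin_defect_def resolvent_zero[OF a] value_flux_zero by simp
    then show "l (scale_fun c x) = c * l x" if "l \<in> {robin_defect a}" "x \<in> graph_continuous" for l c x
      using robin_defect_lincomb[OF a GC.X_simps(1) that(2), of c] that(1) unfolding add_0_left by simp
    show "Re (graph_ip (resolvent (ereal \<alpha>) f) f) \<le> Re (graph_ip (resolvent a f) f)"
      if "f \<in> graph_continuous" "\<forall>l\<in>{robin_defect a}. l f = 0" for f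
      using robin_defect_zero[OF a that(1)] that(2) by simp
  qed (use t in auto)
  then show "count (ereal \<alpha>) t \<le> count a t + 1" by simp
qed

section \<open>From eigenvalues of the resolvent to the eigenvalue lists\<close>

context
  fixes a :: ereal
  assumes a: "ereal \<alpha> \<le> a"
begin

text \<open>Multiplying the resolvent equation by \<open>\<mu> - m\<close> identifies the eigenspace
  for \<open>\<mu>\<close> with that of the resolvent for \<open>1 / (\<mu> - m)\<close>. At and
  below \<open>m\<close> coercivity excludes eigenfunctions.\<close>

lemma multiplicity_eq:
  "multiplicity_of (with_delta \<Gamma> v a) \<mu> = (if m < \<mu> then geom a (1 / (\<mu> - m)) else 0)"
proof -
  interpret T: compact_positive_operator scale_fun graph_continuous graph_ip "resolvent a"
    by (rule resolvent_compact_positive[OF a])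
  let ?c = "complex_of_real (\<mu> - m)"
  note es = eigenspace_with_delta[where m = m]
  show ?thesis
  proof (cases "m < \<mu>")
    case True
    have inv: "complex_of_real (1 / (\<mu> - m)) * ?c = 1" "?c * complex_of_real (1 / (\<mu> - m)) = 1"
      using True by (simp_all flip: of_real_mult)
    have "eigenspace (with_delta \<Gamma> v a) \<mu> = {x \<in> graph_continuous. resolvent a x = scale_fun (complex_of_real (1 / (\<mu> - m))) x}"
      unfolding es
    proof (intro Collect_cong iffI)
      fix f assume f: "solves m f (scale_fun ?c f) \<and> graph_conds a f"
      then have fX: "f \<in> graph_continuous" using solvesD(1) by blast
      have f': "scale_fun ?c (resolvent a f) = f"
        unfolding T.T_scale[OF fX, symmetric] by (rule resolvent_eqI[OF a conjunct1[OF f] conjunct2[OF f]])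
      have "scale_fun (complex_of_real (1 / (\<mu> - m))) (scale_fun ?c (resolvent a f)) = resolvent a f"
        unfolding graph_fun.scale_scale inv(1) graph_fun.scale_one ..
      then have "resolvent a f = scale_fun (complex_of_real (1 / (\<mu> - m))) f"
        unfolding f' by (rule sym)
      then show "f \<in> graph_continuous \<and> resolvent a f = scale_fun (complex_of_real (1 / (\<mu> - m))) f"
        using fX by blast
    next
      fix f assume f: "f \<in> graph_continuous \<and> resolvent a f = scale_fun (complex_of_real (1 / (\<mu> - m))) f"
      then have fX: "f \<in> graph_continuous" by simp
      have "resolvent a (scale_fun ?c f) = f"
        unfolding T.T_scale[OF fX] conjunct2[OF f] graph_fun.scale_scale inv(2) graph_fun.scale_one ..
      then show "solves m f (scale_fun ?c f) \<and> graph_conds a f"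
        using resolvent[OF a GC.X_simps(4)[OF fX], of ?c] by metis
    qed
    then show ?thesis using True unfolding multiplicity_of_def T.geom_mult_def by simp
  next
    case False
    have "f = 0" if "f \<in> eigenspace (with_delta \<Gamma> v a) \<mu>" for f
    proof -
      have f: "solves m f (scale_fun ?c f)" "graph_conds a f" using that unfolding es by auto
      note fX = solvesD(1)[OF f(1)]
      have "Re (graph_ip f f) \<le> Re (graph_ip (scale_fun ?c f) f)"
        using coercive[OF a f] sum_deriv_nonneg[OF f(1)] by simp
      also have "\<dots> = (\<mu> - m) * Re (graph_ip f f)" unfolding GC.ip_scale[OF fX fX] by simp
      also have "\<dots> \<le> 0" using False GC.ip_nonneg[OF fX] by (intro mult_nonpos_nonneg) auto
      finally show ?thesis using GC.nrm2_pos[OF fX] by fastforce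
    qed
    then have "eigenspace (with_delta \<Gamma> v a) \<mu> \<subseteq> graph_fun.span {}" by auto
    then have "multiplicity_of (with_delta \<Gamma> v a) \<mu> = 0"
      using graph_fun.dim_le_card[of "eigenspace (with_delta \<Gamma> v a) \<mu>" "{}"] unfolding multiplicity_of_def by simp
    then show ?thesis using False by simp
  qed
qed

lemma spectrum_image:
  assumes "m < z"
  shows "{\<mu>. \<mu> \<le> z \<and> multiplicity_of (with_delta \<Gamma> v a) \<mu> \<noteq> 0} =
    (\<lambda>\<tau>. m + 1 / \<tau>) ` {\<tau>. 1 / (z - m) \<le> \<tau> \<and> geom a \<tau> \<noteq> 0}"
proof
  show "{\<mu>. \<mu> \<le> z \<and> multiplicity_of (with_delta \<Gamma> v a) \<mu> \<noteq> 0} \<subseteq>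
    (\<lambda>\<tau>. m + 1 / \<tau>) ` {\<tau>. 1 / (z - m) \<le> \<tau> \<and> geom a \<tau> \<noteq> 0}"
  proof
    fix \<mu> assume "\<mu> \<in> {\<mu>. \<mu> \<le> z \<and> multiplicity_of (with_delta \<Gamma> v a) \<mu> \<noteq> 0}"
    then have \<mu>: "\<mu> \<le> z" "m < \<mu>" "geom a (1 / (\<mu> - m)) \<noteq> 0" by (auto simp: multiplicity_eq split: if_splits)
    then have "1 / (z - m) \<le> 1 / (\<mu> - m)" by (intro divide_left_mono mult_pos_pos) auto
    then show "\<mu> \<in> (\<lambda>\<tau>. m + 1 / \<tau>) ` {\<tau>. 1 / (z - m) \<le> \<tau> \<and> geom a \<tau> \<noteq> 0}"
      using \<mu> by (intro image_eqI[of _ _ "1 / (\<mu> - m)"]) auto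
  qed
  show "(\<lambda>\<tau>. m + 1 / \<tau>) ` {\<tau>. 1 / (z - m) \<le> \<tau> \<and> geom a \<tau> \<noteq> 0} \<subseteq>
    {\<mu>. \<mu> \<le> z \<and> multiplicity_of (with_delta \<Gamma> v a) \<mu> \<noteq> 0}"
  proof
    fix \<mu> assume "\<mu> \<in> (\<lambda>\<tau>. m + 1 / \<tau>) ` {\<tau>. 1 / (z - m) \<le> \<tau> \<and> geom a \<tau> \<noteq> 0}"
    then obtain \<tau> where \<mu>: "\<mu> = m + 1 / \<tau>" and \<tau>: "1 / (z - m) \<le> \<tau>" "geom a \<tau> \<noteq> 0" by blast
    have "0 < 1 / (z - m)" using assms by simp
    then have pos: "0 < \<tau>" using \<tau>(1) by linarith
    then have "1 / \<tau> \<le> z - m" using \<tau>(1) assms by (simp add: field_simps)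
    then show "\<mu> \<in> {\<mu>. \<mu> \<le> z \<and> multiplicity_of (with_delta \<Gamma> v a) \<mu> \<noteq> 0}"
      using pos \<tau>(2) by (simp add: multiplicity_eq \<mu>)
  qed
qed

lemma spectrum_finite_below: "finite {\<mu>. \<mu> \<le> z \<and> multiplicity_of (with_delta \<Gamma> v a) \<mu> \<noteq> 0}"
proof (cases "m < z")
  case True
  interpret T: compact_positive_operator scale_fun graph_continuous graph_ip "resolvent a"
    by (rule resolvent_compact_positive[OF a])
  show ?thesis
    unfolding spectrum_image[OF True] using True by (intro finite_imageI T.finite_eigenvalues_above) simp
next
  case False
  then have "{\<mu>. \<mu> \<le> z \<and> multiplicity_of (with_delta \<Gamma> v a) \<mu> \<noteq> 0} = {}" by (auto simp: multiplicity_eq)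
  then show ?thesis by (simp only: finite.emptyI)
qed

lemma spectrum_infinite: "infinite {\<mu>. multiplicity_of (with_delta \<Gamma> v a) \<mu> \<noteq> 0}"
proof -
  interpret T: compact_positive_operator scale_fun graph_continuous graph_ip "resolvent a"
    by (rule resolvent_compact_positive[OF a])
  have "infinite ((\<lambda>\<tau>. m + 1 / \<tau>) ` {\<tau>. 0 < \<tau> \<and> geom a \<tau> \<noteq> 0})"
    using T.infinitely_many_eigenvalues[OF graph_continuous_infinite_dimensional]
    by (subst finite_image_iff) (auto simp: inj_on_def)
  moreover have "(\<lambda>\<tau>. m + 1 / \<tau>) ` {\<tau>. 0 < \<tau> \<and> geom a \<tau> \<noteq> 0} \<subseteq> {\<mu>. multiplicity_of (with_delta \<Gamma> v a) \<mu> \<noteq> 0}"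
    by (auto simp: multiplicity_eq)
  ultimately show ?thesis by (meson infinite_super)
qed

lemma count_le_eq:
  "count_le (multiplicity_of (with_delta \<Gamma> v a)) z = (if m < z then count a (1 / (z - m)) else 0)"
proof (cases "m < z")
  case True
  interpret T: compact_positive_operator scale_fun graph_continuous graph_ip "resolvent a"
    by (rule resolvent_compact_positive[OF a])
  have pos: "0 < \<tau>" if "1 / (z - m) \<le> \<tau>" for \<tau>
  proof -
    have "0 < 1 / (z - m)" using True by simp
    then show ?thesis using that by linarith
  qed
  have inj: "inj_on (\<lambda>\<tau>. m + 1 / \<tau>) {\<tau>. 1 / (z - m) \<le> \<tau> \<and> geom a \<tau> \<noteq> 0}"
    using pos by (auto simp: inj_on_def)
  have "count_le (multiplicity_of (with_delta \<Gamma> v a)) z =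
    (\<Sum>\<tau> | 1 / (z - m) \<le> \<tau> \<and> geom a \<tau> \<noteq> 0. multiplicity_of (with_delta \<Gamma> v a) (m + 1 / \<tau>))"
    unfolding count_le_def spectrum_image[OF True] sum.reindex[OF inj] o_def ..
  also have "\<dots> = (\<Sum>\<tau> | 1 / (z - m) \<le> \<tau> \<and> geom a \<tau> \<noteq> 0. geom a \<tau>)"
    by (intro sum.cong refl) (use pos in \<open>auto simp: multiplicity_eq\<close>)
  finally show ?thesis using True by (simp add: T.eigenvalue_count_def)
next
  case False
  then have "{\<mu>. \<mu> \<le> z \<and> multiplicity_of (with_delta \<Gamma> v a) \<mu> \<noteq> 0} = {}" by (auto simp: multiplicity_eq)
  then show ?thesis using False unfolding count_le_def by simp
qed

text \<open>The first point where \<open>eigenval\<close> is known to denote the intended list; it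
  is the list indexed from 0, hence the shift by one.\<close>

lemma eigenval_enumerates:
  "\<exists>s. enumerates (multiplicity_of (with_delta \<Gamma> v a)) s \<and> (\<forall>n. eigenval (with_delta \<Gamma> v a) n = s (n - 1))"
proof -
  have "lists_eigenvalues (with_delta \<Gamma> v a) = enumerates (multiplicity_of (with_delta \<Gamma> v a))"
    by (auto simp: lists_eigenvalues_def enumerates_def fun_eq_iff)
  then show ?thesis
    using theI'[OF enumerates_ex1[OF spectrum_finite_below spectrum_infinite]]
    unfolding eigenval_def by auto
qed

end

lemma eigenval_interlace:
  assumes a: "ereal \<alpha> \<le> a" and n: "n \<ge> 1"
  shows "eigenval (with_delta \<Gamma> v (ereal \<alpha>)) n \<le> eigenval (with_delta \<Gamma> v a) n"
    "eigenval (with_delta \<Gamma> v a) n \<le> eigenval (with_delta \<Gamma> v (ereal \<alpha>)) (n + 1)"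
proof -
  obtain s where s: "enumerates (multiplicity_of (with_delta \<Gamma> v (ereal \<alpha>))) s"
    "\<And>n. eigenval (with_delta \<Gamma> v (ereal \<alpha>)) n = s (n - 1)" using eigenval_enumerates[OF order_refl] by blast
  obtain s' where s': "enumerates (multiplicity_of (with_delta \<Gamma> v a)) s'"
    "\<And>n. eigenval (with_delta \<Gamma> v a) n = s' (n - 1)" using eigenval_enumerates[OF a] by blast
  have le: "count_le (multiplicity_of (with_delta \<Gamma> v a)) z \<le> count_le (multiplicity_of (with_delta \<Gamma> v (ereal \<alpha>))) z"
    "count_le (multiplicity_of (with_delta \<Gamma> v (ereal \<alpha>))) z \<le> count_le (multiplicity_of (with_delta \<Gamma> v a)) z + 1" for z
    using count_interlace[OF a, of "1 / (z - m)"] by (auto simp: count_le_eq[OF a] count_le_eq[OF order_refl])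
  note il = enumerates_interlace[OF spectrum_finite_below[OF order_refl] spectrum_finite_below[OF a] s(1) s'(1) le]
  show "eigenval (with_delta \<Gamma> v (ereal \<alpha>)) n \<le> eigenval (with_delta \<Gamma> v a) n"
    unfolding s(2) s'(2) by (rule il(1))
  \<comment> \<open>Here \<open>n \<ge> 1\<close> matters: for \<open>n = 0\<close> the truncated
    \<open>n - 1\<close> would make both labels refer to index 0.\<close>
  show "eigenval (with_delta \<Gamma> v a) n \<le> eigenval (with_delta \<Gamma> v (ereal \<alpha>)) (n + 1)"
    unfolding s(2) s'(2) using il(2)[of "n - 1"] n by simp
qed

lemma multiplicity_eigenval:
  assumes a: "ereal \<alpha> \<le> a"
  shows "multiplicity_of (with_delta \<Gamma> v a) (eigenval (with_delta \<Gamma> v a) n) \<noteq> 0"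
proof -
  obtain s where s: "enumerates (multiplicity_of (with_delta \<Gamma> v a)) s"
    "\<And>n. eigenval (with_delta \<Gamma> v a) n = s (n - 1)" using eigenval_enumerates[OF a] by blast
  show ?thesis unfolding s(2) by (rule enumerates_value[OF s(1)])
qed

end

theorem theorem5p1:
  fixes \<Gamma> \<Gamma>' :: "('v, 'e) quantum_graph" and v :: 'v and \<alpha> :: real and \<alpha>' :: ereal
  assumes "compact_quantum_graph \<Gamma>"
    and "v \<in> verts (skeleton \<Gamma>)"
    and "vcond \<Gamma> v = delta_cond (ereal \<alpha>)"
    and "\<Gamma>' = with_delta \<Gamma> v \<alpha>'"
    and "ereal \<alpha> < \<alpha>'"
  shows "\<forall>n \<ge> 1.
     (eigenval \<Gamma> n \<le> eigenval \<Gamma>' n \<and> eigenval \<Gamma>' n \<le> eigenval \<Gamma> (n + 1)) \<and>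
     (\<forall>f. multiplicity_of \<Gamma>' (eigenval \<Gamma>' n) = 1 \<and>
          f \<in> eigenspace \<Gamma>' (eigenval \<Gamma>' n) \<and> f \<noteq> 0 \<and>
          (vertex_values \<Gamma>' f v \<noteq> 0\<^sub>v (deg \<Gamma>' v) \<or>
           (\<Sum>i < deg \<Gamma>' v. vec_index (vertex_derivs \<Gamma>' f v) i) \<noteq> 0)
        \<longrightarrow> eigenval \<Gamma> n < eigenval \<Gamma>' n \<and> eigenval \<Gamma>' n < eigenval \<Gamma> (n + 1))"
proof -
  interpret G: graph_vertex \<Gamma> v using assms(1,2) by unfold_locales
  obtain m where m: "\<And>f g. G.solves m f g \<Longrightarrow> G.other_conds f \<Longrightarrow> G.cont_at f \<Longrightarrow>
     (\<Sum>e\<in>arcs (skeleton \<Gamma>). sqnorm_on (len \<Gamma> e) (G.dd f e)) / 2 + Re (G.graph_ip f f) \<le>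
     Re (G.graph_ip g f) - Re ((G.flux f - complex_of_real \<alpha> * G.value_at f) * cnj (G.value_at f))"
    using G.graph_form_bound[of \<alpha>] by blast
  interpret R: graph_resolvent \<Gamma> v \<alpha> m using m by unfold_locales
  \<comment> \<open>The graph already carries the condition with coefficient \<open>\<alpha>\<close>
    at \<open>v\<close>, so the results about \<open>with_delta\<close> speak about
    \<open>\<Gamma>\<close> itself.\<close>
  have \<Gamma>: "with_delta \<Gamma> v (ereal \<alpha>) = \<Gamma>" using assms(3) by (simp add: with_delta_def flip: assms(3))
  have le: "ereal \<alpha> \<le> \<alpha>'" using assms(5) by simp
  have deg: "deg (with_delta \<Gamma> v \<alpha>') v = deg \<Gamma> v" by (simp add: with_delta_def)
  \<comment> \<open>Every entry of the list of \<open>\<Gamma>\<close> is an eigenvalue of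
    \<open>\<Gamma>\<close>, whereas the simple eigenvalue of \<open>\<Gamma>'\<close> is none; so
    neither of the weak inequalities can be an equality.\<close>
  have strict: "eigenval \<Gamma> k \<noteq> eigenval \<Gamma>' n"
    if "multiplicity_of \<Gamma>' (eigenval \<Gamma>' n) = 1" "f \<in> eigenspace \<Gamma>' (eigenval \<Gamma>' n)" "f \<noteq> 0"
      and nz: "vertex_values \<Gamma>' f v \<noteq> 0\<^sub>v (deg \<Gamma>' v) \<or> (\<Sum>i < deg \<Gamma>' v. vec_index (vertex_derivs \<Gamma>' f v) i) \<noteq> 0"
    for f k n
  proof -
    have "G.graph_conds \<alpha>' f" using that(2) unfolding assms(4) G.eigenspace_with_delta[where m = 0] by blast
    then have "G.value_at f \<noteq> 0 \<or> G.flux f \<noteq> 0"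
      using nz G.vertex_values_nonzero[of \<alpha>' f] unfolding assms(4) deg G.vertex_with_delta G.flux_vertex by blast
    from G.simple_eigenvalue_not_common[OF assms(5) that(1-3)[unfolded assms(4)] this]
    have "multiplicity_of \<Gamma> (eigenval \<Gamma>' n) = 0" unfolding \<Gamma> assms(4) .
    then show ?thesis using R.multiplicity_eigenval[OF order_refl, of k] unfolding \<Gamma> by metis
  qed
  have weak: "eigenval \<Gamma> n \<le> eigenval \<Gamma>' n" "eigenval \<Gamma>' n \<le> eigenval \<Gamma> (n + 1)" if "n \<ge> 1" for n
    using R.eigenval_interlace[OF le that] unfolding \<Gamma> assms(4) by blast+
  show ?thesis
  proof (intro allI impI conjI)
    fix n :: nat and f assume n: "1 \<le> n"
    show "eigenval \<Gamma> n \<le> eigenval \<Gamma>' n" "eigenval \<Gamma>' n \<le> eigenval \<Gamma> (n + 1)" by (rule weak[OF n])+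
    assume "multiplicity_of \<Gamma>' (eigenval \<Gamma>' n) = 1 \<and>
          f \<in> eigenspace \<Gamma>' (eigenval \<Gamma>' n) \<and> f \<noteq> 0 \<and>
          (vertex_values \<Gamma>' f v \<noteq> 0\<^sub>v (deg \<Gamma>' v) \<or>
           (\<Sum>i < deg \<Gamma>' v. vec_index (vertex_derivs \<Gamma>' f v) i) \<noteq> 0)"
    then have ne: "eigenval \<Gamma> k \<noteq> eigenval \<Gamma>' n" for k using strict by blast
    show "eigenval \<Gamma> n < eigenval \<Gamma>' n" using weak(1)[OF n] ne[of n] by simp
    show "eigenval \<Gamma>' n < eigenval \<Gamma> (n + 1)" using weak(2)[OF n] ne[of "n + 1"] by simp
  qed
qed

end
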